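(* Let $K^\star\subset\mathbb{R}^d$ and $C\subset\mathbb{R}^q$ be (nonempty) compact convex sets, and suppose that $\mathrm{Aut}(C)$ is a subgroup of $O(q,\mathbb{R})$. Let $(u^{(i)},y^{(i)})$, $i\ge1$, be i.i.d. draws from $P_{K^\star}$ and let $P_{n,K^\star}$ be the empirical measure of the first $n$. Suppose there exists $\hat A\in L(\mathbb{R}^q,\mathbb{R}^d)$ such that: - $M_{K^\star,C}=\hat A\cdot\mathrm{Aut}(C)$ (the set of minimizers is a single orbit); - $h_C$ is differentiable at $\hat A^Tu$ for $P_{K^\star}$-a.e. $u$; - the function $\Phi_C(\cdot,P_{K^\star})$ is twice differentiable at $\hat A$, and its Hessian $\Gamma$ at $\hat A$ is positive definite restricted to the subspace $T^\perp$, i.e. $\Gamma|_{T^\perp}\succ0$, where $T:=T_{\hat A}M_{K^\star,C}$ is the tangent space of $M_{K^\star,C}$ at $\hat A$; - the collection of subsets of $S^{d-1}\times\mathbb{R}\times\mathbb{R}$ $$\Big\{\big\{(u,y,s)\ :\ d_{C,A,\hat A}(u,y)\ge s\ge0\ \text{ or }\ d_{C,A,\hat A}(u,y)\le s\le0\big\}\ :\ A\in B_{\|\cdot\|_F}(\hat A)\setminus\{\hat A\}\Big\}$$ is a VC class. Let $\hat A_n\in\mathrm{argmin}_A\Phi_C(A,P_{n,K^\star})$, $n\in\mathbb{N}$, be a sequence of minimizers of the empirical loss, and let $\tilde A_n\in\mathrm{argmin}_{A\in\hat A_n\cdot\mathrm{Aut}(C)}\|\hat A-A\|_F$, $n\in\mathbb{N}$.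 Set $\nabla=\nabla_A\big((h_C(A^Tu)-y)^2\big)$. Then $$\sqrt n\,(\tilde A_n-\hat A)\ \overset{D}{\to}\ \mathcal{N}\Big(0,\ (\Gamma|_{T^\perp})^{-1}\big(\mathbb{E}_{P_{K^\star}}[\nabla\otimes\nabla|_{A=\hat A}]\big|_{T^\perp}\big)(\Gamma|_{T^\perp})^{-1}\Big).$$
   Context: $L(\mathbb{R}^q,\mathbb{R}^d)$ is the space of linear maps $\mathbb{R}^q\to\mathbb{R}^d$ with the Frobenius inner product and norm $\|\cdot\|_F$; $B_{\|\cdot\|_F}(\hat A)=\{A:\|A-\hat A\|_F\le1\}$. $S^{d-1}$ is the unit sphere of $\mathbb{R}^d$; $h_K(u)=\sup_{x\in K}\langle x,u\rangle$. $P_{K^\star}$ is the law of $(u,y)\in S^{d-1}\times\mathbb{R}$ with $y=h_{K^\star}(u)+\varepsilon$, where $u$ is uniform on $S^{d-1}$, $\varepsilon$ is independent of $u$, $\mathbb{E}[\varepsilon]=0$, $\mathbb{E}[\varepsilon^2]=\sigma^2<\infty$. $\Phi_C(A,P):=\mathbb{E}_P[(h_C(A^Tu)-y)^2]$ and $M_{K^\star,C}:=\mathrm{argmin}_{A\in L(\mathbb{R}^q,\mathbb{R}^d)}\Phi_C(A,P_{K^\star})$. $\mathrm{Aut}(C)$ is the set of linear transformations $g$ of $\mathbb{R}^q$ with $g(C)=C$; $A\cdot\mathrm{Aut}(C)=\{Ag:g\in\mathrm{Aut}(C)\}$. Since $\mathrm{Aut}(C)$ is a compact matrix Lie group, each such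 orbit is a smooth submanifold of $L(\mathbb{R}^q,\mathbb{R}^d)$. For $A_1\ne A_2$, $d_{C,A_1,A_2}(u,y)=\frac{1}{\|A_1-A_2\|_F}\big((h_C(A_1^Tu)-y)^2-(h_C(A_2^Tu)-y)^2\big)$. A collection $\mathcal{F}$ of subsets of a set shatters a finite set $D$ if for every $A\subset D$ there is $G\in\mathcal{F}$ with $A=G\cap D$; $\mathcal{F}$ is a VC (Vapnik-Chervonenkis) class if there is a finite $k$ such that no set of cardinality greater than $k$ is shattered by $\mathcal{F}$. For a self-adjoint operator (or quadratic form) $Q$ on $L(\mathbb{R}^q,\mathbb{R}^d)$, $Q|_{T^\perp}$ is its restriction (compression) to $T^\perp$; the limiting Gaussian is supported on $T^\perp$. $\overset{D}{\to}$ is convergence in distribution. *)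

theory Defs
  imports "HOL-Probability.Probability"
begin

section \<open>Support functions and automorphisms\<close>

definition support_fun :: "'a::euclidean_space set \<Rightarrow> 'a \<Rightarrow> real" where
  "support_fun K u = (SUP x\<in>K. x \<bullet> u)"

text \<open>
  Linear maps from \<open>real ^ 'q\<close> to \<open>real ^ 'd\<close> are matrices of type \<open>real ^ 'q ^ 'd\<close>, on which
  the library's inner product and norm are the Frobenius ones.
\<close>

definition Aut :: "(real ^ 'q) set \<Rightarrow> (real ^ 'q ^ 'q) set" where
  "Aut C = {g. (\<lambda>x. g *v x) ` C = C}"

definition orbit :: "real ^ 'q ^ 'd \<Rightarrow> (real ^ 'q) set \<Rightarrow> (real ^ 'q ^ 'd) set" where
  "orbit A C = (\<lambda>g. A ** g) ` Aut C"

lemma inner_matrix_eq_Frobenius: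
  fixes A B :: "real ^ 'q ^ 'd"
  shows "A \<bullet> B = (\<Sum>i\<in>UNIV. \<Sum>j\<in>UNIV. A $ i $ j * B $ i $ j)"
  by (simp add: inner_vec_def)

text \<open>
  \<open>Aut C\<close> is not required to consist of invertible maps a priori, but it is a subgroup of the
  orthogonal group as soon as it is contained in it.
\<close>

lemma Aut_subgroup:
  fixes C :: "(real ^ 'q) set"
  assumes "Aut C \<subseteq> {g. orthogonal_matrix g}"
  shows "mat 1 \<in> Aut C"
    and "\<And>g h. g \<in> Aut C \<Longrightarrow> h \<in> Aut C \<Longrightarrow> g ** h \<in> Aut C"
    and "\<And>g. g \<in> Aut C \<Longrightarrow> transpose g \<in> Aut C \<and> transpose g ** g = mat 1 \<and> g ** transpose g = mat 1"
proof -
  show "mat 1 \<in> Aut C"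
    by (simp add: Aut_def)
  show "g ** h \<in> Aut C" if "g \<in> Aut C" "h \<in> Aut C" for g h
    using that by (simp add: Aut_def matrix_vector_mul_assoc[symmetric] image_image[symmetric])
  show "transpose g \<in> Aut C \<and> transpose g ** g = mat 1 \<and> g ** transpose g = mat 1"
    if g: "g \<in> Aut C" for g
  proof -
    have o: "transpose g ** g = mat 1 \<and> g ** transpose g = mat 1"
      using assms g by (auto simp: orthogonal_matrix_def)
    have "(\<lambda>x. transpose g *v x) ` C = (\<lambda>x. transpose g *v x) ` (\<lambda>x. g *v x) ` C"
      using g by (simp add: Aut_def)
    also have "\<dots> = C"
      using o by (simp add: image_image matrix_vector_mul_assoc del: transpose_matrix_vector)
    finally show ?thesis
      using o by (simp add: Aut_def)
  qed
qed


section \<open>The regression model\<close>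

text \<open>
  The uniform distribution on the unit sphere, as the image of the uniform distribution on the
  unit ball under radial projection. (The center, a null set, is mapped to \<open>0\<close>.)
\<close>

definition sphere_uniform :: "'a::euclidean_space measure" where
  "sphere_uniform = distr (uniform_measure lborel (cball 0 1)) borel (\<lambda>x. x /\<^sub>R norm x)"

text \<open>
  The law of \<open>(u, support_fun K u + e)\<close>, where \<open>u\<close> is uniform on the sphere and \<open>e\<close> is
  independent of \<open>u\<close> with law \<open>\<nu>\<close>.
\<close>

definition regression_law ::
    "'a::euclidean_space set \<Rightarrow> real measure \<Rightarrow> ('a \<times> real) measure" where
  "regression_law K \<nu> =
     distr (sphere_uniform \<Otimes>\<^sub>M \<nu>) borel (\<lambda>(u, e). (u, support_fun K u + e))"

definition empirical_measure :: "nat \<Rightarrow> (nat \<Rightarrow> 'a::topological_space) \<Rightarrow> 'a measure" where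
  "empirical_measure n z = distr (uniform_count_measure {..<n}) borel z"

definition sq_loss ::
    "(real ^ 'q) set \<Rightarrow> real ^ 'q ^ 'd \<Rightarrow> (real ^ 'd) \<times> real \<Rightarrow> real" where
  "sq_loss C A = (\<lambda>(u, y). (support_fun C (transpose A *v u) - y)\<^sup>2)"

definition risk ::
    "(real ^ 'q) set \<Rightarrow> real ^ 'q ^ 'd \<Rightarrow> ((real ^ 'd) \<times> real) measure \<Rightarrow> real" where
  "risk C A P = (\<integral>z. sq_loss C A z \<partial>P)"

definition argmin_set :: "('a \<Rightarrow> 'b::ord) \<Rightarrow> 'a set \<Rightarrow> 'a set" where
  "argmin_set f S = {x. is_arg_min f (\<lambda>x. x \<in> S) x}"

definition risk_minimizers ::
    "(real ^ 'q) set \<Rightarrow> ((real ^ 'd) \<times> real) measure \<Rightarrow> (real ^ 'q ^ 'd) set" where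
  "risk_minimizers C P = argmin_set (\<lambda>A. risk C A P) UNIV"

definition loss_quotient ::
    "(real ^ 'q) set \<Rightarrow> real ^ 'q ^ 'd \<Rightarrow> real ^ 'q ^ 'd \<Rightarrow> (real ^ 'd) \<times> real \<Rightarrow> real" where
  "loss_quotient C A1 A2 z = (sq_loss C A1 z - sq_loss C A2 z) / norm (A1 - A2)"


section \<open>VC classes\<close>

definition shatters :: "'a set set \<Rightarrow> 'a set \<Rightarrow> bool" where
  "shatters F D \<longleftrightarrow> (\<forall>A\<subseteq>D. \<exists>G\<in>F. A = G \<inter> D)"

definition VC_class :: "'a set set \<Rightarrow> bool" where
  "VC_class F \<longleftrightarrow> (\<exists>k. \<forall>D. finite D \<and> card D > k \<longrightarrow> \<not> shatters F D)"

definition loss_quotient_graphs ::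
    "(real ^ 'q) set \<Rightarrow> real ^ 'q ^ 'd \<Rightarrow> ((real ^ 'd) \<times> real \<times> real) set set" where
  "loss_quotient_graphs C A0 =
     (\<lambda>A. {(u, y, s). u \<in> sphere 0 1 \<and>
             (loss_quotient C A A0 (u, y) \<ge> s \<and> s \<ge> 0 \<or>
              loss_quotient C A A0 (u, y) \<le> s \<and> s \<le> 0)}) ` (cball A0 1 - {A0})"


section \<open>Derivatives and tangent spaces\<close>

text \<open>Off the points of differentiability the value of \<open>gradient\<close> is unspecified.\<close>

definition gradient :: "('a::real_inner \<Rightarrow> real) \<Rightarrow> 'a \<Rightarrow> 'a" where
  "gradient f x = (THE D. GDERIV f x :> D)"

text \<open>
  \<open>f\<close> is twice differentiable at \<open>x\<close>, in the Frechet sense, and its Hessian there, regarded as a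
  linear operator, is \<open>H\<close>.
\<close>

definition has_hessian ::
    "('a::real_inner \<Rightarrow> real) \<Rightarrow> ('a \<Rightarrow> 'a) \<Rightarrow> 'a \<Rightarrow> bool" where
  "has_hessian f H x \<longleftrightarrow>
     (\<exists>g. (\<forall>\<^sub>F y in nhds x. GDERIV f y :> g y) \<and> (g has_derivative H) (at x))"

text \<open>
  Velocities at time \<open>0\<close> of the smooth curves in \<open>S\<close> that pass through \<open>x\<close> at time \<open>0\<close>; here
  \<open>c k\<close> is the derivative of order \<open>k\<close> of the curve \<open>c 0\<close>.
\<close>

definition tangent_space :: "'a::real_normed_vector set \<Rightarrow> 'a \<Rightarrow> 'a set" where
  "tangent_space S x =
     {v. \<exists>e>0. \<exists>c :: nat \<Rightarrow> real \<Rightarrow> 'a.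
           (\<forall>k. \<forall>t\<in>{-e<..<e}. (c k has_vector_derivative c (Suc k) t) (at t)) \<and>
           (\<forall>t\<in>{-e<..<e}. c 0 t \<in> S) \<and> c 0 0 = x \<and> c 1 0 = v}"


section \<open>Operators on a subspace\<close>

text \<open>
  For a subspace \<open>S\<close>, \<open>closest_point S\<close> is the orthogonal projection onto \<open>S\<close>, so on \<open>S\<close> the
  following is the compression of \<open>Q\<close> to \<open>S\<close>.
\<close>

definition compression :: "'a::euclidean_space set \<Rightarrow> ('a \<Rightarrow> 'a) \<Rightarrow> 'a \<Rightarrow> 'a" where
  "compression S Q x = closest_point S (Q x)"

text \<open>The integral of the rank-one operators \<open>G z \<otimes> G z\<close>.\<close>

definition second_moment_op ::
    "'z measure \<Rightarrow> ('z \<Rightarrow> 'a::euclidean_space) \<Rightarrow> 'a \<Rightarrow> 'a" where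
  "second_moment_op P G h = (\<integral>z. (G z \<bullet> h) *\<^sub>R G z \<partial>P)"

text \<open>
  The operator \<open>inverse (H|S) \<circ> V|S \<circ> inverse (H|S)\<close> on \<open>S\<close>, extended by zero to the orthogonal
  complement of \<open>S\<close>.
\<close>

definition sandwich ::
    "'a::euclidean_space set \<Rightarrow> ('a \<Rightarrow> 'a) \<Rightarrow> ('a \<Rightarrow> 'a) \<Rightarrow> 'a \<Rightarrow> 'a" where
  "sandwich S H V h =
     (let Hinv = inv_into S (compression S H)
      in Hinv (compression S V (Hinv (closest_point S h))))"


section \<open>Gaussian measures and convergence in distribution\<close>

definition normal_law :: "real \<Rightarrow> real \<Rightarrow> real measure" where
  "normal_law m v =
     (if v = 0 then return borel m else density lborel (\<lambda>x. ennreal (normal_density m (sqrt v) x)))"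

text \<open>
  \<open>N\<close> is the (possibly degenerate) normal distribution with mean \<open>m\<close> and covariance operator \<open>Q\<close>:
  every linear functional \<open>h\<close> has law \<open>normal_law (m \<bullet> h) (Q h \<bullet> h)\<close>.
\<close>

definition is_gaussian ::
    "'a::euclidean_space measure \<Rightarrow> 'a \<Rightarrow> ('a \<Rightarrow> 'a) \<Rightarrow> bool" where
  "is_gaussian N m Q \<longleftrightarrow>
     prob_space N \<and> sets N = sets borel \<and>
     linear Q \<and> (\<forall>h k. Q h \<bullet> k = h \<bullet> Q k) \<and> (\<forall>h. Q h \<bullet> h \<ge> 0) \<and>
     (\<forall>h. distr N borel (\<lambda>x. x \<bullet> h) = normal_law (m \<bullet> h) (Q h \<bullet> h))"

definition converges_weakly ::
    "(nat \<Rightarrow> 'a::topological_space measure) \<Rightarrow> 'a measure \<Rightarrow> bool" where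
  "converges_weakly \<mu> N \<longleftrightarrow>
     (\<forall>f :: 'a \<Rightarrow> real. continuous_on UNIV f \<longrightarrow> bounded (range f) \<longrightarrow>
        (\<lambda>n. \<integral>x. f x \<partial>\<mu> n) \<longlonglongrightarrow> (\<integral>x. f x \<partial>N))"


section \<open>Basic facts about the model\<close>

lemma support_fun_diff_le:
  fixes K :: "'a::euclidean_space set"
  assumes "bounded K" "K \<noteq> {}" and B: "\<And>x. x \<in> K \<Longrightarrow> norm x \<le> B"
  shows "support_fun K u - support_fun K v \<le> B * norm (u - v)"
proof -
  have bdd: "bdd_above ((\<lambda>x. x \<bullet> w) ` K)" for w
  proof (rule bdd_aboveI2)
    fix x assume "x \<in> K"
    then show "x \<bullet> w \<le> B * norm w"
      using norm_cauchy_schwarz[of x w] B[of x] mult_right_mono[of "norm x" B "norm w"] by auto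
  qed
  have "support_fun K u \<le> support_fun K v + B * norm (u - v)"
    unfolding support_fun_def
  proof (rule cSUP_least[OF \<open>K \<noteq> {}\<close>])
    fix x assume x: "x \<in> K"
    have "x \<bullet> u = x \<bullet> v + x \<bullet> (u - v)"
      by (simp add: inner_diff_right)
    moreover have "x \<bullet> v \<le> (SUP x\<in>K. x \<bullet> v)"
      by (rule cSUP_upper[OF x bdd])
    moreover have "x \<bullet> (u - v) \<le> B * norm (u - v)"
      using norm_cauchy_schwarz[of x "u - v"] B[OF x]
        mult_right_mono[of "norm x" B "norm (u - v)"] by auto
    ultimately show "x \<bullet> u \<le> (SUP x\<in>K. x \<bullet> v) + B * norm (u - v)"
      by linarith
  qed
  then show ?thesis by simp
qed

lemma continuous_support_fun:
  fixes K :: "'a::euclidean_space set"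
  assumes "bounded K" "K \<noteq> {}"
  shows "continuous_on UNIV (support_fun K)"
proof -
  obtain B where B: "B > 0" "\<And>x. x \<in> K \<Longrightarrow> norm x \<le> B"
    using assms(1) bounded_pos by blast
  have "\<bar>support_fun K u - support_fun K v\<bar> \<le> B * norm (u - v)" for u v
    using support_fun_diff_le[OF assms B(2), of u v] support_fun_diff_le[OF assms B(2), of v u]
    by (auto simp: norm_minus_commute abs_le_iff)
  then have "B-lipschitz_on UNIV (support_fun K)"
    using B(1) by (auto simp: lipschitz_on_def dist_norm)
  then show ?thesis
    by (rule lipschitz_on_continuous_on)
qed

lemma sets_sphere_uniform [measurable_cong, simp]: "sets sphere_uniform = sets borel"
  by (simp add: sphere_uniform_def)

lemma prob_space_uniform_cball:
  "prob_space (uniform_measure lborel (cball (0 :: 'a::euclidean_space) 1))"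
proof (rule prob_space_uniform_measure)
  have "measure lborel (cball (0 :: 'a) 1) > 0"
    by (rule content_cball_pos) simp
  then show "emeasure lborel (cball (0 :: 'a) 1) \<noteq> 0"
    by (auto simp: measure_def)
  show "emeasure lborel (cball (0 :: 'a) 1) \<noteq> \<infinity>"
    using emeasure_bounded_finite[OF bounded_cball[of "0::'a" 1]] by auto
qed

lemma prob_space_sphere_uniform: "prob_space (sphere_uniform :: 'a::euclidean_space measure)"
  unfolding sphere_uniform_def
  by (rule prob_space.prob_space_distr[OF prob_space_uniform_cball]) measurable

lemma AE_sphere_uniform: "AE u in (sphere_uniform :: 'a::euclidean_space measure). u \<in> sphere 0 1"
proof -
  have "AE x in lborel. x \<noteq> (0 :: 'a)"
    by (rule AE_I'[of "{0}"]) (auto intro: null_setsI)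
  then have "AE x in uniform_measure lborel (cball (0 :: 'a) 1). x \<noteq> 0"
    by (intro AE_uniform_measureI) auto
  then show ?thesis
    unfolding sphere_uniform_def by (subst AE_distr_iff) auto
qed

lemma prob_space_regression_law:
  fixes K :: "'a::euclidean_space set"
  assumes "compact K" "K \<noteq> {}" "prob_space \<nu>" "sets \<nu> = sets borel"
  shows "prob_space (regression_law K \<nu>)"
proof -
  interpret S: prob_space "sphere_uniform :: 'a measure" by (rule prob_space_sphere_uniform)
  interpret N: prob_space \<nu> by fact
  interpret pair_prob_space "sphere_uniform :: 'a measure" \<nu> ..
  have [measurable]: "support_fun K \<in> borel_measurable borel"
    using assms(1,2) by (intro borel_measurable_continuous_onI continuous_support_fun)
      (auto simp: compact_imp_bounded)
  note [measurable_cong] = \<open>sets \<nu> = sets borel\<close>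
  show ?thesis
    unfolding regression_law_def by (rule prob_space_distr) measurable
qed

lemma risk_empirical_measure:
  fixes C :: "(real ^ 'q) set" and A :: "real ^ 'q ^ 'd"
  assumes "compact C" "C \<noteq> {}"
  shows "risk C A (empirical_measure n z) = (\<Sum>i<n. sq_loss C A (z i)) / n"
proof -
  have [measurable]: "support_fun C \<in> borel_measurable borel"
    using assms by (intro borel_measurable_continuous_onI continuous_support_fun)
      (auto simp: compact_imp_bounded)
  have lin[measurable]: "(\<lambda>u. transpose A *v u) \<in> borel_measurable borel"
    by (intro borel_measurable_continuous_onI matrix_vector_mult_linear_continuous_on)
  have "sq_loss C A \<in> borel_measurable (borel \<Otimes>\<^sub>M borel)"
    unfolding sq_loss_def by measurable
  then have "sq_loss C A \<in> borel_measurable borel"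
    by (simp add: borel_prod)
  moreover have "z \<in> measurable (uniform_count_measure {..<n}) borel"
    by (simp cong: measurable_cong_sets add: sets_uniform_count_measure_count_space)
  ultimately show ?thesis
    unfolding risk_def empirical_measure_def
    by (simp add: integral_distr integral_uniform_count_measure)
qed

end

theory Submission
  imports Defs
begin

text \<open>
  The automorphisms of \<open>C\<close> are isometries that do not change the loss, so the aligned estimator
  \<open>Atilde n\<close> minimizes the empirical risk as well, and \<open>Ahat\<close> is the point of its own orbit that is
  closest to \<open>Atilde n\<close>. Hence \<open>Atilde n - Ahat\<close> is exactly orthogonal to the tangent space \<open>T\<close>,
  and the degenerate minimization problem becomes a nondegenerate one on the orthogonal complement.

  The loss is Lipschitz in the parameter, with a Lipschitz constant of order \<open>1 + \<bar>e\<bar>\<close> in the noise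
  \<open>e\<close>. Conditionally on the noise, Hoeffding's lemma makes the increments of the empirical process
  subgaussian relative to the empirical second moment of the weights \<open>1 + \<bar>e\<bar>\<close>, which is bounded in
  probability although \<open>e\<close> has only two moments; what conditioning leaves over is a multiple of the
  mean of the noise. Chaining over dyadic nets therefore bounds the process uniformly on balls.
  This yields consistency, by peeling the rate \<open>sqrt n\<close>, and the uniform approximation of the
  empirical risk at scale \<open>1 / sqrt n\<close> by the random quadratic form \<open>h \<bullet> s + (h \<bullet> \<Gamma> h) / 2\<close> with the
  normalized score \<open>s\<close>. Its minimizer on the orthogonal complement of \<open>T\<close> is the compressed
  inverse of \<open>\<Gamma>\<close> applied to \<open>- s\<close>, whose limit law is given by the central limit theorem.
\<close>


section \<open>Calculus and linear algebra\<close>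

text \<open>Three features of the problem shape the argument. The square of the noise cancels in a
  difference of two losses, and what remains is affine in the noise. This is why \<open>loss\<close>
  is written in the residual coordinates \<open>(u, e)\<close>, in which covariate and noise are
  independent, and why a weight linear in the noise suffices. Next, a supremum over an uncountable
  family never occurs as a random variable: the uniform bounds hold for all parameters at once on
  \<open>regular_event n K - E\<close> with a measurable \<open>E\<close> of small probability.
  Their constants depend neither on the sample size nor on the function family beyond its Lipschitz
  constant, so balls that shrink with \<open>n\<close> can be rescaled to the unit ball and treated
  by the same lemma. Finally, the parameter space is not compact, so the estimator has to be
  confined to a ball before consistency can be addressed; this rests on the quadratic growth of the
  loss along rays, which would break down only if \<open>hC A\<close> vanished almost everywhere for
  some nonzero \<open>A\<close>.\<close>

lemma GDERIV_along_line:
  fixes f :: "'a::real_inner \<Rightarrow> real"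
  assumes "GDERIV f (x + s *\<^sub>R u) :> D"
  shows "((\<lambda>s. f (x + s *\<^sub>R u)) has_real_derivative u \<bullet> D) (at s)"
proof -
  have "((\<lambda>s. x + s *\<^sub>R u) has_derivative (\<lambda>h. h *\<^sub>R u)) (at s)"
    by (auto intro!: derivative_eq_intros)
  from has_derivative_compose[OF this assms[unfolded gderiv_def]]
  show ?thesis by (simp add: has_field_derivative_def mult.commute[of _ "u \<bullet> D"])
qed

section \<open>Second-order expansions at a point\<close>

lemma has_hessianE:
  fixes f :: "'a::real_inner \<Rightarrow> real"
  assumes "has_hessian f H x"
  obtains g where "bounded_linear H"
    and "\<And>e. e > 0 \<Longrightarrow> \<exists>d>0. \<forall>y. norm (y - x) < d \<longrightarrow>
           GDERIV f y :> g y \<and> norm (g y - g x - H (y - x)) \<le> e * norm (y - x)"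
proof -
  obtain g where g: "\<forall>\<^sub>F y in nhds x. GDERIV f y :> g y" "(g has_derivative H) (at x)"
    using assms unfolding has_hessian_def by blast
  obtain r where r: "r > 0" "\<And>y. dist y x < r \<Longrightarrow> GDERIV f y :> g y"
    using g(1) unfolding eventually_nhds_metric by blast
  show ?thesis
  proof
    show "bounded_linear H" using g(2) by (rule has_derivative_bounded_linear)
    fix e :: real assume "e > 0"
    then obtain d where d: "d > 0"
      "\<And>y. norm (y - x) < d \<Longrightarrow> norm (g y - g x - H (y - x)) \<le> e * norm (y - x)"
      using g(2) unfolding has_derivative_at_alt by blast
    show "\<exists>d>0. \<forall>y. norm (y - x) < d \<longrightarrow>
           GDERIV f y :> g y \<and> norm (g y - g x - H (y - x)) \<le> e * norm (y - x)"
      using d r by (intro exI[of _ "min r d"]) (auto simp: dist_norm)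
  qed
qed

text \<open>The gradient is differentiable at \<open>x\<close> only. So the mean value theorem is
  applied once, in the direction \<open>u\<close>, and the two gradients that it produces are both
  linearized at \<open>x\<close>; their linear parts differ by exactly
  \<open>t *\<^sub>R H v\<close>.\<close>

lemma second_difference_hessian:
  fixes f :: "'a::real_inner \<Rightarrow> real"
  assumes hess: "has_hessian f H x" and "e > 0"
  shows "\<exists>d>0. \<forall>t. 0 < t \<and> t < d \<longrightarrow>
    \<bar>f (x + t *\<^sub>R u + t *\<^sub>R v) - f (x + t *\<^sub>R u) - f (x + t *\<^sub>R v) + f x - t\<^sup>2 * (H v \<bullet> u)\<bar> \<le> e * t\<^sup>2"
proof -
  obtain g where H: "bounded_linear H"
    and g: "\<And>e. e > 0 \<Longrightarrow> \<exists>d>0. \<forall>y. norm (y - x) < d \<longrightarrow>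
           GDERIV f y :> g y \<and> norm (g y - g x - H (y - x)) \<le> e * norm (y - x)"
    using has_hessianE[OF hess] by metis
  interpret H: bounded_linear H by fact
  \<comment> \<open>Every displacement that occurs has norm at most \<open>t * c\<close>. In the
    tolerance \<open>e / (2 * c\<^sup>2)\<close> one factor \<open>c\<close> pays for this, the
    other one for \<open>norm u\<close>, and the 2 for the two gradients.\<close>
  define c where "c = norm u + norm v + 1"
  have c: "c > 0" "norm u \<le> c" "norm u + norm v \<le> c" by (auto simp: c_def add_nonneg_pos)
  obtain d where d: "d > 0" "\<And>y. norm (y - x) < d \<Longrightarrow> GDERIV f y :> g y"
    "\<And>y. norm (y - x) < d \<Longrightarrow> norm (g y - g x - H (y - x)) \<le> e / (2 * c\<^sup>2) * norm (y - x)"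
    using g[of "e / (2 * c\<^sup>2)"] \<open>e > 0\<close> c by auto
  show ?thesis
  proof (intro exI[of _ "d / c"] conjI allI impI)
    show "d / c > 0" using d c by simp
    fix t assume t: "0 < t \<and> t < d / c"
    then have tc: "t * c < d" using c by (simp add: field_simps)
    have near: "norm (s *\<^sub>R u + t' *\<^sub>R v) \<le> t * c" if "0 \<le> s" "s \<le> t" "0 \<le> t'" "t' \<le> t" for s t'
    proof -
      have "norm (s *\<^sub>R u + t' *\<^sub>R v) \<le> s * norm u + t' * norm v"
        using norm_triangle_ineq[of "s *\<^sub>R u" "t' *\<^sub>R v"] that by simp
      also have "\<dots> \<le> t * norm u + t * norm v"
        using that by (intro add_mono mult_right_mono) auto
      also have "\<dots> \<le> t * c" using t c by (simp add: distrib_left[symmetric])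
      finally show ?thesis .
    qed
    define \<phi> where "\<phi> s = f (x + t *\<^sub>R v + s *\<^sub>R u) - f (x + s *\<^sub>R u)" for s
    have "(\<phi> has_real_derivative u \<bullet> g (x + t *\<^sub>R v + s *\<^sub>R u) - u \<bullet> g (x + s *\<^sub>R u)) (at s)"
      if "0 \<le> s" "s \<le> t" for s
      unfolding \<phi>_def
      using near[of s t] near[of s 0] that tc t
      by (intro DERIV_diff GDERIV_along_line d) (auto simp: algebra_simps)
    from MVT2[of 0 t \<phi>, OF _ this] t obtain s where s: "0 < s" "s < t"
      "\<phi> t - \<phi> 0 = t * (u \<bullet> g (x + t *\<^sub>R v + s *\<^sub>R u) - u \<bullet> g (x + s *\<^sub>R u))"
      by auto
    define w1 where "w1 = g (x + t *\<^sub>R v + s *\<^sub>R u) - g x - H (t *\<^sub>R v + s *\<^sub>R u)"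
    define w2 where "w2 = g (x + s *\<^sub>R u) - g x - H (s *\<^sub>R u)"
    have n1: "norm (t *\<^sub>R v + s *\<^sub>R u) \<le> t * c" using near[of s t] s t by (simp add: add.commute)
    have n2: "norm (s *\<^sub>R u) \<le> t * c" using near[of s 0] s t by simp
    have e0: "0 \<le> e / (2 * c\<^sup>2)" using \<open>e > 0\<close> by simp
    have "norm w1 \<le> e / (2 * c\<^sup>2) * norm (t *\<^sub>R v + s *\<^sub>R u)"
      using d(3)[of "x + t *\<^sub>R v + s *\<^sub>R u"] n1 tc by (simp add: w1_def algebra_simps)
    also have "\<dots> \<le> e / (2 * c\<^sup>2) * (t * c)" using n1 e0 by (rule mult_left_mono)
    also have "\<dots> = e * t / (2 * c)" using c by (simp add: power2_eq_square)
    finally have w1: "norm w1 \<le> e * t / (2 * c)" .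
    have "norm w2 \<le> e / (2 * c\<^sup>2) * norm (s *\<^sub>R u)"
      using d(3)[of "x + s *\<^sub>R u"] n2 tc by (simp add: w2_def algebra_simps)
    also have "\<dots> \<le> e / (2 * c\<^sup>2) * (t * c)" using n2 e0 by (rule mult_left_mono)
    also have "\<dots> = e * t / (2 * c)" using c by (simp add: power2_eq_square)
    finally have w2: "norm w2 \<le> e * t / (2 * c)" .
    have "g (x + t *\<^sub>R v + s *\<^sub>R u) - g (x + s *\<^sub>R u) = w1 - w2 + t *\<^sub>R H v"
      by (simp add: w1_def w2_def H.add H.scaleR)
    then have eq: "\<phi> t - \<phi> 0 - t\<^sup>2 * (H v \<bullet> u) = t * (u \<bullet> (w1 - w2))"
      using s(3) by (simp add: inner_diff_right[symmetric])
        (simp add: inner_add_right power2_eq_square algebra_simps inner_commute)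
    have "norm (w1 - w2) \<le> e * t / c"
      proof -
      have "e * t / (2 * c) + e * t / (2 * c) = e * t / c" using c by (simp add: field_simps)
      then show ?thesis using norm_triangle_ineq4[of w1 w2] w1 w2 by linarith
    qed
    then have "norm u * norm (w1 - w2) \<le> c * (e * t / c)"
      using c by (intro mult_mono) auto
    then have "\<bar>u \<bullet> (w1 - w2)\<bar> \<le> e * t"
      using Cauchy_Schwarz_ineq2[of u "w1 - w2"] c by simp
    then have "t * \<bar>u \<bullet> (w1 - w2)\<bar> \<le> e * t\<^sup>2"
      using t by (simp add: power2_eq_square mult.left_commute)
    then have "\<bar>\<phi> t - \<phi> 0 - t\<^sup>2 * (H v \<bullet> u)\<bar> \<le> e * t\<^sup>2"
      unfolding eq using t by (simp add: abs_mult)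
    then show "\<bar>f (x + t *\<^sub>R u + t *\<^sub>R v) - f (x + t *\<^sub>R u) - f (x + t *\<^sub>R v) + f x - t\<^sup>2 * (H v \<bullet> u)\<bar> \<le> e * t\<^sup>2"
      unfolding \<phi>_def by (simp add: algebra_simps)
  qed
qed

text \<open>The second difference is unchanged when \<open>u\<close> and \<open>v\<close> are
  exchanged, so both mixed terms approximate the same number up to a small multiple of
  \<open>t\<^sup>2\<close>.\<close>

lemma has_hessian_symmetric:
  fixes f :: "'a::real_inner \<Rightarrow> real"
  assumes "has_hessian f H x"
  shows "H u \<bullet> v = u \<bullet> H v"
proof -
  have "\<bar>H v \<bullet> u - H u \<bullet> v\<bar> \<le> 0 + e" if "e > 0" for e
  proof -
    have e2: "e / 2 > 0" using that by simp
    obtain d where d: "d > 0" "\<And>t. 0 < t \<and> t < d \<Longrightarrow>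
      \<bar>f (x + t *\<^sub>R u + t *\<^sub>R v) - f (x + t *\<^sub>R u) - f (x + t *\<^sub>R v) + f x - t\<^sup>2 * (H v \<bullet> u)\<bar> \<le> e / 2 * t\<^sup>2"
      using second_difference_hessian[OF assms e2, of u v] by blast
    obtain d' where d': "d' > 0" "\<And>t. 0 < t \<and> t < d' \<Longrightarrow>
      \<bar>f (x + t *\<^sub>R v + t *\<^sub>R u) - f (x + t *\<^sub>R v) - f (x + t *\<^sub>R u) + f x - t\<^sup>2 * (H u \<bullet> v)\<bar> \<le> e / 2 * t\<^sup>2"
      using second_difference_hessian[OF assms e2, of v u] by blast
    define t where "t = min d d' / 2"
    have t: "0 < t" "t < d" "t < d'" using d d' by (auto simp: t_def)
    have "x + t *\<^sub>R v + t *\<^sub>R u = x + t *\<^sub>R u + t *\<^sub>R v" by simp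
    with d'(2)[of t] t have
      "\<bar>f (x + t *\<^sub>R u + t *\<^sub>R v) - f (x + t *\<^sub>R v) - f (x + t *\<^sub>R u) + f x - t\<^sup>2 * (H u \<bullet> v)\<bar> \<le> e / 2 * t\<^sup>2"
      by simp
    moreover have "e * t\<^sup>2 = e / 2 * t\<^sup>2 + e / 2 * t\<^sup>2" by simp
    ultimately have "\<bar>t\<^sup>2 * (H v \<bullet> u) - t\<^sup>2 * (H u \<bullet> v)\<bar> \<le> e * t\<^sup>2"
      using d(2)[of t] t by linarith
    then have "t\<^sup>2 * \<bar>H v \<bullet> u - H u \<bullet> v\<bar> \<le> t\<^sup>2 * e"
      by (metis (no_types, opaque_lifting) abs_mult abs_of_nonneg mult.commute right_diff_distrib zero_le_power2)
    then show ?thesis using t by simp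
  qed
  then have "\<bar>H v \<bullet> u - H u \<bullet> v\<bar> \<le> 0" by (rule field_le_epsilon)
  then show ?thesis by (simp add: inner_commute)
qed

text \<open>Once the quadratic term is subtracted, the derivative along the segment is exactly the
  linearization error of the gradient, which differentiability of the gradient at the single point
  \<open>x\<close> controls.\<close>

lemma has_hessian_critical_expansion:
  fixes f :: "'a::real_inner \<Rightarrow> real"
  assumes hess: "has_hessian f H x" and crit: "GDERIV f x :> 0" and "e > 0"
  shows "\<exists>d>0. \<forall>v. norm v < d \<longrightarrow> \<bar>f (x + v) - f x - (v \<bullet> H v) / 2\<bar> \<le> e * (norm v)\<^sup>2"
proof -
  obtain g where H: "bounded_linear H"
    and g: "\<And>e. e > 0 \<Longrightarrow> \<exists>d>0. \<forall>y. norm (y - x) < d \<longrightarrow>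
           GDERIV f y :> g y \<and> norm (g y - g x - H (y - x)) \<le> e * norm (y - x)"
    using has_hessianE[OF hess] by metis
  interpret H: bounded_linear H by fact
  obtain d where d: "d > 0" "\<And>y. norm (y - x) < d \<Longrightarrow> GDERIV f y :> g y"
    "\<And>y. norm (y - x) < d \<Longrightarrow> norm (g y - g x - H (y - x)) \<le> e * norm (y - x)"
    using g[OF \<open>e > 0\<close>] by auto
  have "GDERIV f x :> g x" using d by simp
  then have "(\<lambda>h. h \<bullet> g x) = (\<lambda>h. h \<bullet> 0)"
    using crit unfolding gderiv_def by (rule has_derivative_unique)
  from fun_cong[OF this, of "g x"] have gx: "g x = 0" by simp
  show ?thesis
  proof (intro exI[of _ d] conjI allI impI)
    show "d > 0" by fact
    fix v :: 'a assume v: "norm v < d"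
    define \<phi> where "\<phi> t = f (x + t *\<^sub>R v) - t\<^sup>2 * (v \<bullet> H v) / 2" for t :: real
    have near: "norm (t *\<^sub>R v) < d" if "0 \<le> t" "t \<le> 1" for t :: real
      using that v mult_right_mono[of t 1 "norm v"] by auto
    have "(\<phi> has_real_derivative v \<bullet> g (x + t *\<^sub>R v) - t * (v \<bullet> H v)) (at t)"
      if "0 \<le> t" "t \<le> 1" for t :: real
      unfolding \<phi>_def using near[OF that]
      by (intro DERIV_diff GDERIV_along_line d) (auto intro!: derivative_eq_intros)
    from MVT2[of 0 1 \<phi>, OF _ this] obtain t where t: "0 < t" "t < 1"
      "\<phi> 1 - \<phi> 0 = v \<bullet> g (x + t *\<^sub>R v) - t * (v \<bullet> H v)" by auto
    have "norm (g (x + t *\<^sub>R v) - H (t *\<^sub>R v)) \<le> e * norm (t *\<^sub>R v)"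
      using d(3)[of "x + t *\<^sub>R v"] near[of t] t gx by simp
    also have "\<dots> \<le> e * norm v" using t \<open>e > 0\<close> mult_right_mono[of t 1 "norm v"] by simp
    finally have "norm v * norm (g (x + t *\<^sub>R v) - H (t *\<^sub>R v)) \<le> norm v * (e * norm v)"
      by (intro mult_left_mono) auto
    then have "\<bar>v \<bullet> (g (x + t *\<^sub>R v) - H (t *\<^sub>R v))\<bar> \<le> e * (norm v)\<^sup>2"
      using Cauchy_Schwarz_ineq2[of v "g (x + t *\<^sub>R v) - H (t *\<^sub>R v)"]
      by (simp add: power2_eq_square mult.left_commute)
    moreover have "v \<bullet> (g (x + t *\<^sub>R v) - H (t *\<^sub>R v)) = \<phi> 1 - \<phi> 0"
      using t(3) by (simp add: inner_diff_right H.scaleR)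
    ultimately show "\<bar>f (x + v) - f x - (v \<bullet> H v) / 2\<bar> \<le> e * (norm v)\<^sup>2"
      by (simp add: \<phi>_def algebra_simps)
  qed
qed

section \<open>Existence and measurability of gradients\<close>

lemma GDERIV_iff_small:
  fixes f :: "'a::euclidean_space \<Rightarrow> real"
  shows "GDERIV f x :> D \<longleftrightarrow>
    (\<forall>e>0. \<exists>d>0. \<forall>h. norm h < d \<longrightarrow> \<bar>f (x + h) - f x - D \<bullet> h\<bar> \<le> e * norm h)"
proof
  assume "GDERIV f x :> D"
  then have small: "\<And>e. e > 0 \<Longrightarrow> \<exists>d>0. \<forall>y. norm (y - x) < d \<longrightarrow> norm (f y - f x - (y - x) \<bullet> D) \<le> e * norm (y - x)"
    unfolding gderiv_def has_derivative_at_alt by blast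
  show "\<forall>e>0. \<exists>d>0. \<forall>h. norm h < d \<longrightarrow> \<bar>f (x + h) - f x - D \<bullet> h\<bar> \<le> e * norm h"
  proof (intro allI impI)
    fix e :: real assume "e > 0"
    then obtain d where d: "d > 0"
      "\<And>y. norm (y - x) < d \<Longrightarrow> norm (f y - f x - (y - x) \<bullet> D) \<le> e * norm (y - x)"
      using small by blast
    show "\<exists>d>0. \<forall>h. norm h < d \<longrightarrow> \<bar>f (x + h) - f x - D \<bullet> h\<bar> \<le> e * norm h"
      using d(1) d(2)[of "x + _"] by (intro exI[of _ d]) (auto simp: inner_commute)
  qed
next
  assume small: "\<forall>e>0. \<exists>d>0. \<forall>h. norm h < d \<longrightarrow> \<bar>f (x + h) - f x - D \<bullet> h\<bar> \<le> e * norm h"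
  show "GDERIV f x :> D"
    unfolding gderiv_def has_derivative_at_alt
  proof (intro conjI allI impI)
    show "bounded_linear (\<lambda>h. h \<bullet> D)" by (rule bounded_linear_inner_left)
    fix e :: real assume "e > 0"
    then obtain d where d: "d > 0" "\<And>h. norm h < d \<Longrightarrow> \<bar>f (x + h) - f x - D \<bullet> h\<bar> \<le> e * norm h"
      using small by blast
    show "\<exists>d>0. \<forall>y. norm (y - x) < d \<longrightarrow> norm (f y - f x - (y - x) \<bullet> D) \<le> e * norm (y - x)"
      using d(1) d(2)[of "_ - x"] by (intro exI[of _ d]) (auto simp: inner_commute)
  qed
qed

lemma gradient_eq:
  fixes f :: "'a::real_inner \<Rightarrow> real"
  assumes "GDERIV f x :> D"
  shows "gradient f x = D"
  unfolding gradient_def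
proof (rule the_equality)
  show "GDERIV f x :> D" by fact
  fix D' assume "GDERIV f x :> D'"
  then have "(\<lambda>h. h \<bullet> D') = (\<lambda>h. h \<bullet> D)"
    using assms unfolding gderiv_def by (rule has_derivative_unique)
  from fun_cong[OF this, of "D' - D"] have "(D' - D) \<bullet> (D' - D) = 0" by (simp add: inner_diff_right)
  then show "D' = D" by simp
qed

lemma GDERIV_sequence:
  fixes f :: "'a::real_inner \<Rightarrow> real"
  assumes f: "GDERIV f x :> D" and t: "t \<longlonglongrightarrow> 0" "\<And>n::nat. t n \<noteq> 0"
  shows "(\<lambda>n. (f (x + t n *\<^sub>R h) - f x) / t n) \<longlonglongrightarrow> h \<bullet> D"
proof -
  have "((\<lambda>s. f (x + s *\<^sub>R h)) has_real_derivative h \<bullet> D) (at 0)"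
    by (rule GDERIV_along_line) (use f in simp)
  then have "((\<lambda>s. (f (x + s *\<^sub>R h) - f x) / s) \<longlongrightarrow> h \<bullet> D) (at 0)"
    by (simp add: DERIV_def)
  moreover have "filterlim t (at 0) sequentially"
    using t by (auto simp: filterlim_at)
  ultimately show ?thesis by (rule filterlim_compose)
qed

text \<open>This prepares measurability: the uncountable search for a gradient is replaced by a
  search in the dense set \<open>B\<close>, at the price of a tolerance. Conversely, the candidates
  for two tolerances differ by at most the sum of the tolerances, so they form a Cauchy sequence,
  and its limit is the gradient.\<close>

lemma GDERIV_exists_iff_countable:
  fixes f :: "'a::euclidean_space \<Rightarrow> real"
  assumes dense: "\<And>X. open X \<Longrightarrow> X \<noteq> {} \<Longrightarrow> \<exists>d\<in>B. d \<in> X"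
  shows "(\<exists>D. GDERIV f x :> D) \<longleftrightarrow>
    (\<forall>k::nat. \<exists>L\<in>B. \<exists>j::nat. \<forall>h. norm h < 1 / Suc j \<longrightarrow> \<bar>f (x + h) - f x - L \<bullet> h\<bar> \<le> 1 / Suc k * norm h)"
    (is "?l \<longleftrightarrow> ?r")
proof
  assume ?l
  then obtain D where D: "GDERIV f x :> D" by blast
  show ?r
  proof
    fix k :: nat
    define e where "e = 1 / real (Suc k)"
    have e2: "e / 2 > 0" by (simp add: e_def)
    obtain d where d: "d > 0" "\<And>h. norm h < d \<Longrightarrow> \<bar>f (x + h) - f x - D \<bullet> h\<bar> \<le> e / 2 * norm h"
      using D e2 unfolding GDERIV_iff_small by blast
    obtain j where j: "1 / real (Suc j) < d"
      using reals_Archimedean[OF d(1)] by (auto simp: inverse_eq_divide)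
    obtain L where L: "L \<in> B" "dist D L < e / 2"
      using dense[of "ball D (e / 2)"] e2 by auto
    have "\<bar>f (x + h) - f x - L \<bullet> h\<bar> \<le> e * norm h" if "norm h < 1 / real (Suc j)" for h
    proof -
      have "\<bar>(D - L) \<bullet> h\<bar> \<le> norm (D - L) * norm h" by (rule Cauchy_Schwarz_ineq2)
      also have "\<dots> \<le> e / 2 * norm h" using L(2) by (intro mult_right_mono) (auto simp: dist_norm)
      finally have "\<bar>(D - L) \<bullet> h\<bar> \<le> e / 2 * norm h" .
      moreover have "\<bar>f (x + h) - f x - D \<bullet> h\<bar> \<le> e / 2 * norm h" using that j by (intro d(2)) linarith
      moreover have "f (x + h) - f x - L \<bullet> h = (f (x + h) - f x - D \<bullet> h) + (D - L) \<bullet> h"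
        by (simp add: inner_diff_left)
      ultimately have "\<bar>f (x + h) - f x - L \<bullet> h\<bar> \<le> e / 2 * norm h + e / 2 * norm h"
        using abs_triangle_ineq[of "f (x + h) - f x - D \<bullet> h" "(D - L) \<bullet> h"] by linarith
      then show ?thesis by simp
    qed
    then show "\<exists>L\<in>B. \<exists>j::nat. \<forall>h. norm h < 1 / Suc j \<longrightarrow> \<bar>f (x + h) - f x - L \<bullet> h\<bar> \<le> 1 / Suc k * norm h"
      using L(1) unfolding e_def by blast
  qed
next
  assume ?r
  then obtain L j where Lj: "\<And>(k::nat) h. norm h < 1 / Suc (j k :: nat) \<Longrightarrow>
      \<bar>f (x + h) - f x - L k \<bullet> h\<bar> \<le> 1 / Suc k * norm h" by metis
  have dist: "norm (L k - L l) \<le> 1 / Suc k + 1 / Suc l" for k l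
  proof (cases "L k = L l")
    case False
    \<comment> \<open>Both approximations are tested on a multiple of \<open>L k - L l\<close> that
      is short enough for both radii; this bounds the norm of the difference.\<close>
    define v where "v = L k - L l"
    have v: "norm v > 0" using False by (simp add: v_def)
    define t where "t = min (1 / Suc (j k)) (1 / Suc (j l)) / (2 * norm v)"
    have t: "t > 0" using v by (simp add: t_def)
    define w where "w = min (1 / real (Suc (j k))) (1 / real (Suc (j l)))"
    have w: "0 < w" "w \<le> 1 / real (Suc (j k))" "w \<le> 1 / real (Suc (j l))" by (simp_all add: w_def)
    have "norm (t *\<^sub>R v) = w / 2"
      using v w(1) unfolding t_def w_def[symmetric] by simp
    then have "norm (t *\<^sub>R v) < 1 / Suc (j k)" "norm (t *\<^sub>R v) < 1 / Suc (j l)"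
      using w by linarith+
    from Lj[OF this(1)] Lj[OF this(2)]
    have "\<bar>(L k - L l) \<bullet> (t *\<^sub>R v)\<bar> \<le> 1 / Suc k * norm (t *\<^sub>R v) + 1 / Suc l * norm (t *\<^sub>R v)"
      unfolding inner_diff_left by linarith
    then have "t * (v \<bullet> v) \<le> (1 / Suc k + 1 / Suc l) * (t * norm v)"
      using t by (simp add: v_def[symmetric] abs_mult algebra_simps)
    then have "(t * norm v) * norm v \<le> (t * norm v) * (1 / Suc k + 1 / Suc l)"
      by (simp add: dot_square_norm power2_eq_square mult_ac)
    then show ?thesis using v t unfolding v_def[symmetric] by simp
  qed simp
  have "Cauchy L"
  proof (rule metric_CauchyI)
    fix e :: real assume "e > 0"
    then obtain N where N: "inverse (real (Suc N)) < e / 2"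
      using reals_Archimedean[of "e / 2"] by auto
    have "dist (L m) (L n) < e" if "m \<ge> N" "n \<ge> N" for m n
    proof -
      have "1 / real (Suc m) \<le> 1 / real (Suc N)" "1 / real (Suc n) \<le> 1 / real (Suc N)"
        using that by (auto intro!: divide_left_mono)
      then show ?thesis using dist[of m n] N by (simp add: dist_norm inverse_eq_divide)
    qed
    then show "\<exists>M. \<forall>m\<ge>M. \<forall>n\<ge>M. dist (L m) (L n) < e" by blast
  qed
  then obtain D where D: "L \<longlonglongrightarrow> D" using Cauchy_convergent_iff convergent_def by blast
  have LD: "norm (L k - D) \<le> 1 / Suc k" for k
  proof (rule LIMSEQ_le)
    show "(\<lambda>l. norm (L k - L l)) \<longlonglongrightarrow> norm (L k - D)" by (intro tendsto_intros D)
    have "(\<lambda>l. 1 / real (Suc k) + 1 / real (Suc l)) \<longlonglongrightarrow> 1 / real (Suc k) + 0"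
      by (intro tendsto_add tendsto_const LIMSEQ_Suc lim_1_over_n)
    then show "(\<lambda>l. 1 / real (Suc k) + 1 / real (Suc l)) \<longlonglongrightarrow> 1 / real (Suc k)" by simp
  qed (use dist in auto)
  have "GDERIV f x :> D"
    unfolding GDERIV_iff_small
  proof (intro allI impI)
    fix e :: real assume "e > 0"
    then obtain k where k: "inverse (real (Suc k)) < e / 2"
      using reals_Archimedean[of "e / 2"] by auto
    have "\<bar>f (x + h) - f x - D \<bullet> h\<bar> \<le> e * norm h" if h: "norm h < 1 / Suc (j k)" for h
    proof -
      have "\<bar>(L k - D) \<bullet> h\<bar> \<le> norm (L k - D) * norm h" by (rule Cauchy_Schwarz_ineq2)
      also have "\<dots> \<le> 1 / Suc k * norm h" using LD by (intro mult_right_mono) auto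
      finally have "\<bar>(L k - D) \<bullet> h\<bar> \<le> 1 / Suc k * norm h" .
      moreover have "f (x + h) - f x - D \<bullet> h = (f (x + h) - f x - L k \<bullet> h) + (L k - D) \<bullet> h"
        by (simp add: inner_diff_left)
      ultimately have "\<bar>f (x + h) - f x - D \<bullet> h\<bar> \<le> 1 / Suc k * norm h + 1 / Suc k * norm h"
        using abs_triangle_ineq[of "f (x + h) - f x - L k \<bullet> h" "(L k - D) \<bullet> h"] Lj[OF h] by linarith
      also have "\<dots> = (2 * inverse (real (Suc k))) * norm h" by (simp add: inverse_eq_divide)
      also have "\<dots> \<le> e * norm h" using k by (intro mult_right_mono) auto
      finally show ?thesis .
    qed
    then show "\<exists>d>0. \<forall>h. norm h < d \<longrightarrow> \<bar>f (x + h) - f x - D \<bullet> h\<bar> \<le> e * norm h"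
      by (intro exI[of _ "1 / Suc (j k)"]) auto
  qed
  then show ?l by blast
qed

text \<open>For a fixed candidate \<open>L\<close> the condition on \<open>z\<close> is an
  intersection over all \<open>h\<close> of closed conditions, because \<open>F A\<close> is
  continuous in \<open>z\<close>; it is closed although the intersection is uncountable. Only
  countable operations remain.\<close>

lemma
  fixes F :: "'a::euclidean_space \<Rightarrow> 'z::topological_space \<Rightarrow> real"
  assumes cont: "\<And>A. continuous_on UNIV (F A)"
  shows borel_GDERIV_exists: "{z. \<exists>D. GDERIV (\<lambda>A. F A z) x :> D} \<in> sets borel"
    and borel_measurable_gradient: "(\<lambda>z. gradient (\<lambda>A. F A z) x) \<in> borel_measurable borel"
proof -
  obtain B :: "'a set" where B: "countable B" "\<And>X. open X \<Longrightarrow> X \<noteq> {} \<Longrightarrow> \<exists>d\<in>B. d \<in> X"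
    using countable_dense_exists by blast
  define W where "W k L j = {z. \<forall>h. norm h < 1 / real (Suc j) \<longrightarrow>
      \<bar>F (x + h) z - F x z - L \<bullet> h\<bar> \<le> 1 / real (Suc k) * norm h}" for k j :: nat and L
  have "closed (W k L j)" for k L j
    unfolding W_def by (intro closed_Collect_all closed_Collect_imp closed_Collect_le open_Collect_const
        continuous_intros continuous_on_subset[OF cont]) auto
  then have W: "W k L j \<in> sets borel" for k L j by simp
  have "{z. \<exists>D. GDERIV (\<lambda>A. F A z) x :> D} = (\<Inter>k. \<Union>L\<in>B. \<Union>j. W k L j)"
  proof -
    have "(\<exists>D. GDERIV (\<lambda>A. F A z) x :> D) \<longleftrightarrow> (\<forall>k. \<exists>L\<in>B. \<exists>j. z \<in> W k L j)" for z
      unfolding W_def mem_Collect_eq by (rule GDERIV_exists_iff_countable[OF B(2)])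
    then show ?thesis by auto
  qed
  also have "\<dots> \<in> sets borel"
    using B(1) W by (intro sets.countable_INT' sets.countable_UN' sets.countable_UN) auto
  finally show diff: "{z. \<exists>D. GDERIV (\<lambda>A. F A z) x :> D} \<in> sets borel" .
  have F[measurable]: "F A \<in> borel_measurable borel" for A
    by (rule borel_measurable_continuous_onI[OF cont])
  define q where "q z = (\<Sum>b\<in>Basis. lim (\<lambda>n. (F (x + (1 / real (Suc n)) *\<^sub>R b) z - F x z) / (1 / real (Suc n))) *\<^sub>R b)" for z
  have q: "q \<in> borel_measurable borel" unfolding q_def by measurable
  \<comment> \<open>Where no gradient exists, the description ranges over the predicate that is
    false everywhere, so its unspecified value is the same for all such \<open>z\<close>, and the
    case distinction is measurable.\<close>
  have "gradient (\<lambda>A. F A z) x = (if \<exists>D. GDERIV (\<lambda>A. F A z) x :> D then q z else (THE D. False))" for z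
  proof (cases "\<exists>D. GDERIV (\<lambda>A. F A z) x :> D")
    case True
    then obtain D where D: "GDERIV (\<lambda>A. F A z) x :> D" by blast
    have "(\<lambda>n. 1 / real (Suc n)) \<longlonglongrightarrow> 0" by (rule LIMSEQ_Suc[OF lim_1_over_n])
    from limI[OF GDERIV_sequence[OF D this]] have "q z = (\<Sum>b\<in>Basis. (b \<bullet> D) *\<^sub>R b)"
      unfolding q_def by simp
    also have "\<dots> = D" by (simp add: inner_commute[of _ D] euclidean_representation)
    finally show ?thesis using True gradient_eq[OF D] by simp
  next
    case False
    then have "gderiv (\<lambda>A. F A z) x = (\<lambda>D. False)" by auto
    then show ?thesis using False unfolding gradient_def by simp
  qed
  then show "(\<lambda>z. gradient (\<lambda>A. F A z) x) \<in> borel_measurable borel"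
    using q diff by (simp add: measurable_If)
qed

section \<open>Orthogonal projections and inverses of compressions\<close>

lemma closest_point_subspace:
  fixes S :: "'a::euclidean_space set"
  assumes "subspace S"
  shows closest_point_subspace_in: "closest_point S x \<in> S"
    and closest_point_subspace_inner: "y \<in> S \<Longrightarrow> closest_point S x \<bullet> y = x \<bullet> y"
proof -
  have S: "closed S" "convex S" "S \<noteq> {}"
    using assms closed_subspace subspace_imp_convex subspace_0 by blast+
  show in_S: "closest_point S x \<in> S" using S by (simp add: closest_point_in_set)
  define p where "p = closest_point S x"
  have le: "(x - p) \<bullet> z \<le> 0" if "z \<in> S" for z
    using closest_point_dot[OF S(2,1), of "p + z" x] that in_S assms
    by (simp add: p_def subspace_add)
  show "closest_point S x \<bullet> y = x \<bullet> y" if "y \<in> S"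
    using le[of y] le[of "- y"] that assms by (simp add: p_def subspace_neg inner_diff_left)
qed

lemma closest_point_subspace_unique:
  fixes S :: "'a::euclidean_space set"
  assumes "subspace S" "p \<in> S" "\<And>y. y \<in> S \<Longrightarrow> p \<bullet> y = x \<bullet> y"
  shows "closest_point S x = p"
proof -
  have "closest_point S x - p \<in> S"
    using assms closest_point_subspace_in subspace_diff by blast
  then have "(closest_point S x - p) \<bullet> (closest_point S x - p) = 0"
    using assms(3) closest_point_subspace_inner[OF assms(1)] by (metis inner_diff_left right_minus_eq)
  then show ?thesis by simp
qed

lemma linear_closest_point_subspace:
  fixes S :: "'a::euclidean_space set"
  assumes S: "subspace S"
  shows "linear (closest_point S)"
proof
  show "closest_point S (x + y) = closest_point S x + closest_point S y" for x y
    by (rule closest_point_subspace_unique[OF S])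
      (auto simp: S closest_point_subspace_in subspace_add closest_point_subspace_inner inner_add_left)
  show "closest_point S (r *\<^sub>R x) = r *\<^sub>R closest_point S x" for r x
    by (rule closest_point_subspace_unique[OF S])
      (auto simp: S closest_point_subspace_in subspace_scale closest_point_subspace_inner)
qed

text \<open>Projecting first makes the inverse an operator on the whole space that, in the positive
  definite case below, vanishes on the orthogonal complement of \<open>S\<close>. The
  \<open>sandwich\<close> becomes a plain product of three operators.\<close>

definition compression_inverse :: "'a::euclidean_space set \<Rightarrow> ('a \<Rightarrow> 'a) \<Rightarrow> 'a \<Rightarrow> 'a" where
  "compression_inverse S H x = inv_into S (compression S H) (closest_point S x)"

lemma sandwich_eq_compression_inverse:
  "sandwich S H V h = compression_inverse S H (V (compression_inverse S H h))"
  by (simp add: sandwich_def compression_inverse_def compression_def Let_def)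

context
  fixes S :: "'a::euclidean_space set" and H :: "'a \<Rightarrow> 'a"
  assumes S: "subspace S" and H: "linear H"
    and sym: "\<And>u v. H u \<bullet> v = u \<bullet> H v"
    and pos: "\<And>h. h \<in> S \<Longrightarrow> h \<noteq> 0 \<Longrightarrow> h \<bullet> H h > 0"
begin

text \<open>Positivity on \<open>S\<close> gives injectivity, and equality of dimensions gives
  surjectivity.\<close>

lemma bij_betw_compression: "bij_betw (compression S H) S S"
proof -
  have lin: "linear (compression S H)"
    unfolding compression_def
    using linear_compose[OF H linear_closest_point_subspace[OF S]] by (simp add: o_def)
  have "inj_on (compression S H) S"
  proof (rule inj_onI)
    fix a b assume ab: "a \<in> S" "b \<in> S" "compression S H a = compression S H b"
    have "a - b \<in> S" using ab S by (simp add: subspace_diff)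
    have "compression S H (a - b) = 0" using ab lin by (simp add: linear_diff)
    then have "(a - b) \<bullet> H (a - b) = 0"
      using closest_point_subspace_inner[OF S \<open>a - b \<in> S\<close>, of "H (a - b)"]
      by (simp add: compression_def inner_commute)
    then show "a = b" using pos[OF \<open>a - b \<in> S\<close>] by force
  qed
  moreover have sub: "compression S H ` S \<subseteq> S"
    using S by (auto simp: compression_def closest_point_subspace_in)
  moreover have "dim (compression S H ` S) = dim S"
    using lin calculation(1) S by (intro dim_image_eq) (simp_all add: span_eq_iff[THEN iffD2])
  ultimately show ?thesis
    using S lin by (simp add: bij_betw_def subspace_dim_equal linear_subspace_image)
qed

lemma compression_inverse_in: "compression_inverse S H x \<in> S"
  unfolding compression_inverse_def using bij_betw_compression closest_point_subspace_in[OF S]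
  by (metis bij_betw_imp_surj_on inv_into_into)

text \<open>The weak form of the equation, tested against \<open>S\<close>. Together with membership
  in \<open>S\<close> it determines the compressed inverse, and all further properties are derived
  from it rather than from \<open>inv_into\<close>.\<close>

lemma compression_inverse_inner:
  assumes "v \<in> S" shows "v \<bullet> H (compression_inverse S H x) = v \<bullet> x"
proof -
  have "compression S H (compression_inverse S H x) = closest_point S x"
    unfolding compression_inverse_def using bij_betw_compression closest_point_subspace_in[OF S]
    by (metis bij_betw_imp_surj_on f_inv_into_f)
  then show ?thesis
    using closest_point_subspace_inner[OF S assms] by (metis compression_def inner_commute)
qed

lemma compression_inverse_unique:
  assumes "p \<in> S" "\<And>v. v \<in> S \<Longrightarrow> v \<bullet> H p = v \<bullet> x"
  shows "compression_inverse S H x = p"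
proof -
  define d where "d = compression_inverse S H x - p"
  have "d \<in> S" using assms compression_inverse_in S by (simp add: d_def subspace_diff)
  then have "d \<bullet> H d = 0"
    using assms(2)[of d] compression_inverse_inner[of d x] H
    by (simp add: d_def linear_diff inner_diff_right)
  then show ?thesis using pos[OF \<open>d \<in> S\<close>] by (force simp: d_def)
qed

lemma linear_compression_inverse: "linear (compression_inverse S H)"
  by (rule linearI; rule compression_inverse_unique)
    (auto simp: S subspace_add subspace_scale compression_inverse_in compression_inverse_inner
      linear_add[OF H] linear_cmul[OF H] inner_add_right)

lemma compression_inverse_symmetric:
  "compression_inverse S H x \<bullet> y = x \<bullet> compression_inverse S H y"
  by (metis compression_inverse_in compression_inverse_inner inner_commute sym)

end

section \<open>Positive semidefinite operators\<close>

lemma psd_Cauchy_Schwarz: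
  fixes Q :: "'a::euclidean_space \<Rightarrow> 'a"
  assumes Q: "linear Q" and sym: "\<And>h k. Q h \<bullet> k = h \<bullet> Q k" and pos: "\<And>h. Q h \<bullet> h \<ge> 0"
  shows "(Q h \<bullet> k)\<^sup>2 \<le> (Q h \<bullet> h) * (Q k \<bullet> k)"
proof -
  have quad: "0 \<le> Q h \<bullet> h + 2 * t * (Q h \<bullet> k) + t\<^sup>2 * (Q k \<bullet> k)" for t
  proof -
    have "Q k \<bullet> h = Q h \<bullet> k" using sym by (metis inner_commute)
    then show ?thesis
      using pos[of "h + t *\<^sub>R k"] Q
      by (simp add: linear_add linear_cmul inner_add_left inner_add_right power2_eq_square algebra_simps)
  qed
  show ?thesis
  proof (cases "Q k \<bullet> k = 0")
    case True
    have "Q h \<bullet> k = 0"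
    proof (rule ccontr)
      assume "Q h \<bullet> k \<noteq> 0"
      \<comment> \<open>Without a quadratic term the form is affine in \<open>t\<close>, and this
        \<open>t\<close> gives it the value -1.\<close>
      then show False
        using quad[of "- (Q h \<bullet> h + 1) / (2 * (Q h \<bullet> k))"] True by (simp add: field_simps)
    qed
    then show ?thesis using True by simp
  next
    case False
    then have "Q k \<bullet> k > 0" using pos[of k] by simp
    with quad[of "- (Q h \<bullet> k) / (Q k \<bullet> k)"] show ?thesis
      by (simp add: field_simps power2_eq_square)
  qed
qed

text \<open>Cholesky elimination, one basis vector at a time. Subtracting the rank-one operator of
  the pivot \<open>e\<close> leaves an operator that is positive semidefinite by Cauchy-Schwarz and
  kills \<open>e\<close> as well as all vectors killed before. A zero pivot forces
  \<open>Q e = 0\<close>, again by Cauchy-Schwarz. The vectors serve as a square root of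
  \<open>Q\<close> in the construction of Gaussian measures.\<close>

lemma psd_sum_of_rank_one:
  fixes Q :: "'a::euclidean_space \<Rightarrow> 'a"
  assumes "linear Q" "\<And>h k. Q h \<bullet> k = h \<bullet> Q k" "\<And>h. Q h \<bullet> h \<ge> 0"
  shows "\<exists>(n::nat) v. \<forall>h. Q h = (\<Sum>i<n. (v i \<bullet> h) *\<^sub>R v i)"
proof -
  have "\<exists>(n::nat) v. \<forall>h. Q h = (\<Sum>i<n. (v i \<bullet> h) *\<^sub>R v i)"
    if "finite E" "E \<subseteq> Basis" "\<And>b. b \<in> Basis - E \<Longrightarrow> Q b = 0"
      "linear Q" "\<And>h k. Q h \<bullet> k = h \<bullet> Q k" "\<And>h. Q h \<bullet> h \<ge> 0" for E :: "'a set" and Q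
    using that
  proof (induction E arbitrary: Q rule: finite_induct)
    case empty
    then have "Q h = 0" for h
      using linear_eq_stdbasis[of Q "\<lambda>_. 0"] by (auto simp: linear_iff)
    then show ?case by (intro exI[of _ 0]) auto
  next
    case (insert e E)
    note CS = psd_Cauchy_Schwarz[OF insert.prems(3-5)]
    define q where "q = Q e \<bullet> e"
    show ?case
    proof (cases "q = 0")
      case True
      have "(Q e \<bullet> Q e)\<^sup>2 \<le> 0" using CS[of e "Q e"] True by (simp add: q_def)
      then have "Q e = 0" by simp
      then show ?thesis using insert.IH[of Q] insert.prems by auto
    next
      case False
      then have q: "q > 0" using insert.prems(5)[of e] by (simp add: q_def)
      define Q' where "Q' h = Q h - ((Q e \<bullet> h) / q) *\<^sub>R Q e" for h
      have lin: "linear Q'"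
        using insert.prems(3)
        by (auto simp: Q'_def linear_iff inner_add_right algebra_simps add_divide_distrib)
      have "\<exists>(n::nat) v. \<forall>h. Q' h = (\<Sum>i<n. (v i \<bullet> h) *\<^sub>R v i)"
      proof (rule insert.IH)
        show "E \<subseteq> Basis" using insert.prems by auto
        show "linear Q'" by fact
        show "Q' h \<bullet> k = h \<bullet> Q' k" for h k
          using insert.prems(4)[of h k] by (simp add: Q'_def inner_diff_left inner_diff_right inner_commute)
        show "Q' h \<bullet> h \<ge> 0" for h
          using CS[of e h] q by (simp add: Q'_def q_def inner_diff_left field_simps power2_eq_square)
        show "Q' b = 0" if "b \<in> Basis - E" for b
        proof (cases "b = e")
          case True then show ?thesis using q by (simp add: Q'_def q_def)
        next
          case False
          then have "Q b = 0" using insert.prems(2) that by auto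
          moreover have "Q e \<bullet> b = e \<bullet> Q b" using insert.prems(4) .
          ultimately show ?thesis by (simp add: Q'_def)
        qed
      qed
      then obtain n :: nat and v where v: "\<And>h. Q' h = (\<Sum>i<n. (v i \<bullet> h) *\<^sub>R v i)" by blast
      define w where "w = (1 / sqrt q) *\<^sub>R Q e"
      have "Q h = Q' h + (w \<bullet> h) *\<^sub>R w" for h
        using q by (simp add: Q'_def w_def)
      then have "Q h = (\<Sum>i<Suc n. ((v(n := w)) i \<bullet> h) *\<^sub>R (v(n := w)) i)" for h
        by (simp add: v)
      then show ?thesis by blast
    qed
  qed
  from this[of Basis Q] assms show ?thesis by auto
qed


section \<open>Gaussian measures and the multivariate central limit theorem\<close>

lemma indep_vars_PiM_components:
  assumes "\<And>i. i \<in> I \<Longrightarrow> prob_space (N i)" "I \<noteq> {}"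
  shows "prob_space.indep_vars (Pi\<^sub>M I N) N (\<lambda>i x. x i) I"
proof -
  have ps: "prob_space (Pi\<^sub>M I N)" using assms(1) by (rule prob_space_PiM)
  have "distr (Pi\<^sub>M I N) (Pi\<^sub>M I N) (\<lambda>x. \<lambda>i\<in>I. x i) = distr (Pi\<^sub>M I N) (Pi\<^sub>M I N) (\<lambda>x. x)"
    by (rule distr_cong) (auto simp: space_PiM)
  also have "\<dots> = Pi\<^sub>M I N" by (simp add: distr_id2)
  also have "Pi\<^sub>M I N = Pi\<^sub>M I (\<lambda>i. distr (Pi\<^sub>M I N) (N i) (\<lambda>x. x i))"
  proof (intro PiM_cong refl)
    fix i assume "i \<in> I"
    then show "N i = distr (Pi\<^sub>M I N) (N i) (\<lambda>x. x i)"
      using assms(1) by (intro distr_PiM_component[symmetric]) auto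
  qed
  finally show ?thesis
    by (subst prob_space.indep_vars_iff_distr_eq_PiM'[OF ps assms(2)]) auto
qed

text \<open>The measure is the law of the combination of the vectors \<open>v i\<close> with
  independent standard normal coefficients: each linear functional of it is a sum of independent
  normal variables whose variances add up to \<open>Q h \<bullet> h\<close>.\<close>

lemma is_gaussian_exists:
  fixes Q :: "'a::euclidean_space \<Rightarrow> 'a" and v :: "nat \<Rightarrow> 'a"
  assumes lin: "linear Q" and sym: "\<And>h k. Q h \<bullet> k = h \<bullet> Q k" and pos: "\<And>h. Q h \<bullet> h \<ge> 0"
    and v: "\<And>h. Q h = (\<Sum>i<n. (v i \<bullet> h) *\<^sub>R v i)"
  shows "\<exists>N. is_gaussian N 0 Q"
proof -
  define D where "D = Pi\<^sub>M {..<n} (\<lambda>_. std_normal_distribution)"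
  define X where "X x = (\<Sum>i<n. x i *\<^sub>R v i)" for x :: "nat \<Rightarrow> real"
  have std: "prob_space std_normal_distribution" using prob_space_normal_density by simp
  interpret D: prob_space D unfolding D_def by (rule prob_space_PiM) (rule std)
  have comp[measurable]: "(\<lambda>x. x i) \<in> borel_measurable D" if "i < n" for i
    unfolding D_def using that
    by (intro measurable_PiM_component_rev[where i=i] measurable_ident_sets) auto
  have X[measurable]: "X \<in> borel_measurable D"
    unfolding X_def by (intro borel_measurable_sum borel_measurable_scaleR comp) auto
  have law: "distr D borel (\<lambda>x. X x \<bullet> h) = normal_law 0 (Q h \<bullet> h)" for h
  proof -
    \<comment> \<open>A normal density requires a positive standard deviation, so only the nonzero
      coefficients are kept. If there are none, the law is the point mass at 0.\<close>
    define J where "J = {i. i < n \<and> v i \<bullet> h \<noteq> 0}"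
    have fin: "finite J" by (simp add: J_def)
    have Xh: "X x \<bullet> h = (\<Sum>i\<in>J. 0 + (v i \<bullet> h) * x i)" for x
      unfolding X_def J_def inner_sum_left
      by (rule sum.mono_neutral_cong_right) (auto simp: mult.commute)
    have Qh: "Q h \<bullet> h = (\<Sum>i\<in>J. \<bar>v i \<bullet> h\<bar>\<^sup>2)"
      unfolding v J_def inner_sum_left
      by (rule sum.mono_neutral_cong_right) (auto simp: power2_eq_square)
    show ?thesis
    proof (cases "J = {}")
      case True
      then have "distr D borel (\<lambda>x. X x \<bullet> h) = distr D borel (\<lambda>x. 0)"
        by (intro distr_cong) (auto simp: Xh)
      also have "\<dots> = return borel 0"
        by (metis D.distr_const space_borel UNIV_I)
      finally show ?thesis using True Qh by (simp add: normal_law_def)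
    next
      case False
      then have n: "{..<n} \<noteq> {}" by (auto simp: J_def)
      have "D.indep_vars (\<lambda>_. std_normal_distribution) (\<lambda>i x. x i) {..<n}"
        unfolding D_def by (rule indep_vars_PiM_components) (use n std in auto)
      then have "D.indep_vars (\<lambda>_. std_normal_distribution) (\<lambda>i x. x i) J"
        by (rule D.indep_vars_subset) (auto simp: J_def)
      then have "D.indep_vars (\<lambda>_. borel) (\<lambda>i. (\<lambda>y. 0 + (v i \<bullet> h) * y) \<circ> (\<lambda>x. x i)) J"
        by (rule D.indep_vars_compose) auto
      then have ind: "D.indep_vars (\<lambda>_. borel) (\<lambda>i x. 0 + (v i \<bullet> h) * x i) J"
        by (simp add: comp_def)
      have "distributed D lborel (\<lambda>x. x i) (normal_density 0 1)" if "i < n" for i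
      proof -
        have "distr D std_normal_distribution (\<lambda>x. x i) = std_normal_distribution"
          unfolding D_def using that std by (intro distr_PiM_component) auto
        moreover have "distr D std_normal_distribution (\<lambda>x. x i) = distr D lborel (\<lambda>x. x i)"
          by (rule distr_cong) auto
        ultimately show ?thesis using that by (simp add: distributed_def)
      qed
      then have "distributed D lborel (\<lambda>x. 0 + (v i \<bullet> h) * x i)
          (normal_density (0 + (v i \<bullet> h) * 0) (\<bar>v i \<bullet> h\<bar> * 1))" if "i \<in> J" for i
        using that by (intro D.normal_density_affine) (auto simp: J_def)
      then have "distributed D lborel (\<lambda>x. \<Sum>i\<in>J. 0 + (v i \<bullet> h) * x i)
          (normal_density (\<Sum>i\<in>J. 0) (sqrt (\<Sum>i\<in>J. \<bar>v i \<bullet> h\<bar>\<^sup>2)))"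
        using False fin ind by (intro D.sum_indep_normal) (auto simp: J_def)
      then have "distr D lborel (\<lambda>x. X x \<bullet> h) = density lborel (normal_density 0 (sqrt (Q h \<bullet> h)))"
        by (simp add: distributed_def Xh Qh)
      moreover have "distr D lborel (\<lambda>x. X x \<bullet> h) = distr D borel (\<lambda>x. X x \<bullet> h)"
        by (rule distr_cong) auto
      moreover have "Q h \<bullet> h \<noteq> 0"
        unfolding Qh using fin False by (subst sum_nonneg_eq_0_iff) (auto simp: J_def)
      ultimately show ?thesis by (simp add: normal_law_def)
    qed
  qed
  show ?thesis
  proof (intro exI[of _ "distr D borel X"])
    show "is_gaussian (distr D borel X) 0 Q"
      unfolding is_gaussian_def using lin sym pos law
      by (auto simp: distr_distr comp_def intro!: D.prob_space_distr)
  qed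
qed

section \<open>Trigonometric polynomials as test functions\<close>

inductive_set trig_polys :: "('a::real_inner \<Rightarrow> real) set" where
  cos: "(\<lambda>x. a * cos (h \<bullet> x + b)) \<in> trig_polys"
| add: "f \<in> trig_polys \<Longrightarrow> g \<in> trig_polys \<Longrightarrow> (\<lambda>x. f x + g x) \<in> trig_polys"

lemma trig_polys_const: "(\<lambda>x. c) \<in> trig_polys"
  using trig_polys.cos[of c 0 0] by simp

text \<open>The product formula for cosines turns the span into an algebra, as Stone-Weierstrass
  requires. The free phase \<open>b\<close> of the generators supplies the sines and the
  constants.\<close>

lemma trig_polys_mult_cos:
  assumes "g \<in> trig_polys"
  shows "(\<lambda>x. a * cos (h \<bullet> x + b) * g x) \<in> trig_polys"
  using assms
proof induction
  case (cos a' h' b')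
  have "(\<lambda>x. a * cos (h \<bullet> x + b) * (a' * cos (h' \<bullet> x + b'))) =
    (\<lambda>x. a * a' / 2 * cos ((h - h') \<bullet> x + (b - b')) + a * a' / 2 * cos ((h + h') \<bullet> x + (b + b')))"
  proof
    fix x
    have "cos (h \<bullet> x + b) * cos (h' \<bullet> x + b') =
        (cos ((h - h') \<bullet> x + (b - b')) + cos ((h + h') \<bullet> x + (b + b'))) / 2"
      unfolding cos_times_cos by (simp add: inner_diff_left inner_add_left algebra_simps)
    then have "a * cos (h \<bullet> x + b) * (a' * cos (h' \<bullet> x + b')) =
        a * a' * ((cos ((h - h') \<bullet> x + (b - b')) + cos ((h + h') \<bullet> x + (b + b'))) / 2)"
      by (metis mult.assoc mult.left_commute)
    also have "\<dots> = a * a' / 2 * cos ((h - h') \<bullet> x + (b - b')) + a * a' / 2 * cos ((h + h') \<bullet> x + (b + b'))"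
      by (simp add: field_simps)
    finally show "a * cos (h \<bullet> x + b) * (a' * cos (h' \<bullet> x + b')) = \<dots>" .
  qed
  then show ?case by (simp only:) (intro trig_polys.intros)
next
  case (add f g)
  then show ?case by (auto simp: distrib_left intro!: trig_polys.add)
qed

lemma trig_polys_mult:
  assumes "f \<in> trig_polys" "g \<in> trig_polys"
  shows "(\<lambda>x. f x * g x) \<in> trig_polys"
  using assms by induction (auto simp: distrib_right trig_polys_mult_cos intro!: trig_polys.add)

lemma trig_polys_continuous: "f \<in> trig_polys \<Longrightarrow> continuous_on S f"
  by (induction rule: trig_polys.induct) (auto intro!: continuous_intros)

lemma trig_polys_bounded: "f \<in> trig_polys \<Longrightarrow> \<exists>R. \<forall>x. \<bar>f x\<bar> \<le> R"
proof (induction rule: trig_polys.induct)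
  case (cos a h b)
  have "\<bar>a\<bar> * \<bar>cos (h \<bullet> x + b)\<bar> \<le> \<bar>a\<bar> * 1" for x by (intro mult_left_mono) auto
  then show ?case by (intro exI[of _ "\<bar>a\<bar>"]) (simp add: abs_mult)
next
  case (add f g)
  then obtain R R' where "\<And>x. \<bar>f x\<bar> \<le> R" "\<And>x. \<bar>g x\<bar> \<le> R'" by blast
  then have "\<bar>f x + g x\<bar> \<le> R + R'" for x using abs_triangle_ineq[of "f x" "g x"] by (meson add_mono order_trans)
  then show ?case by blast
qed

text \<open>A small multiple of \<open>x - y\<close> as frequency puts both angles into the range
  where the sine is injective, and a sine is a cosine with phase \<open>- (pi / 2)\<close>.\<close>

lemma trig_polys_separate:
  fixes x y :: "'a::real_inner"
  assumes "x \<noteq> y"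
  shows "\<exists>f\<in>trig_polys. f x \<noteq> f y"
proof -
  define z where "z = x - y"
  define t where "t = 1 / (\<bar>z \<bullet> x\<bar> + \<bar>z \<bullet> y\<bar> + 1)"
  have den: "\<bar>z \<bullet> x\<bar> + \<bar>z \<bullet> y\<bar> + 1 > 0" by (simp add: add_nonneg_pos)
  have t: "t > 0" using den by (simp add: t_def)
  have small: "\<bar>t * (z \<bullet> w)\<bar> \<le> 1" if "w = x \<or> w = y" for w
    using that den by (auto simp: t_def abs_mult)
  have "pi / 2 > 1" using pi_gt3 by simp
  then have range: "- (pi / 2) \<le> t * (z \<bullet> w)" "t * (z \<bullet> w) \<le> pi / 2" if "w = x \<or> w = y" for w
    using small[OF that] by auto
  have "z \<bullet> x - z \<bullet> y = z \<bullet> z" by (simp add: z_def inner_diff_right)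
  also have "\<dots> \<noteq> 0" using assms by (simp add: z_def)
  finally have "t * (z \<bullet> x) \<noteq> t * (z \<bullet> y)" using t by auto
  then have "sin (t * (z \<bullet> x)) \<noteq> sin (t * (z \<bullet> y))"
    using sin_inj_pi range by metis
  then have "1 * cos ((t *\<^sub>R z) \<bullet> x + (- (pi / 2))) \<noteq> 1 * cos ((t *\<^sub>R z) \<bullet> y + (- (pi / 2)))"
    by (simp add: cos_diff)
  with trig_polys.cos[of 1 "t *\<^sub>R z" "- (pi / 2)"] show ?thesis by (metis (no_types, lifting))
qed

lemma trig_polys_compose_polynomial:
  fixes q :: "real \<Rightarrow> real"
  assumes "real_polynomial_function q" "p \<in> trig_polys"
  shows "(\<lambda>x. q (p x)) \<in> trig_polys"
  using assms
proof induction
  case (linear f)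
  then have "f (p x) = f 1 * p x" for x
    using linear_cmul[OF bounded_linear.linear, of f "p x" 1] by simp
  then show ?case using linear by (simp add: trig_polys_mult trig_polys_const)
qed (auto intro: trig_polys_const trig_polys.add trig_polys_mult)

text \<open>
  A trigonometric polynomial that approximates \<open>f\<close> on a ball may be large outside of it; composing
  it with a polynomial that approximates the truncation function repairs this.
\<close>

lemma trig_polys_approx:
  fixes f :: "'a::euclidean_space \<Rightarrow> real"
  assumes f: "continuous_on UNIV f" "\<And>x. \<bar>f x\<bar> \<le> B" and "e > 0"
  obtains r where "r \<in> trig_polys" "\<And>x. \<bar>r x\<bar> \<le> B + e" "\<And>x. norm x \<le> L \<Longrightarrow> \<bar>f x - r x\<bar> \<le> 2 * e"
proof -
  interpret trig: function_ring_on "trig_polys :: ('a \<Rightarrow> real) set" "cball 0 L"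
    by unfold_locales
      (auto intro: trig_polys_const trig_polys.add trig_polys_mult trig_polys_continuous trig_polys_separate)
  obtain p where p: "p \<in> trig_polys" "\<And>x. x \<in> cball 0 L \<Longrightarrow> \<bar>f x - p x\<bar> < e"
    using trig.Stone_Weierstrass_basic[OF continuous_on_subset[OF f(1)] \<open>e > 0\<close>] by auto
  obtain R where R: "\<And>x. \<bar>p x\<bar> \<le> R" using trig_polys_bounded[OF p(1)] by blast
  define c where "c t = max (- B) (min B t)" for t
  have "continuous_on {-R..R} c" unfolding c_def by (intro continuous_intros)
  then obtain q where q: "real_polynomial_function q" "\<And>t. t \<in> {-R..R} \<Longrightarrow> \<bar>c t - q t\<bar> < e"
    using Stone_Weierstrass_real_polynomial_function[of "{-R..R}" c e] \<open>e > 0\<close> by auto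
  have B: "B \<ge> 0" using f(2)[of 0] by simp
  have qp: "\<bar>c (p x) - q (p x)\<bar> < e" for x
    using q(2)[of "p x"] R[of x] by (auto simp: abs_le_iff)
  show ?thesis
  proof
    show "(\<lambda>x. q (p x)) \<in> trig_polys" using q(1) p(1) by (rule trig_polys_compose_polynomial)
    show "\<bar>q (p x)\<bar> \<le> B + e" for x
      using qp[of x] B by (auto simp: c_def max_def min_def abs_le_iff split: if_splits)
    show "\<bar>f x - q (p x)\<bar> \<le> 2 * e" if "norm x \<le> L" for x
    proof -
      \<comment> \<open>Truncation to the interval from \<open>- B\<close> to \<open>B\<close> does
        not increase the distance to \<open>f x\<close>, which lies in that interval.\<close>
      have "\<bar>f x - c (p x)\<bar> \<le> e"
        using p(2)[of x] that f(2)[of x] by (auto simp: c_def max_def min_def abs_le_iff split: if_splits)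
      then show ?thesis using qp[of x] by simp
    qed
  qed
qed

section \<open>Weak convergence from cosine integrals and tightness\<close>

lemma prob_space_tight:
  fixes N :: "'a::real_normed_vector measure"
  assumes "prob_space N" "sets N = sets borel" "e > 0"
  shows "\<exists>L. measure N {x. norm x > L} \<le> e"
proof -
  interpret prob_space N by fact
  have "(\<lambda>k. measure N {x. norm x > real k}) \<longlonglongrightarrow> measure N (\<Inter>k. {x. norm x > real k})"
  proof (rule finite_Lim_measure_decseq)
    show "range (\<lambda>k. {x :: 'a. norm x > real k}) \<subseteq> sets N"
      unfolding assms(2) by (auto intro!: borel_open open_Collect_less continuous_intros)
  qed (auto simp: decseq_def)
  moreover have "(\<Inter>k. {x :: 'a. norm x > real k}) = {}"
  proof safe
    fix x :: 'a assume x: "x \<in> (\<Inter>k. {x. norm x > real k})"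
    obtain k where "norm x < real k" using reals_Archimedean2 by blast
    moreover have "x \<in> {x. norm x > real k}" using x by (rule INT_D) simp
    ultimately show "x \<in> {}" by simp
  qed
  ultimately have "eventually (\<lambda>k. measure N {x. norm x > real k} < e) sequentially"
    using \<open>e > 0\<close> by (intro order_tendstoD(2)[of _ 0]) simp_all
  then obtain k where "measure N {x. norm x > real k} < e"
    using eventually_happens[of _ sequentially] by auto
  then show ?thesis by (intro exI[of _ "real k"]) simp
qed

text \<open>On the ball the integrands are within \<open>2 * e\<close> of each other; off the ball
  they differ by at most \<open>2 * B + e\<close>, but the mass there is at most
  \<open>e\<close>.\<close>

lemma prob_integral_diff_le:
  fixes f r :: "'a::real_normed_vector \<Rightarrow> real"
  assumes N: "prob_space N" "sets N = sets borel"
    and f: "continuous_on UNIV f" "\<And>x. \<bar>f x\<bar> \<le> B"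
    and r: "continuous_on UNIV r" "\<And>x. \<bar>r x\<bar> \<le> B + e" "\<And>x. norm x \<le> L \<Longrightarrow> \<bar>f x - r x\<bar> \<le> 2 * e"
    and tail: "measure N {x. norm x > L} \<le> e" and e: "e > 0"
  shows "\<bar>(\<integral>x. f x \<partial>N) - (\<integral>x. r x \<partial>N)\<bar> \<le> 2 * e + (2 * B + e) * e"
proof -
  interpret prob_space N by fact
  have meas: "f \<in> borel_measurable N" "r \<in> borel_measurable N"
    using borel_measurable_continuous_onI[OF f(1)] borel_measurable_continuous_onI[OF r(1)]
    by (simp_all add: measurable_cong_sets[OF N(2) refl])
  have intf: "integrable N f" by (rule integrable_const_bound[where B = B]) (auto simp: f meas)
  have intr: "integrable N r" by (rule integrable_const_bound[where B = "B + e"]) (auto simp: r meas)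
  have B: "B \<ge> 0" using f(2)[of 0] by simp
  have set: "{x. norm x > L} \<in> sets N"
    unfolding N(2) by (intro borel_open open_Collect_less continuous_intros)
  have "\<bar>(\<integral>x. f x \<partial>N) - (\<integral>x. r x \<partial>N)\<bar> = \<bar>\<integral>x. f x - r x \<partial>N\<bar>"
    using intf intr by simp
  also have "\<dots> \<le> (\<integral>x. \<bar>f x - r x\<bar> \<partial>N)" by (rule integral_abs_bound)
  also have "\<dots> \<le> (\<integral>x. 2 * e + (2 * B + e) * indicator {x. norm x > L} x \<partial>N)"
  proof (rule integral_mono)
    show "integrable N (\<lambda>x. \<bar>f x - r x\<bar>)" using intf intr by auto
    show "integrable N (\<lambda>x. 2 * e + (2 * B + e) * indicator {x. norm x > L} x)"
      using set by (intro Bochner_Integration.integrable_add integrable_mult_right integrable_real_indicator)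
        (auto simp: emeasure_eq_measure)
    show "\<bar>f x - r x\<bar> \<le> 2 * e + (2 * B + e) * indicator {x. norm x > L} x" for x
      using f(2)[of x] r(2)[of x] r(3)[of x] e B by (auto simp: indicator_def)
  qed
  also have "\<dots> = 2 * e + (2 * B + e) * measure N {x. norm x > L}"
    using set by (subst Bochner_Integration.integral_add)
      (auto simp: prob_space emeasure_eq_measure intro!: integrable_mult_right integrable_real_indicator)
  also have "\<dots> \<le> 2 * e + (2 * B + e) * e"
    using tail B e by (intro add_left_mono mult_left_mono) auto
  finally show ?thesis .
qed

text \<open>A form of Levy's continuity theorem. Cosine integrals determine the integrals of all
  trigonometric polynomials, and tightness allows a bounded continuous function to be replaced by
  such a polynomial on one ball for almost all \<open>n\<close> simultaneously.\<close>

theorem converges_weakly_if_cos_tight: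
  fixes \<mu> :: "nat \<Rightarrow> 'a::euclidean_space measure"
  assumes \<mu>: "\<And>n. prob_space (\<mu> n)" "\<And>n. sets (\<mu> n) = sets borel"
    and N: "prob_space N" "sets N = sets borel"
    and cos: "\<And>h b. (\<lambda>n. \<integral>x. cos (h \<bullet> x + b) \<partial>\<mu> n) \<longlonglongrightarrow> (\<integral>x. cos (h \<bullet> x + b) \<partial>N)"
    and tight: "\<And>e. e > 0 \<Longrightarrow> \<exists>L. \<forall>\<^sub>F n in sequentially. measure (\<mu> n) {x. norm x > L} \<le> e"
  shows "converges_weakly \<mu> N"
  unfolding converges_weakly_def
proof (intro allI impI)
  fix f :: "'a \<Rightarrow> real" assume cont: "continuous_on UNIV f" and "bounded (range f)"
  then obtain B where B: "\<And>x. \<bar>f x\<bar> \<le> B" by (auto simp: bounded_iff)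
  then have "B \<ge> 0" using abs_ge_zero order_trans by blast
  have int: "integrable K g" if "prob_space K" "sets K = sets borel" "g \<in> trig_polys"
    for K and g :: "'a \<Rightarrow> real"
  proof -
    interpret prob_space K by fact
    obtain R where "\<And>x. \<bar>g x\<bar> \<le> R" using trig_polys_bounded[OF \<open>g \<in> trig_polys\<close>] by blast
    then show ?thesis
      using borel_measurable_continuous_onI[OF trig_polys_continuous[OF that(3)]]
      by (intro integrable_const_bound[where B = R]) (auto simp: measurable_cong_sets[OF that(2) refl])
  qed
  have lim: "(\<lambda>n. \<integral>x. g x \<partial>\<mu> n) \<longlonglongrightarrow> (\<integral>x. g x \<partial>N)" if "g \<in> trig_polys" for g
    using that
  proof induction
    case (cos a h b)
    then show ?case using assms(5)[of h b] by (auto intro!: tendsto_mult_left)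
  next
    case (add f g)
    then show ?case
      using int[OF \<mu>] int[OF N] by (simp add: tendsto_add)
  qed
  show "(\<lambda>n. \<integral>x. f x \<partial>\<mu> n) \<longlonglongrightarrow> (\<integral>x. f x \<partial>N)"
  proof (rule LIMSEQ_I)
    fix e' :: real assume "e' > 0"
    \<comment> \<open>Two approximation errors and one convergence error add up to
      \<open>2 * (2 * e + (2 * B + e) * e) + e\<close>, which for \<open>e \<le> 1\<close> is at
      most \<open>e * (7 + 4 * B)\<close>. The 8 makes the inequality strict.\<close>
    define e where "e = min 1 (e' / (8 + 4 * B))"
    have pos: "8 + 4 * B > 0" using \<open>B \<ge> 0\<close> by simp
    have e: "e > 0" "e \<le> 1" using \<open>e' > 0\<close> pos by (auto simp: e_def)
    have "e \<le> e' / (8 + 4 * B)" by (simp add: e_def)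
    then have e3: "e * (8 + 4 * B) \<le> e'" using pos by (simp only: pos_le_divide_eq)
    obtain L1 where L1: "\<forall>\<^sub>F n in sequentially. measure (\<mu> n) {x. norm x > L1} \<le> e"
      using tight[OF e(1)] by blast
    obtain L2 where L2: "measure N {x. norm x > L2} \<le> e"
      using prob_space_tight[OF N e(1)] by blast
    define L where "L = max L1 L2"
    have LN: "measure N {x. norm x > L} \<le> e"
    proof -
      interpret prob_space N by fact
      have "measure N {x. norm x > L} \<le> measure N {x. norm x > L2}"
        by (rule finite_measure_mono)
          (auto simp: L_def N(2) intro!: borel_open open_Collect_less continuous_intros)
      then show ?thesis using L2 by simp
    qed
    obtain r where r: "r \<in> trig_polys" "\<And>x. \<bar>r x\<bar> \<le> B + e" "\<And>x. norm x \<le> L \<Longrightarrow> \<bar>f x - r x\<bar> \<le> 2 * e"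
      using trig_polys_approx[OF cont B e(1), of L] by blast
    have diff: "\<bar>(\<integral>x. f x \<partial>K) - (\<integral>x. r x \<partial>K)\<bar> \<le> 2 * e + (2 * B + e) * e"
      if "prob_space K" "sets K = sets borel" "measure K {x. norm x > L} \<le> e" for K
      using prob_integral_diff_le[OF that(1,2) cont B trig_polys_continuous[OF r(1)] r(2) _ that(3) e(1)] r(3)
      by blast
    have "\<forall>\<^sub>F n in sequentially. \<bar>(\<integral>x. r x \<partial>\<mu> n) - (\<integral>x. r x \<partial>N)\<bar> < e"
      using tendstoD[OF lim[OF r(1)] e(1)] by (simp add: dist_real_def)
    with L1 have "\<forall>\<^sub>F n in sequentially. norm ((\<integral>x. f x \<partial>\<mu> n) - (\<integral>x. f x \<partial>N)) < e'"
    proof eventually_elim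
      case (elim n)
      interpret prob_space "\<mu> n" by (rule \<mu>)
      have "measure (\<mu> n) {x. norm x > L} \<le> measure (\<mu> n) {x. norm x > L1}"
        by (rule finite_measure_mono)
          (auto simp: L_def \<mu>(2) intro!: borel_open open_Collect_less continuous_intros)
      then have "\<bar>(\<integral>x. f x \<partial>\<mu> n) - (\<integral>x. r x \<partial>\<mu> n)\<bar> \<le> 2 * e + (2 * B + e) * e"
        using elim by (intro diff \<mu>) auto
      moreover have "\<bar>(\<integral>x. f x \<partial>N) - (\<integral>x. r x \<partial>N)\<bar> \<le> 2 * e + (2 * B + e) * e"
        using LN by (intro diff N)
      moreover have "2 * (2 * e + (2 * B + e) * e) + e < e'"
      proof -
        have "e * e \<le> 1 * e" using e by (intro mult_right_mono) auto
        then have "2 * (2 * e + (2 * B + e) * e) + e \<le> e * (7 + 4 * B)" by (simp add: algebra_simps)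
        also have "\<dots> < e * (8 + 4 * B)" using e by simp
        finally show ?thesis using e3 by simp
      qed
      moreover have arith: "\<bar>x - z\<bar> < e'"
        if "\<bar>x - r1\<bar> \<le> k" "\<bar>z - r2\<bar> \<le> k" "2 * k + e < e'" "\<bar>r1 - r2\<bar> < e" for x z r1 r2 k :: real
        using that unfolding abs_le_iff abs_less_iff by auto
      ultimately show ?case using elim(2) unfolding real_norm_def by (intro arith) assumption+
    qed
    then show "\<exists>no. \<forall>n\<ge>no. norm ((\<integral>x. f x \<partial>\<mu> n) - (\<integral>x. f x \<partial>N)) < e'"
      by (simp add: eventually_sequentially)
  qed
qed

section \<open>Second moments and the multivariate central limit theorem\<close>

lemma (in prob_space) indep_sum_second_moment:
  fixes X :: "nat \<Rightarrow> 'a \<Rightarrow> real"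
  assumes ind: "indep_vars (\<lambda>_. borel) X UNIV"
    and int: "\<And>i. integrable M (\<lambda>x. (X i x)\<^sup>2)" and mean: "\<And>i. expectation (X i) = 0"
  shows "integrable M (\<lambda>x. (\<Sum>i<n. X i x)\<^sup>2)"
    and "expectation (\<lambda>x. (\<Sum>i<n. X i x)\<^sup>2) = (\<Sum>i<n. expectation (\<lambda>x. (X i x)\<^sup>2))"
proof -
  have meas[measurable]: "X i \<in> borel_measurable M" for i
    using ind by (auto simp: indep_vars_def)
  have intX: "integrable M (X i)" for i
    using square_integrable_imp_integrable[OF meas int] .
  have "integrable M (\<lambda>x. (\<Sum>i<n. X i x)\<^sup>2) \<and>
    expectation (\<lambda>x. (\<Sum>i<n. X i x)\<^sup>2) = (\<Sum>i<n. expectation (\<lambda>x. (X i x)\<^sup>2))"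
  proof (induction n)
    case (Suc n)
    have "indep_var borel (X n) borel (\<lambda>x. \<Sum>i<n. X i x)"
      by (rule indep_vars_sum) (auto intro: indep_vars_subset[OF ind])
    moreover have "integrable M (\<lambda>x. \<Sum>i<n. X i x)" using intX by auto
    ultimately have cross: "integrable M (\<lambda>x. X n x * (\<Sum>i<n. X i x))"
      "expectation (\<lambda>x. X n x * (\<Sum>i<n. X i x)) = 0"
      using indep_var_integrable[of "X n" "\<lambda>x. \<Sum>i<n. X i x"]
        indep_var_lebesgue_integral[of "X n" "\<lambda>x. \<Sum>i<n. X i x"] intX[of n] mean[of n] by auto
    have sq: "(\<Sum>i<Suc n. X i x)\<^sup>2 = (\<Sum>i<n. X i x)\<^sup>2 + (X n x)\<^sup>2 + 2 * (X n x * (\<Sum>i<n. X i x))" for x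
      by (simp add: power2_eq_square algebra_simps)
    show ?case
      unfolding sq using Suc int[of n] cross by simp
  qed simp
  then show "integrable M (\<lambda>x. (\<Sum>i<n. X i x)\<^sup>2)"
    and "expectation (\<lambda>x. (\<Sum>i<n. X i x)\<^sup>2) = (\<Sum>i<n. expectation (\<lambda>x. (X i x)\<^sup>2))"
    by auto
qed

lemma (in prob_space) prob_abs_ge_second_moment:
  fixes X :: "'a \<Rightarrow> real"
  assumes [measurable]: "X \<in> borel_measurable M" and "integrable M (\<lambda>x. (X x)\<^sup>2)" "c > 0"
  shows "prob {x \<in> space M. \<bar>X x\<bar> \<ge> c} \<le> expectation (\<lambda>x. (X x)\<^sup>2) / c\<^sup>2"
proof -
  have "{x \<in> space M. \<bar>X x\<bar> \<ge> c} = {x \<in> space M. (X x)\<^sup>2 \<ge> c\<^sup>2}"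
    using \<open>c > 0\<close> abs_le_square_iff[of c] by auto
  also have "prob \<dots> \<le> expectation (\<lambda>x. (X x)\<^sup>2) / c\<^sup>2"
    using assms by (intro integral_Markov_inequality_measure[where A = "{}"]) auto
  finally show ?thesis .
qed

text \<open>Both branches of \<open>normal_law\<close> are images of the standard normal law under
  scaling, so the degenerate limit needs no separate treatment from here on.\<close>

lemma normal_law_cos:
  assumes "v \<ge> 0"
  shows "(\<integral>x. cos (x + b) \<partial>normal_law 0 v) = (\<integral>x. cos (sqrt v * x + b) \<partial>std_normal_distribution)"
proof (cases "v = 0")
  case True
  interpret S: prob_space std_normal_distribution
    using prob_space_normal_density by simp
  show ?thesis using True S.prob_space by (simp add: normal_law_def integral_return)
next
  case False
  interpret S: prob_space std_normal_distribution
    using prob_space_normal_density by simp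
  have "distributed std_normal_distribution lborel (\<lambda>x. x) (normal_density 0 1)"
  proof -
    have "distr std_normal_distribution lborel (\<lambda>x. x) = distr std_normal_distribution std_normal_distribution (\<lambda>x. x)"
      by (rule distr_cong) auto
    then show ?thesis by (simp add: distributed_def distr_id2)
  qed
  from S.normal_density_affine[OF this, of "sqrt v" 0] False assms
  have "distr std_normal_distribution lborel (\<lambda>x. 0 + sqrt v * x) = density lborel (normal_density 0 (sqrt v))"
    by (simp add: distributed_def)
  then have "(\<integral>x. cos (x + b) \<partial>density lborel (normal_density 0 (sqrt v)))
      = (\<integral>x. cos (x + b) \<partial>distr std_normal_distribution lborel (\<lambda>x. sqrt v * x))" by simp
  also have "\<dots> = (\<integral>x. cos (sqrt v * x + b) \<partial>std_normal_distribution)"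
    by (rule integral_distr) auto
  finally show ?thesis using False by (simp add: normal_law_def)
qed

lemma (in prob_space) central_limit_cos:
  fixes X :: "nat \<Rightarrow> 'a \<Rightarrow> real"
  assumes ind: "indep_vars (\<lambda>_. borel) X UNIV" and law: "\<And>n. distr M borel (X n) = \<mu>"
    and int: "\<And>i. integrable M (\<lambda>x. (X i x)\<^sup>2)" and mean: "\<And>i. expectation (X i) = 0"
    and var: "\<And>i. expectation (\<lambda>x. (X i x)\<^sup>2) = v"
  shows "(\<lambda>n. expectation (\<lambda>x. cos ((\<Sum>i<n. X i x) / sqrt n + b)))
    \<longlonglongrightarrow> (\<integral>x. cos (x + b) \<partial>normal_law 0 v)"
proof -
  have meas[measurable]: "X i \<in> borel_measurable M" for i
    using ind by (auto simp: indep_vars_def)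
  have v: "v \<ge> 0" using var[of 0] by (metis integral_nonneg_AE AE_I2 zero_le_power2)
  show ?thesis
  proof (cases "v = 0")
    case True
    \<comment> \<open>Zero variance makes all summands vanish almost surely, which is the degenerate
      limit. The central limit theorem for positive variance covers the other case.\<close>
    have "AE x in M. X i x = 0" for i
      using integral_nonneg_eq_0_iff_AE[OF int[of i]] var[of i] True by simp
    then have "AE x in M. \<forall>i. X i x = 0" by (simp add: AE_all_countable)
    then have "expectation (\<lambda>x. cos ((\<Sum>i<n. X i x) / sqrt n + b)) = expectation (\<lambda>x. cos b)" for n
      by (intro integral_cong_AE) auto
    then show ?thesis using True by (simp add: normal_law_def integral_return prob_space)
  next
    case False
    then have s: "sqrt v > 0" using v by simp
    define \<mu>' where "\<mu>' n = distr M borel (\<lambda>x. (\<Sum>i<n. X i x) / sqrt (n * (sqrt v)\<^sup>2))" for n :: nat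
    have conv: "weak_conv_m \<mu>' std_normal_distribution"
      unfolding \<mu>'_def
      by (rule central_limit_theorem_zero_mean[OF ind mean s int _ law])
        (use var v mean in \<open>simp add: variance_mean_zero\<close>)
    have rd: "real_distribution (\<mu>' n)" for n unfolding \<mu>'_def by (rule real_distribution_distr) auto
    have "(\<lambda>n. \<integral>x. cos (sqrt v * x + b) \<partial>\<mu>' n) \<longlonglongrightarrow> (\<integral>x. cos (sqrt v * x + b) \<partial>std_normal_distribution)"
      by (rule weak_conv_imp_integral_bdd_continuous_conv[OF rd real_dist_normal_dist conv, where B = 1])
        (auto intro!: continuous_intros)
    moreover have "(\<integral>x. cos (sqrt v * x + b) \<partial>\<mu>' n) = expectation (\<lambda>x. cos ((\<Sum>i<n. X i x) / sqrt n + b))" for n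
    proof -
      have "sqrt v * ((\<Sum>i<n. X i x) / sqrt (n * (sqrt v)\<^sup>2)) = (\<Sum>i<n. X i x) / sqrt n" for x
        using s v by (simp add: real_sqrt_mult)
      then show ?thesis unfolding \<mu>'_def by (subst integral_distr) auto
    qed
    ultimately show ?thesis using normal_law_cos[OF v, of b] by simp
  qed
qed

text \<open>Summing the scalar second moments over an orthonormal basis gives the trace of the
  covariance, whatever \<open>n\<close> is. Chebyshev's inequality turns this into
  tightness.\<close>

lemma (in prob_space) normalized_sum_second_moment:
  fixes Y :: "nat \<Rightarrow> 'a \<Rightarrow> 'b::euclidean_space"
  assumes ind: "indep_vars (\<lambda>_. borel) Y UNIV"
    and int: "\<And>i h. integrable M (\<lambda>x. (Y i x \<bullet> h)\<^sup>2)" and mean: "\<And>i h. expectation (\<lambda>x. Y i x \<bullet> h) = 0"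
    and var: "\<And>i h. expectation (\<lambda>x. (Y i x \<bullet> h)\<^sup>2) = q h" and n: "n \<ge> 1"
  shows "integrable M (\<lambda>x. (norm ((1 / sqrt n) *\<^sub>R (\<Sum>i<n. Y i x)))\<^sup>2)"
    and "expectation (\<lambda>x. (norm ((1 / sqrt n) *\<^sub>R (\<Sum>i<n. Y i x)))\<^sup>2) = (\<Sum>b\<in>Basis. q b)"
proof -
  have indh: "indep_vars (\<lambda>_. borel) (\<lambda>i x. Y i x \<bullet> h) UNIV" for h
    by (rule indep_vars_compose2[OF ind]) simp
  note moment = indep_sum_second_moment[OF indh int mean]
  have eq: "(norm ((1 / sqrt n) *\<^sub>R (\<Sum>i<n. Y i x)))\<^sup>2 = (\<Sum>b\<in>Basis. (\<Sum>i<n. Y i x \<bullet> b)\<^sup>2 / n)" for x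
  proof -
    have "(norm ((1 / sqrt n) *\<^sub>R (\<Sum>i<n. Y i x)))\<^sup>2 = (1 / n) * (norm (\<Sum>i<n. Y i x))\<^sup>2"
      by (simp add: power_mult_distrib power_divide)
    also have "(norm (\<Sum>i<n. Y i x))\<^sup>2 = (\<Sum>b\<in>Basis. ((\<Sum>i<n. Y i x) \<bullet> b)\<^sup>2)"
      unfolding power2_norm_eq_inner by (subst euclidean_inner) (simp add: power2_eq_square)
    finally show ?thesis by (simp add: inner_sum_left sum_divide_distrib)
  qed
  show "integrable M (\<lambda>x. (norm ((1 / sqrt n) *\<^sub>R (\<Sum>i<n. Y i x)))\<^sup>2)"
    unfolding eq using moment(1) by auto
  have "expectation (\<lambda>x. (norm ((1 / sqrt n) *\<^sub>R (\<Sum>i<n. Y i x)))\<^sup>2) = (\<Sum>b\<in>Basis. n * q b / n)"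
    unfolding eq using moment(1) by (simp add: moment(2) var)
  then show "expectation (\<lambda>x. (norm ((1 / sqrt n) *\<^sub>R (\<Sum>i<n. Y i x)))\<^sup>2) = (\<Sum>b\<in>Basis. q b)"
    using n by simp
qed

lemma abs_cos_diff_le: "\<bar>cos x - cos y\<bar> \<le> \<bar>x - y\<bar>" for x y :: real
proof -
  have "\<bar>sin ((x + y) / 2)\<bar> * \<bar>sin ((y - x) / 2)\<bar> \<le> 1 * \<bar>(y - x) / 2\<bar>"
    by (intro mult_mono abs_sin_x_le_abs_x) auto
  then show ?thesis by (simp add: cos_diff_cos abs_mult abs_minus_commute)
qed

text \<open>The Cramer-Wold device and Slutsky's lemma in one: the scalar central limit theorem
  handles each functional of the normalized sums, and \<open>U n\<close> inherits both the cosine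
  limits and the tightness because its distance to these sums vanishes in probability.\<close>

theorem (in prob_space) central_limit_Slutsky:
  fixes Y U :: "nat \<Rightarrow> 'a \<Rightarrow> 'b::euclidean_space"
  assumes ind: "indep_vars (\<lambda>_. borel) Y UNIV" and law: "\<And>n. distr M borel (Y n) = \<mu>"
    and int: "\<And>i h. integrable M (\<lambda>x. (Y i x \<bullet> h)\<^sup>2)" and mean: "\<And>i h. expectation (\<lambda>x. Y i x \<bullet> h) = 0"
    and var: "\<And>i h. expectation (\<lambda>x. (Y i x \<bullet> h)\<^sup>2) = Q h \<bullet> h"
    and N: "is_gaussian N 0 Q"
    and U: "\<And>n. n \<ge> 1 \<Longrightarrow> U n \<in> borel_measurable M"
    and diff: "\<And>e. e > 0 \<Longrightarrow>
      (\<lambda>n. prob {x \<in> space M. norm (U n x - (1 / sqrt n) *\<^sub>R (\<Sum>i<n. Y i x)) > e}) \<longlonglongrightarrow> 0"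
  shows "converges_weakly (\<lambda>n. distr M borel (U n)) N"
proof -
  have Y[measurable]: "Y i \<in> borel_measurable M" for i
    using ind by (auto simp: indep_vars_def)
  define S where "S n x = (1 / sqrt n) *\<^sub>R (\<Sum>i<n. Y i x)" for n x
  have S[measurable]: "S n \<in> borel_measurable M" for n
    unfolding S_def by measurable
  note diff = diff[folded S_def]
  note second = normalized_sum_second_moment[OF ind int mean var, folded S_def]
  have Nprob: "prob_space N" "sets N = sets borel" using N by (auto simp: is_gaussian_def)
  \<comment> \<open>\<open>U 0\<close> need not be a random variable. The shifted sequence is
    measurable at every index and has the same limit.\<close>
  define V where "V n = U (Suc n)" for n
  have V[measurable]: "V n \<in> borel_measurable M" for n unfolding V_def by (rule U) simp
  have indh: "indep_vars (\<lambda>_. borel) (\<lambda>i x. Y i x \<bullet> h) UNIV" for h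
    by (rule indep_vars_compose2[OF ind]) simp
  have lawh: "distr M borel (\<lambda>x. Y i x \<bullet> h) = distr \<mu> borel (\<lambda>y. y \<bullet> h)" for i h
    unfolding law[of i, symmetric] by (subst distr_distr) (auto simp: comp_def)
  have cosS: "(\<lambda>n. expectation (\<lambda>x. cos (h \<bullet> S n x + b))) \<longlonglongrightarrow> (\<integral>x. cos (h \<bullet> x + b) \<partial>N)" for h b
  proof -
    have "distr N borel (\<lambda>x. x \<bullet> h) = normal_law 0 (Q h \<bullet> h)"
      using N by (simp add: is_gaussian_def)
    moreover have "(\<integral>x. cos (x + b) \<partial>distr N borel (\<lambda>x. x \<bullet> h)) = (\<integral>x. cos (x \<bullet> h + b) \<partial>N)"
      by (rule integral_distr) (auto simp: measurable_cong_sets[OF Nprob(2) refl])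
    ultimately have "(\<integral>x. cos (h \<bullet> x + b) \<partial>N) = (\<integral>x. cos (x + b) \<partial>normal_law 0 (Q h \<bullet> h))"
      by (simp add: inner_commute)
    moreover have "h \<bullet> S n x = (\<Sum>i<n. Y i x \<bullet> h) / sqrt n" for n x
      by (simp add: S_def inner_sum_right inner_commute)
    ultimately show ?thesis
      using central_limit_cos[OF indh lawh int mean var, of h b] by simp
  qed
  have evd: "\<forall>\<^sub>F n in sequentially. prob {x \<in> space M. norm (V n x - S (Suc n) x) > e} < d"
    if "e > 0" "d > 0" for e d
    using order_tendstoD(2)[OF LIMSEQ_Suc[OF diff[OF \<open>e > 0\<close>]] \<open>d > 0\<close>] by (simp add: V_def)
  have cosV: "(\<lambda>n. expectation (\<lambda>x. cos (h \<bullet> V n x + b))) \<longlonglongrightarrow> (\<integral>x. cos (h \<bullet> x + b) \<partial>N)" for h b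
  proof -
    have "(\<lambda>n. expectation (\<lambda>x. cos (h \<bullet> V n x + b)) - expectation (\<lambda>x. cos (h \<bullet> S (Suc n) x + b))) \<longlonglongrightarrow> 0"
    proof (rule LIMSEQ_I)
      fix e :: real assume "e > 0"
      \<comment> \<open>Off an event of probability below \<open>e / 4\<close> the cosines differ by
        at most \<open>norm h * d\<close>, which is below \<open>e / 2\<close>; on it they differ by
        at most 2.\<close>
      define d where "d = e / (2 * (norm h + 1))"
      have np: "norm h + 1 > 0" by (simp add: add_nonneg_pos)
      have d: "d > 0" using \<open>e > 0\<close> np by (simp add: d_def)
      have e4: "e / 4 > 0" using \<open>e > 0\<close> by simp
      have hd: "norm h * d < e / 2"
      proof -
        have "norm h * d < (norm h + 1) * d" using d by simp
        also have "\<dots> = e / 2" using np by (simp add: d_def field_simps)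
        finally show ?thesis .
      qed
      have "\<forall>\<^sub>F n in sequentially. norm (expectation (\<lambda>x. cos (h \<bullet> V n x + b))
          - expectation (\<lambda>x. cos (h \<bullet> S (Suc n) x + b)) - 0) < e"
        using evd[OF d e4]
      proof eventually_elim
        case (elim n)
        let ?A = "{x \<in> space M. norm (V n x - S (Suc n) x) > d}"
        have A: "?A \<in> events" by measurable
        have i: "integrable M (\<lambda>x. cos (h \<bullet> Z x + b))" if "Z \<in> borel_measurable M" for Z
          using that by (intro integrable_const_bound[where B = 1]) auto
        have ind: "integrable M (\<lambda>x. norm h * d + 2 * indicator ?A x)"
          using A by (intro Bochner_Integration.integrable_add integrable_mult_right integrable_real_indicator)
            (auto simp: emeasure_eq_measure)
        have "\<bar>expectation (\<lambda>x. cos (h \<bullet> V n x + b)) - expectation (\<lambda>x. cos (h \<bullet> S (Suc n) x + b))\<bar>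
          = \<bar>expectation (\<lambda>x. cos (h \<bullet> V n x + b) - cos (h \<bullet> S (Suc n) x + b))\<bar>"
          using i[OF V] i[OF S] by simp
        also have "\<dots> \<le> expectation (\<lambda>x. \<bar>cos (h \<bullet> V n x + b) - cos (h \<bullet> S (Suc n) x + b)\<bar>)"
          by (rule integral_abs_bound)
        also have "\<dots> \<le> expectation (\<lambda>x. norm h * d + 2 * indicator ?A x)"
        proof (rule integral_mono[OF _ ind])
          show "integrable M (\<lambda>x. \<bar>cos (h \<bullet> V n x + b) - cos (h \<bullet> S (Suc n) x + b)\<bar>)"
            using i[OF V] i[OF S] by auto
          show "\<bar>cos (h \<bullet> V n x + b) - cos (h \<bullet> S (Suc n) x + b)\<bar> \<le> norm h * d + 2 * indicator ?A x"
            if "x \<in> space M" for x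
          proof (cases "x \<in> ?A")
            case True
            have "\<bar>cos (h \<bullet> V n x + b) - cos (h \<bullet> S (Suc n) x + b)\<bar> \<le> 1 + 1"
              by (rule order_trans[OF abs_triangle_ineq4 add_mono]) auto
            moreover have "0 \<le> norm h * d" using d by simp
            ultimately show ?thesis using True by simp
          next
            case False
            have "\<bar>cos (h \<bullet> V n x + b) - cos (h \<bullet> S (Suc n) x + b)\<bar> \<le> \<bar>h \<bullet> V n x + b - (h \<bullet> S (Suc n) x + b)\<bar>"
              by (rule abs_cos_diff_le)
            also have "\<dots> = \<bar>h \<bullet> (V n x - S (Suc n) x)\<bar>" by (simp add: inner_diff_right)
            also have "\<dots> \<le> norm h * norm (V n x - S (Suc n) x)" by (rule Cauchy_Schwarz_ineq2)
            also have "\<dots> \<le> norm h * d" using False that by (intro mult_left_mono) auto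
            finally show ?thesis using False by simp
          qed
        qed
        also have "\<dots> = norm h * d + 2 * prob ?A"
          using A by (subst Bochner_Integration.integral_add)
            (auto simp: prob_space emeasure_eq_measure intro!: integrable_mult_right integrable_real_indicator)
        also have "\<dots> < e" using elim hd by simp
        finally show ?case by simp
      qed
      then show "\<exists>no. \<forall>n\<ge>no. norm (expectation (\<lambda>x. cos (h \<bullet> V n x + b))
          - expectation (\<lambda>x. cos (h \<bullet> S (Suc n) x + b)) - 0) < e"
        by (simp add: eventually_sequentially)
    qed
    from tendsto_add[OF this LIMSEQ_Suc[OF cosS[of h b]]] show ?thesis by simp
  qed
  have "converges_weakly (\<lambda>n. distr M borel (V n)) N"
  proof (rule converges_weakly_if_cos_tight)
    show "prob_space (distr M borel (V n))" for n by (rule prob_space_distr) simp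
    show "(\<lambda>n. \<integral>x. cos (h \<bullet> x + b) \<partial>distr M borel (V n)) \<longlonglongrightarrow> (\<integral>x. cos (h \<bullet> x + b) \<partial>N)" for h b
      using cosV by (simp add: integral_distr)
    fix e :: real assume "e > 0"
    \<comment> \<open>The trace, increased by 1 to be positive. The choice of \<open>L\<close> makes
      the Chebyshev bound \<open>t / L\<^sup>2\<close> equal to \<open>e / 2\<close>; the other half
      of \<open>e\<close> is for the event that \<open>V n\<close> is farther than 1 from the
      normalized sum.\<close>
    define t where "t = (\<Sum>b\<in>Basis. Q b \<bullet> b) + 1"
    have t: "(\<Sum>b\<in>Basis. Q b \<bullet> b) \<le> t" "t > 0"
      using N by (auto simp: t_def is_gaussian_def intro!: add_nonneg_pos sum_nonneg)
    define L where "L = sqrt (2 * t / e)"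
    have L: "L > 0" "t / L\<^sup>2 = e / 2" using t \<open>e > 0\<close> by (auto simp: L_def)
    have tail: "prob {x \<in> space M. norm (S (Suc n) x) \<ge> L} \<le> e / 2" for n
    proof -
      have "prob {x \<in> space M. \<bar>norm (S (Suc n) x)\<bar> \<ge> L} \<le> expectation (\<lambda>x. (norm (S (Suc n) x))\<^sup>2) / L\<^sup>2"
        using second(1)[of "Suc n"] L by (intro prob_abs_ge_second_moment) auto
      also have "\<dots> \<le> t / L\<^sup>2" using second(2)[of "Suc n"] t by (intro divide_right_mono) auto
      finally show ?thesis using L by simp
    qed
    have "\<forall>\<^sub>F n in sequentially. measure (distr M borel (V n)) {x. norm x > L + 1} \<le> e"
      using evd[OF zero_less_one half_gt_zero[OF \<open>e > 0\<close>]]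
    proof eventually_elim
      case (elim n)
      have "measure (distr M borel (V n)) {x. norm x > L + 1} = prob {x \<in> space M. norm (V n x) > L + 1}"
        by (subst measure_distr) (auto intro!: borel_open open_Collect_less continuous_intros arg_cong[where f = prob])
      also have "\<dots> \<le> prob ({x \<in> space M. norm (S (Suc n) x) \<ge> L} \<union> {x \<in> space M. norm (V n x - S (Suc n) x) > 1})"
      proof (rule finite_measure_mono)
        show "{x \<in> space M. norm (V n x) > L + 1} \<subseteq>
          {x \<in> space M. norm (S (Suc n) x) \<ge> L} \<union> {x \<in> space M. norm (V n x - S (Suc n) x) > 1}"
        proof
          fix x assume x: "x \<in> {x \<in> space M. norm (V n x) > L + 1}"
          have "norm (V n x) \<le> norm (S (Suc n) x) + norm (V n x - S (Suc n) x)"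
            using norm_triangle_ineq[of "S (Suc n) x" "V n x - S (Suc n) x"] by simp
          with x show "x \<in> {x \<in> space M. norm (S (Suc n) x) \<ge> L} \<union> {x \<in> space M. norm (V n x - S (Suc n) x) > 1}"
            by auto
        qed
      qed measurable
      also have "\<dots> \<le> prob {x \<in> space M. norm (S (Suc n) x) \<ge> L} + prob {x \<in> space M. norm (V n x - S (Suc n) x) > 1}"
        by (rule measure_Un_le) measurable
      also have "\<dots> \<le> e" using tail[of n] elim by simp
      finally show ?case .
    qed
    then show "\<exists>L. \<forall>\<^sub>F n in sequentially. measure (distr M borel (V n)) {x. norm x > L} \<le> e" by blast
  qed (use Nprob in auto)
  then have lim: "(\<lambda>n. \<integral>x. f x \<partial>distr M borel (U (Suc n))) \<longlonglongrightarrow> (\<integral>x. f x \<partial>N)"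
    if "continuous_on UNIV f" "bounded (range f)" for f :: "'b \<Rightarrow> real"
    using that by (simp add: converges_weakly_def V_def)
  show ?thesis
    unfolding converges_weakly_def by (intro allI impI LIMSEQ_imp_Suc[OF lim])
qed


section \<open>Chaining\<close>

text \<open>Coordinates are rounded towards 0, so the norm does not increase and the nets stay in
  the unit ball. The mesh \<open>1 / 4 ^ k\<close> shrinks faster than the increments
  \<open>l / 2 ^ k\<close> that chaining allows; the ratio \<open>1 / 2 ^ k\<close> is what the tail
  bound exploits.\<close>

definition dyadic_trunc :: "nat \<Rightarrow> 'a::euclidean_space \<Rightarrow> 'a" where
  "dyadic_trunc k x = (\<Sum>b\<in>Basis. (sgn (x \<bullet> b) * of_int \<lfloor>4 ^ k * \<bar>x \<bullet> b\<bar>\<rfloor> / 4 ^ k) *\<^sub>R b)"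

lemma dyadic_trunc_inner:
  "b \<in> Basis \<Longrightarrow> dyadic_trunc k x \<bullet> b = sgn (x \<bullet> b) * of_int \<lfloor>4 ^ k * \<bar>x \<bullet> b\<bar>\<rfloor> / 4 ^ k"
  unfolding dyadic_trunc_def by (rule inner_sum_left_Basis)

lemma
  fixes t :: real
  shows dyadic_trunc_real_le: "\<bar>sgn t * of_int \<lfloor>4 ^ k * \<bar>t\<bar>\<rfloor> / 4 ^ k\<bar> \<le> \<bar>t\<bar>"
    and dyadic_trunc_real_diff: "\<bar>t - sgn t * of_int \<lfloor>4 ^ k * \<bar>t\<bar>\<rfloor> / 4 ^ k\<bar> \<le> 1 / 4 ^ k"
proof -
  define r where "r = of_int \<lfloor>4 ^ k * \<bar>t\<bar>\<rfloor> / (4 ^ k :: real)"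
  have "0 \<le> r" by (simp add: r_def)
  have "r \<le> 4 ^ k * \<bar>t\<bar> / 4 ^ k" unfolding r_def by (intro divide_right_mono) auto
  then have le: "r \<le> \<bar>t\<bar>" by simp
  have "\<bar>t\<bar> - r = (4 ^ k * \<bar>t\<bar> - of_int \<lfloor>4 ^ k * \<bar>t\<bar>\<rfloor>) / 4 ^ k"
    by (simp add: r_def diff_divide_distrib)
  also have "\<dots> \<le> 1 / 4 ^ k" by (intro divide_right_mono zero_le_power) linarith+
  finally have "\<bar>t\<bar> - r \<le> 1 / 4 ^ k" .
  moreover have "sgn t * of_int \<lfloor>4 ^ k * \<bar>t\<bar>\<rfloor> / 4 ^ k = sgn t * r" by (simp add: r_def)
  ultimately show "\<bar>sgn t * of_int \<lfloor>4 ^ k * \<bar>t\<bar>\<rfloor> / 4 ^ k\<bar> \<le> \<bar>t\<bar>"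
    and "\<bar>t - sgn t * of_int \<lfloor>4 ^ k * \<bar>t\<bar>\<rfloor> / 4 ^ k\<bar> \<le> 1 / 4 ^ k"
    using \<open>0 \<le> r\<close> le by (auto simp: sgn_if abs_if split: if_splits)
qed

lemma norm_dyadic_trunc_le: "norm (dyadic_trunc k x) \<le> norm x"
  by (rule norm_le_componentwise) (simp only: dyadic_trunc_inner dyadic_trunc_real_le)

lemma norm_diff_dyadic_trunc_le:
  fixes x :: "'a::euclidean_space"
  shows "norm (x - dyadic_trunc k x) \<le> DIM('a) / 4 ^ k"
proof -
  have "norm (x - dyadic_trunc k x) \<le> (\<Sum>b\<in>Basis. \<bar>(x - dyadic_trunc k x) \<bullet> b\<bar>)" by (rule norm_le_l1)
  also have "\<dots> \<le> (\<Sum>b\<in>(Basis::'a set). 1 / 4 ^ k)"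
    by (intro sum_mono) (simp only: dyadic_trunc_inner inner_diff_left dyadic_trunc_real_diff)
  finally show ?thesis by simp
qed

lemma dyadic_trunc_tendsto: "(\<lambda>k. dyadic_trunc k x) \<longlonglongrightarrow> (x :: 'a::euclidean_space)"
proof (rule Lim_null_comparison[where g = "\<lambda>k. DIM('a) / 4 ^ k", THEN LIM_zero_cancel])
  show "\<forall>\<^sub>F k in sequentially. norm (dyadic_trunc k x - x) \<le> DIM('a) / 4 ^ k"
    using norm_diff_dyadic_trunc_le[of x] by (simp add: norm_minus_commute)
  show "(\<lambda>k. DIM('a) / 4 ^ k) \<longlonglongrightarrow> 0"
    by (rule LIMSEQ_divide_realpow_zero) simp
qed

definition dyadic_net :: "nat \<Rightarrow> 'a::euclidean_space set" where
  "dyadic_net k = dyadic_trunc k ` cball 0 1"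

lemma dyadic_net_subset: "dyadic_net k \<subseteq> cball 0 1"
  using order_trans[OF norm_dyadic_trunc_le] by (fastforce simp: dyadic_net_def)

text \<open>Each coordinate is an integer multiple of the mesh and takes at most
  \<open>2 * 4 ^ k + 1\<close> values, which is at most \<open>3 * 4 ^ k\<close>.\<close>

lemma
  shows finite_dyadic_net: "finite (dyadic_net k :: 'a::euclidean_space set)"
    and card_dyadic_net: "card (dyadic_net k :: 'a set) \<le> (3 * 4 ^ k) ^ DIM('a)"
proof -
  define J where "J = PiE (Basis :: 'a set) (\<lambda>_. {- (4 ^ k) .. 4 ^ k :: int})"
  define \<phi> where "\<phi> j = (\<Sum>b\<in>Basis. (of_int (j b) / 4 ^ k) *\<^sub>R b)" for j :: "'a \<Rightarrow> int"
  have finJ: "finite J" unfolding J_def by (intro finite_PiE) auto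
  have "card J = (nat (2 * 4 ^ k + 1)) ^ DIM('a)" unfolding J_def by (simp add: card_PiE)
  also have "\<dots> \<le> (3 * 4 ^ k) ^ DIM('a)"
    by (intro power_mono) (simp_all add: nat_le_iff)
  finally have cardJ: "card J \<le> (3 * 4 ^ k) ^ DIM('a)" .
  have sub: "dyadic_net k \<subseteq> \<phi> ` J"
    unfolding dyadic_net_def
  proof (intro image_subsetI)
    fix x :: 'a assume x: "x \<in> cball 0 1"
    \<comment> \<open>An integer sign replaces \<open>sgn\<close>. At a zero coordinate the floor
      vanishes, so the sign 1 is harmless there.\<close>
    define j where "j = (\<lambda>b\<in>Basis. (if x \<bullet> b < 0 then -1 else 1) * \<lfloor>4 ^ k * \<bar>x \<bullet> b\<bar>\<rfloor>)"
    have "dyadic_trunc k x = \<phi> j"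
      unfolding dyadic_trunc_def \<phi>_def
      by (intro sum.cong refl arg_cong2[where f = scaleR]) (auto simp: j_def sgn_if)
    moreover have "j \<in> J"
    proof -
      have "0 \<le> \<lfloor>4 ^ k * \<bar>x \<bullet> b\<bar>\<rfloor> \<and> \<lfloor>4 ^ k * \<bar>x \<bullet> b\<bar>\<rfloor> \<le> 4 ^ k" if "b \<in> Basis" for b
      proof
        have "\<bar>x \<bullet> b\<bar> \<le> 1" using Basis_le_norm[OF that, of x] x by simp
        then have "4 ^ k * \<bar>x \<bullet> b\<bar> \<le> 4 ^ k" by simp
        then show "\<lfloor>4 ^ k * \<bar>x \<bullet> b\<bar>\<rfloor> \<le> 4 ^ k"
          by (metis floor_mono floor_of_int of_int_numeral of_int_power)
      qed simp
      then have bnd: "0 \<le> \<lfloor>4 ^ k * \<bar>x \<bullet> b\<bar>\<rfloor>" "\<lfloor>4 ^ k * \<bar>x \<bullet> b\<bar>\<rfloor> \<le> 4 ^ k" if "b \<in> Basis" for b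
        using that by blast+
      define m where "m b = \<lfloor>4 ^ k * \<bar>x \<bullet> b\<bar>\<rfloor>" for b
      have "0 \<le> m b" "m b \<le> 4 ^ k" if "b \<in> Basis" for b
        using bnd[OF that] by (simp_all only: m_def)
      then show ?thesis
        unfolding J_def j_def m_def[symmetric]
        by (intro restrict_PiE_iff[THEN iffD2] ballI) fastforce
    qed
    ultimately show "dyadic_trunc k x \<in> \<phi> ` J" by blast
  qed
  show "finite (dyadic_net k :: 'a set)" using finite_subset[OF sub] finJ by simp
  have "card (dyadic_net k :: 'a set) \<le> card (\<phi> ` J)" using sub finJ by (intro card_mono) auto
  also have "\<dots> \<le> card J" using finJ by (rule card_image_le)
  finally show "card (dyadic_net k :: 'a set) \<le> (3 * 4 ^ k) ^ DIM('a)" using cardJ by simp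
qed

lemma geometric_tail_sum: "(\<lambda>i. (1 / 2) ^ (k + i)) sums (2 * (1 / 2) ^ k :: real)"
  using sums_mult[OF geometric_sums[of "1 / 2 :: real"], of "(1 / 2) ^ k"]
  by (simp add: power_add mult.commute)

text \<open>The deterministic half of chaining: the increments along the successive truncations of
  \<theta> telescope and are dominated by a geometric series, and continuity carries the bound from
  the truncations to \<theta> itself.\<close>

lemma chain_along_dyadic_net:
  fixes x :: "'b::euclidean_space \<Rightarrow> real"
  assumes cont: "continuous_on (cball 0 1) x" and \<theta>: "\<theta> \<in> cball 0 1" and "l \<ge> 0"
    and step: "\<And>k a b. k \<ge> k0 \<Longrightarrow> a \<in> dyadic_net k \<Longrightarrow> b \<in> dyadic_net (Suc k) \<Longrightarrow>
      norm (a - b) \<le> 2 * DIM('b) / 4 ^ k \<Longrightarrow> \<bar>x a - x b\<bar> \<le> l / 2 ^ k"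
  shows "\<bar>x \<theta> - x (dyadic_trunc k0 \<theta>)\<bar> \<le> 2 * l / 2 ^ k0"
proof -
  let ?\<pi> = "\<lambda>k. dyadic_trunc k \<theta>"
  have net: "?\<pi> k \<in> dyadic_net k" for k using \<theta> by (auto simp: dyadic_net_def)
  have ball: "?\<pi> k \<in> cball 0 1" for k using net dyadic_net_subset by blast
  have one: "\<bar>x (?\<pi> k) - x (?\<pi> (Suc k))\<bar> \<le> l / 2 ^ k" if "k \<ge> k0" for k
  proof (rule step[OF that net net])
    have "norm (?\<pi> k - ?\<pi> (Suc k)) \<le> norm (\<theta> - ?\<pi> k) + norm (\<theta> - ?\<pi> (Suc k))"
      using norm_triangle_ineq4[of "\<theta> - ?\<pi> (Suc k)" "\<theta> - ?\<pi> k"] by simp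
    also have "\<dots> \<le> DIM('b) / 4 ^ k + DIM('b) / 4 ^ Suc k"
      by (intro add_mono norm_diff_dyadic_trunc_le)
    also have "\<dots> \<le> 2 * DIM('b) / 4 ^ k" by (simp add: field_simps)
    finally show "norm (?\<pi> k - ?\<pi> (Suc k)) \<le> 2 * DIM('b) / 4 ^ k" .
  qed
  have partial: "\<bar>x (?\<pi> (k0 + n)) - x (?\<pi> k0)\<bar> \<le> (\<Sum>i<n. l * (1 / 2) ^ (k0 + i))" for n
  proof (induction n)
    case (Suc n)
    have "\<bar>x (?\<pi> (k0 + n)) - x (?\<pi> (Suc (k0 + n)))\<bar> \<le> l * (1 / 2) ^ (k0 + n)"
      using one[of "k0 + n"] by (simp add: power_divide)
    with Suc show ?case by simp
  qed simp
  have "(\<Sum>i<n. l * (1 / 2) ^ (k0 + i)) \<le> 2 * l / 2 ^ k0" for n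
  proof -
    have "(\<lambda>i. l * (1 / 2) ^ (k0 + i)) sums (l * (2 * (1 / 2) ^ k0))"
      by (rule sums_mult[OF geometric_tail_sum])
    then have "(\<Sum>i<n. l * (1 / 2) ^ (k0 + i)) \<le> l * (2 * (1 / 2) ^ k0)"
      using \<open>l \<ge> 0\<close> by (metis sum_le_suminf sums_unique sums_summable finite_lessThan
        mult_nonneg_nonneg zero_le_power zero_le_divide_1_iff zero_le_numeral)
    also have "l * (2 * (1 / 2) ^ k0) = 2 * l / 2 ^ k0" by (simp add: power_divide)
    finally show ?thesis .
  qed
  then have bound: "\<bar>x (?\<pi> (k0 + n)) - x (?\<pi> k0)\<bar> \<le> 2 * l / 2 ^ k0" for n
    using partial order_trans by blast
  have "(\<lambda>n. ?\<pi> (n + k0)) \<longlonglongrightarrow> \<theta>"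
    using dyadic_trunc_tendsto by (rule LIMSEQ_ignore_initial_segment)
  then have "(\<lambda>n. x (?\<pi> (n + k0))) \<longlonglongrightarrow> x \<theta>"
    using cont \<theta> ball by (auto simp: continuous_on_sequentially comp_def)
  then have "(\<lambda>n. \<bar>x (?\<pi> (n + k0)) - x (?\<pi> k0)\<bar>) \<longlonglongrightarrow> \<bar>x \<theta> - x (?\<pi> k0)\<bar>"
    by (intro tendsto_intros)
  then show ?thesis
    by (rule LIMSEQ_le_const2) (use bound in \<open>auto simp: add.commute\<close>)
qed

text \<open>
  The exponent \<open>4 * DIM('b) + 2\<close> beats the number of pairs of neighbouring points of two
  successive nets, which grows like \<open>16 ^ (k * DIM('b))\<close>.
\<close>

lemma (in prob_space) chaining:
  fixes X :: "'b::euclidean_space \<Rightarrow> 'a \<Rightarrow> real" and K l :: real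
  defines "m \<equiv> 4 * DIM('b) + 2"
  assumes X[measurable]: "\<And>\<theta>. X \<theta> \<in> borel_measurable M" and G[measurable]: "G \<in> events"
    and tail: "\<And>a b s. norm a \<le> 1 \<Longrightarrow> norm b \<le> 1 \<Longrightarrow> s > 0 \<Longrightarrow>
      prob {\<omega> \<in> space M. \<omega> \<in> G \<and> \<bar>X a \<omega> - X b \<omega>\<bar> > s} \<le> K * (norm (a - b) / s) ^ m"
    and cont: "\<And>\<omega>. \<omega> \<in> space M \<Longrightarrow> continuous_on (cball 0 1) (\<lambda>\<theta>. X \<theta> \<omega>)"
    and K: "K \<ge> 0" and l: "l > 0"
  shows "\<exists>E\<in>events. prob E \<le> 2 * 36 ^ DIM('b) * K * (2 * DIM('b) / l) ^ m * (1 / 2) ^ k0 \<and>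
    (\<forall>\<omega>\<in>G - E. \<forall>\<theta>\<in>cball 0 1. \<bar>X \<theta> \<omega> - X (dyadic_trunc k0 \<theta>) \<omega>\<bar> \<le> 2 * l / 2 ^ k0)"
proof -
  define D where "D = DIM('b)"
  \<comment> \<open>Only pairs as close as two successive truncations of one point are retained.
    Their distance matters for the tail bound; for their number the crude count of all pairs will
    do.\<close>
  define pairs where "pairs k = {p \<in> dyadic_net k \<times> (dyadic_net (Suc k) :: 'b set).
    norm (fst p - snd p) \<le> 2 * D / 4 ^ k}" for k :: nat
  define B where "B p k = {\<omega> \<in> space M. \<omega> \<in> G \<and> \<bar>X (fst p) \<omega> - X (snd p) \<omega>\<bar> > l / 2 ^ k}" for p and k :: nat
  define A where "A k = (\<Union>p\<in>pairs k. B p k)" for k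
  define c where "c = 36 ^ D * K * (2 * D / l) ^ m"
  have c: "c \<ge> 0" using K l by (simp add: c_def)
  have finp: "finite (pairs k)" for k
    unfolding pairs_def by (rule finite_subset[of _ "dyadic_net k \<times> dyadic_net (Suc k)"])
      (auto simp: finite_dyadic_net)
  have cardp: "real (card (pairs k)) \<le> 36 ^ D * (16 ^ D) ^ k" for k
  proof -
    have "card (pairs k) \<le> card (dyadic_net k \<times> dyadic_net (Suc k) :: ('b \<times> 'b) set)"
      unfolding pairs_def by (rule card_mono) (auto simp: finite_dyadic_net)
    also have "\<dots> \<le> (3 * 4 ^ k) ^ D * (3 * 4 ^ Suc k) ^ D"
      unfolding card_cartesian_product D_def by (intro mult_mono card_dyadic_net) auto
    also have "\<dots> = (36 * 16 ^ k) ^ D"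
    proof -
      have "(16 :: nat) ^ k = 4 ^ k * 4 ^ k" by (simp flip: power_mult_distrib)
      then have "(3 * 4 ^ k) * (3 * 4 ^ Suc k) = (36 * 16 ^ k :: nat)" by simp
      then show ?thesis by (metis power_mult_distrib)
    qed
    also have "\<dots> = 36 ^ D * (16 ^ D) ^ k" by (simp add: power_mult_distrib mult.commute flip: power_mult)
    finally have "real (card (pairs k)) \<le> real (36 ^ D * (16 ^ D) ^ k)" by (rule of_nat_mono)
    then show ?thesis by simp
  qed
  have B[measurable]: "B p k \<in> events" for p k unfolding B_def by measurable
  have A[measurable]: "A k \<in> events" for k unfolding A_def using finp by (intro sets.finite_UN) auto
  have PA: "prob (A k) \<le> c * (1 / 2) ^ k" for k
  proof -
    have "prob (A k) \<le> (\<Sum>p\<in>pairs k. prob (B p k))"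
      unfolding A_def by (rule finite_measure_subadditive_finite[OF finp]) auto
    also have "\<dots> \<le> (\<Sum>p\<in>pairs k. K * ((2 * D / 4 ^ k) / (l / 2 ^ k)) ^ m)"
    proof (rule sum_mono)
      fix p assume p: "p \<in> pairs k"
      then have "norm (fst p) \<le> 1" "norm (snd p) \<le> 1"
        using dyadic_net_subset by (fastforce simp: pairs_def)+
      then have "prob (B p k) \<le> K * (norm (fst p - snd p) / (l / 2 ^ k)) ^ m"
        unfolding B_def using l by (intro tail) auto
      also have "\<dots> \<le> K * ((2 * D / 4 ^ k) / (l / 2 ^ k)) ^ m"
        using p K l by (intro mult_left_mono power_mono divide_right_mono) (auto simp: pairs_def)
      finally show "prob (B p k) \<le> K * ((2 * D / 4 ^ k) / (l / 2 ^ k)) ^ m" .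
    qed
    also have "\<dots> = card (pairs k) * (K * ((2 * D / 4 ^ k) / (l / 2 ^ k)) ^ m)" by simp
    also have "\<dots> \<le> (36 ^ D * (16 ^ D) ^ k) * (K * ((2 * D / 4 ^ k) / (l / 2 ^ k)) ^ m)"
      using K l by (intro mult_right_mono cardp) auto
    also have "(2 * D / 4 ^ k) / (l / 2 ^ k) = (2 * D / l) * (1 / 2) ^ k"
    proof -
      have "(4::real) ^ k = 2 ^ k * 2 ^ k" by (simp flip: power_mult_distrib)
      then show ?thesis using l by (simp add: field_simps)
    qed
    also have "((2 * D / l) * (1 / 2) ^ k) ^ m = (2 * D / l) ^ m * ((1 / 2) ^ m) ^ k"
      by (simp only: power_mult_distrib power_mult[symmetric] mult.commute[of k m])
    also have "(36 ^ D * (16 ^ D) ^ k) * (K * ((2 * D / l) ^ m * ((1 / 2) ^ m) ^ k))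
      = c * (16 ^ D * (1 / 2) ^ m) ^ k"
      unfolding power_mult_distrib[of _ _ k] by (simp add: c_def)
    \<comment> \<open>The number of pairs contributes a factor \<open>16 ^ D\<close> per level and
      the tail a factor \<open>(1 / 2) ^ m\<close>. With \<open>m = 4 * D + 2\<close> the product is
      \<open>1 / 4\<close>, so the probabilities of the levels are summable.\<close>
    also have "(16 ^ D * (1 / 2) ^ m :: real) = 1 / 4"
    proof -
      have "(1 / 2 :: real) ^ m = ((1 / 2) ^ 4) ^ D * (1 / 2) ^ 2"
        unfolding m_def D_def[symmetric] power_add power_mult ..
      then have "(16 ^ D * (1 / 2) ^ m :: real) = (16 ^ D * (1 / 16) ^ D) * (1 / 4)"
        by (simp add: power2_eq_square power_divide)
      also have "16 ^ D * (1 / 16 :: real) ^ D = 1" by (simp flip: power_mult_distrib)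
      finally show ?thesis by simp
    qed
    also have "c * (1 / 4) ^ k \<le> c * (1 / 2) ^ k"
      using c by (intro mult_left_mono power_mono) auto
    finally show ?thesis .
  qed
  \<comment> \<open>A countable union over the levels of finite unions over pairs: one measurable
    exceptional set serves all \<theta> simultaneously.\<close>
  define E where "E = (\<Union>i. A (k0 + i))"
  have sums: "(\<lambda>i. c * (1 / 2) ^ (k0 + i)) sums (c * (2 * (1 / 2) ^ k0))"
    by (rule sums_mult[OF geometric_tail_sum])
  have smA: "summable (\<lambda>i. prob (A (k0 + i)))"
    by (rule summable_comparison_test'[OF sums_summable[OF sums], where N = 0]) (use PA in auto)
  have "prob E \<le> (\<Sum>i. prob (A (k0 + i)))"
    unfolding E_def by (rule finite_measure_subadditive_countably[OF _ smA]) auto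
  also have "\<dots> \<le> (\<Sum>i. c * (1 / 2) ^ (k0 + i))"
    by (rule suminf_le[OF PA smA sums_summable[OF sums]])
  also have "\<dots> = c * (2 * (1 / 2) ^ k0)" using sums by (simp add: sums_iff)
  finally have "prob E \<le> 2 * 36 ^ D * K * (2 * D / l) ^ m * (1 / 2) ^ k0" by (simp add: c_def)
  moreover have "E \<in> events" unfolding E_def by measurable
  moreover have "\<bar>X \<theta> \<omega> - X (dyadic_trunc k0 \<theta>) \<omega>\<bar> \<le> 2 * l / 2 ^ k0"
    if \<omega>: "\<omega> \<in> G - E" and \<theta>: "\<theta> \<in> cball 0 1" for \<omega> \<theta>
  proof (rule chain_along_dyadic_net[OF _ \<theta>])
    have \<omega>M: "\<omega> \<in> space M" using \<omega> sets.sets_into_space[OF G] by blast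
    then show "continuous_on (cball 0 1) (\<lambda>\<theta>. X \<theta> \<omega>)" by (rule cont)
    show "0 \<le> l" using l by simp
    fix k and a b :: 'b assume k: "k \<ge> k0" and ab: "a \<in> dyadic_net k" "b \<in> dyadic_net (Suc k)"
      "norm (a - b) \<le> 2 * DIM('b) / 4 ^ k"
    have "\<omega> \<notin> A k"
    proof
      assume "\<omega> \<in> A k"
      then have "\<omega> \<in> A (k0 + (k - k0))" using k by simp
      then show False using \<omega> unfolding E_def by blast
    qed
    moreover have "(a, b) \<in> pairs k" using ab by (simp add: pairs_def D_def)
    ultimately have "\<omega> \<notin> B (a, b) k" unfolding A_def by blast
    then show "\<bar>X a \<omega> - X b \<omega>\<bar> \<le> l / 2 ^ k"
      using \<omega> \<omega>M by (simp add: B_def not_less)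
  qed
  ultimately show ?thesis unfolding D_def by blast
qed


section \<open>Empirical processes with independent noise\<close>

text \<open>For fixed noise \<open>e\<close> the function has range in an interval of length
  \<open>2 * c * w e\<close>, for which Hoeffding's lemma yields the exponent
  \<open>t\<^sup>2 * c\<^sup>2 * (w e)\<^sup>2 / 2\<close>. Subtracting this inside the exponential
  before integrating over the noise leaves a bound free of moments of \<open>w\<close>.\<close>

lemma Hoeffding_conditional:
  fixes g :: "'u \<times> 'e \<Rightarrow> real" and w :: "'e \<Rightarrow> real"
  assumes S: "prob_space S" and \<nu>: "prob_space \<nu>"
    and g[measurable]: "g \<in> borel_measurable (S \<Otimes>\<^sub>M \<nu>)" and w[measurable]: "w \<in> borel_measurable \<nu>"
    and bound: "\<And>e. e \<in> space \<nu> \<Longrightarrow> AE u in S. \<bar>g (u, e)\<bar> \<le> c * w e" and "t > 0"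
  shows "(\<integral>\<^sup>+z. ennreal (exp (t * (g z - (\<integral>u. g (u, snd z) \<partial>S)) - t\<^sup>2 * c\<^sup>2 * (w (snd z))\<^sup>2 / 2)) \<partial>(S \<Otimes>\<^sub>M \<nu>)) \<le> 1"
proof -
  interpret S: prob_space S by fact
  interpret \<nu>: prob_space \<nu> by fact
  interpret P: pair_prob_space S \<nu> ..
  define b where "b e = t\<^sup>2 * c\<^sup>2 * (w e)\<^sup>2 / 2" for e
  have [measurable]: "b \<in> borel_measurable \<nu>" unfolding b_def by measurable
  have inner: "(\<integral>\<^sup>+u. ennreal (exp (t * (g (u, e) - (\<integral>u. g (u, e) \<partial>S)) - b e)) \<partial>S) \<le> 1"
    if e: "e \<in> space \<nu>" for e
  proof -
    have [measurable]: "(\<lambda>u. g (u, e)) \<in> borel_measurable S" using e by measurable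
    interpret I: interval_bounded_random_variable S "\<lambda>u. g (u, e)" "- (c * w e)" "c * w e"
    proof
      show "(\<lambda>u. g (u, e)) \<in> borel_measurable S" by measurable
      show "AE u in S. g (u, e) \<in> {- (c * w e)..c * w e}"
        using bound[OF e] by eventually_elim (simp add: abs_le_iff)
    qed
    have "(\<integral>\<^sup>+u. ennreal (exp (t * (g (u, e) - (\<integral>u. g (u, e) \<partial>S)) - b e)) \<partial>S)
      = (\<integral>\<^sup>+u. ennreal (exp (t * (g (u, e) - (\<integral>u. g (u, e) \<partial>S)))) * ennreal (exp (- b e)) \<partial>S)"
      by (simp add: exp_diff exp_minus divide_inverse flip: ennreal_mult)
    also have "\<dots> = (\<integral>\<^sup>+u. ennreal (exp (t * (g (u, e) - (\<integral>u. g (u, e) \<partial>S)))) \<partial>S) * ennreal (exp (- b e))"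
      by (rule nn_integral_multc) measurable
    also have "\<dots> \<le> ennreal (exp (t\<^sup>2 * (c * w e - - (c * w e))\<^sup>2 / 8)) * ennreal (exp (- b e))"
      by (intro mult_right_mono I.Hoeffdings_lemma_nn_integral \<open>t > 0\<close>) simp
    also have "t\<^sup>2 * (c * w e - - (c * w e))\<^sup>2 / 8 = b e"
      by (simp add: b_def power2_eq_square)
    also have "ennreal (exp (b e)) * ennreal (exp (- b e)) = 1"
      by (simp flip: ennreal_mult exp_add)
    finally show ?thesis .
  qed
  have "(\<integral>\<^sup>+z. ennreal (exp (t * (g z - (\<integral>u. g (u, snd z) \<partial>S)) - b (snd z))) \<partial>(S \<Otimes>\<^sub>M \<nu>))
    = (\<integral>\<^sup>+e. (\<integral>\<^sup>+u. ennreal (exp (t * (g (u, e) - (\<integral>u. g (u, e) \<partial>S)) - b e)) \<partial>S) \<partial>\<nu>)"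
    by (subst P.nn_integral_snd[symmetric]) auto
  also have "\<dots> \<le> (\<integral>\<^sup>+e. 1 \<partial>\<nu>)" by (rule nn_integral_mono) (rule inner)
  also have "\<dots> = 1" by (simp add: \<nu>.emeasure_space_1)
  finally show ?thesis by (simp add: b_def)
qed

text \<open>
  The weights \<open>w\<close> need no exponential moments: they enter the exponential bound with a
  negative sign, so only the empirical second moment of the weights has to be controlled.
\<close>

lemma (in prob_space) self_normalized_tail:
  fixes g :: "'u \<times> 'e \<Rightarrow> real" and w :: "'e \<Rightarrow> real" and \<zeta> :: "nat \<Rightarrow> 'a \<Rightarrow> 'u \<times> 'e"
    and S :: "'u measure" and \<nu> :: "'e measure"
  defines "D \<equiv> \<lambda>z. g z - (\<integral>u. g (u, snd z) \<partial>S)"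
  assumes S: "prob_space S" and \<nu>: "prob_space \<nu>"
    and ind: "indep_vars (\<lambda>_. S \<Otimes>\<^sub>M \<nu>) \<zeta> UNIV" and law: "\<And>i. distr M (S \<Otimes>\<^sub>M \<nu>) (\<zeta> i) = S \<Otimes>\<^sub>M \<nu>"
    and g[measurable]: "g \<in> borel_measurable (S \<Otimes>\<^sub>M \<nu>)" and w[measurable]: "w \<in> borel_measurable \<nu>"
    and bound: "\<And>e. e \<in> space \<nu> \<Longrightarrow> AE u in S. \<bar>g (u, e)\<bar> \<le> c * w e"
    and pos: "c > 0" "K > 0" "s > 0" "n \<ge> 1"
  shows "prob {\<omega> \<in> space M. (\<Sum>i<n. (w (snd (\<zeta> i \<omega>)))\<^sup>2) \<le> K * n \<and> (\<Sum>i<n. D (\<zeta> i \<omega>)) \<ge> s * sqrt n}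
    \<le> exp (- (s\<^sup>2 / (2 * K * c\<^sup>2)))"
proof -
  interpret S: prob_space S by fact
  interpret \<nu>: prob_space \<nu> by fact
  have \<zeta>[measurable]: "\<zeta> i \<in> measurable M (S \<Otimes>\<^sub>M \<nu>)" for i using ind by (auto simp: indep_vars_def)
  have D[measurable]: "D \<in> borel_measurable (S \<Otimes>\<^sub>M \<nu>)" unfolding D_def by measurable
  \<comment> \<open>The maximizer of the Chernoff exponent
    \<open>t * s * sqrt n - t\<^sup>2 * c\<^sup>2 * K * n / 2\<close>; its maximal value is
    \<open>v\<close> below.\<close>
  define t where "t = s / (c\<^sup>2 * K * sqrt n)"
  have t: "t > 0" using pos by (simp add: t_def)
  define F where "F z = exp (t * D z - t\<^sup>2 * c\<^sup>2 * (w (snd z))\<^sup>2 / 2)" for z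
  have F[measurable]: "F \<in> borel_measurable (S \<Otimes>\<^sub>M \<nu>)" unfolding F_def by measurable
  define v where "v = s\<^sup>2 / (2 * K * c\<^sup>2)"
  have prodF: "(\<Prod>i<n. F (\<zeta> i \<omega>)) \<ge> exp v"
    if "(\<Sum>i<n. (w (snd (\<zeta> i \<omega>)))\<^sup>2) \<le> K * n" "(\<Sum>i<n. D (\<zeta> i \<omega>)) \<ge> s * sqrt n" for \<omega>
  proof -
    have "t * (s * sqrt n) - t\<^sup>2 * c\<^sup>2 / 2 * (K * n)
      \<le> t * (\<Sum>i<n. D (\<zeta> i \<omega>)) - t\<^sup>2 * c\<^sup>2 / 2 * (\<Sum>i<n. (w (snd (\<zeta> i \<omega>)))\<^sup>2)"
      using that t by (intro diff_mono mult_left_mono) auto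
    moreover have "t * (s * sqrt n) - t\<^sup>2 * c\<^sup>2 / 2 * (K * n) = v"
    proof -
      have "t * (s * sqrt n) = s\<^sup>2 / (c\<^sup>2 * K)"
        using pos by (simp add: t_def power2_eq_square)
      moreover have "t\<^sup>2 * c\<^sup>2 / 2 * (K * n) = t * (s * sqrt n) / 2"
      proof -
        have "t * (c\<^sup>2 * K * sqrt n) = s" using pos by (simp add: t_def)
        moreover have "real n = sqrt n * sqrt n" by simp
        ultimately show ?thesis by (metis (no_types, opaque_lifting) mult.assoc mult.commute power2_eq_square times_divide_eq_left)
      qed
      moreover have "s\<^sup>2 / (c\<^sup>2 * K) - s\<^sup>2 / (c\<^sup>2 * K) / 2 = v"
        by (simp add: v_def mult.assoc mult.commute)
      ultimately show ?thesis by simp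
    qed
    moreover have "(\<Prod>i<n. F (\<zeta> i \<omega>)) =
      exp (t * (\<Sum>i<n. D (\<zeta> i \<omega>)) - t\<^sup>2 * c\<^sup>2 / 2 * (\<Sum>i<n. (w (snd (\<zeta> i \<omega>)))\<^sup>2))"
      unfolding F_def by (simp add: exp_sum[symmetric] sum_subtractf sum_distrib_left)
    ultimately show ?thesis by simp
  qed
  \<comment> \<open>Each factor has mean at most 1 by \<open>Hoeffding_conditional\<close>, hence so
    has the product of these independent factors, and Markov's inequality gives the tail.\<close>
  have "indep_vars (\<lambda>_. borel) (\<lambda>i \<omega>. ennreal (F (\<zeta> i \<omega>))) {..<n}"
    by (rule indep_vars_compose2[OF indep_vars_subset[OF ind]]) auto
  then have "(\<integral>\<^sup>+\<omega>. (\<Prod>i<n. ennreal (F (\<zeta> i \<omega>))) \<partial>M) = (\<Prod>i<n. \<integral>\<^sup>+\<omega>. ennreal (F (\<zeta> i \<omega>)) \<partial>M)"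
    by (intro indep_vars_nn_integral) auto
  also have "\<dots> \<le> (\<Prod>i<n. 1)"
  proof (rule prod_mono_ennreal)
    fix i
    have "(\<integral>\<^sup>+\<omega>. ennreal (F (\<zeta> i \<omega>)) \<partial>M) = (\<integral>\<^sup>+z. ennreal (F z) \<partial>(S \<Otimes>\<^sub>M \<nu>))"
      using nn_integral_distr[OF \<zeta>[of i], of "\<lambda>z. ennreal (F z)"] law[of i] by simp
    also have "\<dots> \<le> 1"
      unfolding F_def D_def by (rule Hoeffding_conditional[OF S \<nu> g w bound t])
    finally show "(\<integral>\<^sup>+\<omega>. ennreal (F (\<zeta> i \<omega>)) \<partial>M) \<le> 1" .
  qed
  finally have le1: "(\<integral>\<^sup>+\<omega>. (\<Prod>i<n. ennreal (F (\<zeta> i \<omega>))) \<partial>M) \<le> 1" by simp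
  let ?A = "{\<omega> \<in> space M. (\<Sum>i<n. (w (snd (\<zeta> i \<omega>)))\<^sup>2) \<le> K * n \<and> (\<Sum>i<n. D (\<zeta> i \<omega>)) \<ge> s * sqrt n}"
  let ?f = "\<lambda>\<omega>. \<Prod>i<n. ennreal (F (\<zeta> i \<omega>))"
  have f: "?f \<in> borel_measurable M" by (intro borel_measurable_prod_ennreal) simp
  have "emeasure M ?A \<le> emeasure M {\<omega> \<in> space M. 1 \<le> ennreal (exp (- v)) * ?f \<omega>}"
  proof (rule emeasure_mono)
    show "{\<omega> \<in> space M. 1 \<le> ennreal (exp (- v)) * ?f \<omega>} \<in> events"
      using f by measurable
    show "?A \<subseteq> {\<omega> \<in> space M. 1 \<le> ennreal (exp (- v)) * (\<Prod>i<n. ennreal (F (\<zeta> i \<omega>)))}"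
    proof safe
      fix \<omega> assume "(\<Sum>i<n. (w (snd (\<zeta> i \<omega>)))\<^sup>2) \<le> K * n" "(\<Sum>i<n. D (\<zeta> i \<omega>)) \<ge> s * sqrt n"
      from prodF[OF this] have "exp (- v) * exp v \<le> exp (- v) * (\<Prod>i<n. F (\<zeta> i \<omega>))" by simp
      then have "ennreal 1 \<le> ennreal (exp (- v) * (\<Prod>i<n. F (\<zeta> i \<omega>)))"
        by (intro ennreal_leI) (simp flip: exp_add)
      moreover have "ennreal (exp (- v)) * (\<Prod>i<n. ennreal (F (\<zeta> i \<omega>))) = ennreal (exp (- v) * (\<Prod>i<n. F (\<zeta> i \<omega>)))"
        by (subst prod_ennreal) (simp_all add: F_def ennreal_mult prod_nonneg)
      ultimately show "1 \<le> ennreal (exp (- v)) * (\<Prod>i<n. ennreal (F (\<zeta> i \<omega>)))"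
        by simp
    qed
  qed
  also have "\<dots> \<le> ennreal (exp (- v)) * (\<integral>\<^sup>+\<omega>. (\<Prod>i<n. ennreal (F (\<zeta> i \<omega>))) * indicator (space M) \<omega> \<partial>M)"
    using nn_integral_Markov_inequality[of "\<lambda>\<omega>. \<Prod>i<n. ennreal (F (\<zeta> i \<omega>))" "space M" M "ennreal (exp (- v))"]
    using f by simp
  also have "(\<integral>\<^sup>+\<omega>. (\<Prod>i<n. ennreal (F (\<zeta> i \<omega>))) * indicator (space M) \<omega> \<partial>M)
      = (\<integral>\<^sup>+\<omega>. (\<Prod>i<n. ennreal (F (\<zeta> i \<omega>))) \<partial>M)"
    by (rule nn_integral_cong) (simp only: indicator_simps mult_1_right)
  also have "ennreal (exp (- v)) * \<dots> \<le> ennreal (exp (- v)) * 1"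
    by (rule mult_left_mono[OF le1]) simp
  finally have "ennreal (prob ?A) \<le> ennreal (exp (- v))"
    unfolding emeasure_eq_measure mult_1_right .
  then have "prob ?A \<le> exp (- v)" by (rule ennreal_le_iff[THEN iffD1, rotated]) simp
  then show ?thesis unfolding v_def .
qed

lemma exp_minus_le_fact_div_power:
  assumes "x > 0" shows "exp (- x) \<le> fact m / (x :: real) ^ m"
proof -
  have "sum (\<lambda>k. x ^ k /\<^sub>R fact k) {m} \<le> (\<Sum>k. x ^ k /\<^sub>R fact k)"
    by (rule sum_le_suminf[OF summable_exp_generic]) (use assms in simp_all)
  then have "x ^ m / fact m \<le> exp x" by (simp add: exp_def divide_inverse mult.commute)
  then have "x ^ m \<le> fact m * exp x" by (simp add: pos_divide_le_eq mult.commute)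
  then have "x ^ m * exp (- x) \<le> fact m * exp x * exp (- x)" by (intro mult_right_mono) auto
  also have "fact m * exp x * exp (- x) = fact m" unfolding mult.assoc exp_add[symmetric] by simp
  finally show ?thesis using assms by (simp add: pos_le_divide_eq mult.commute)
qed

text \<open>One term of the exponential series weakens the subgaussian tail to a power tail, the
  form that \<open>chaining\<close> consumes. The one-sided bound is applied to \<open>g\<close> and
  to its negative.\<close>

lemma (in prob_space) self_normalized_power_tail:
  fixes g :: "'u \<times> 'e \<Rightarrow> real" and w :: "'e \<Rightarrow> real" and \<zeta> :: "nat \<Rightarrow> 'a \<Rightarrow> 'u \<times> 'e"
    and S :: "'u measure" and \<nu> :: "'e measure"
  defines "D \<equiv> \<lambda>z. g z - (\<integral>u. g (u, snd z) \<partial>S)"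
  assumes S: "prob_space S" and \<nu>: "prob_space \<nu>"
    and ind: "indep_vars (\<lambda>_. S \<Otimes>\<^sub>M \<nu>) \<zeta> UNIV" and law: "\<And>i. distr M (S \<Otimes>\<^sub>M \<nu>) (\<zeta> i) = S \<Otimes>\<^sub>M \<nu>"
    and g[measurable]: "g \<in> borel_measurable (S \<Otimes>\<^sub>M \<nu>)" and w[measurable]: "w \<in> borel_measurable \<nu>"
    and bound: "\<And>e. e \<in> space \<nu> \<Longrightarrow> AE u in S. \<bar>g (u, e)\<bar> \<le> c * w e"
    and pos: "c > 0" "K > 0" "s > 0" "n \<ge> 1"
  shows "prob {\<omega> \<in> space M. (\<Sum>i<n. (w (snd (\<zeta> i \<omega>)))\<^sup>2) \<le> K * n \<and> \<bar>(\<Sum>i<n. D (\<zeta> i \<omega>)) / sqrt n\<bar> > s}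
    \<le> 2 * fact m * (2 * K) ^ m * (c / s) ^ (2 * m)"
proof -
  interpret S: prob_space S by fact
  interpret \<nu>: prob_space \<nu> by fact
  have \<zeta>[measurable]: "\<zeta> i \<in> measurable M (S \<Otimes>\<^sub>M \<nu>)" for i using ind by (auto simp: indep_vars_def)
  have D[measurable]: "D \<in> borel_measurable (S \<Otimes>\<^sub>M \<nu>)" unfolding D_def by measurable
  have sq: "sqrt n > 0" using pos by simp
    have neg: "- g z - (\<integral>u. - g (u, snd z) \<partial>S) = - D z" for z by (simp add: D_def)
    let ?G = "\<lambda>\<omega>. (\<Sum>i<n. (w (snd (\<zeta> i \<omega>)))\<^sup>2) \<le> K * n"
    let ?A = "{\<omega> \<in> space M. ?G \<omega> \<and> (\<Sum>i<n. D (\<zeta> i \<omega>)) \<ge> s * sqrt n}"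
    let ?B = "{\<omega> \<in> space M. ?G \<omega> \<and> (\<Sum>i<n. - D (\<zeta> i \<omega>)) \<ge> s * sqrt n}"
    have "prob {\<omega> \<in> space M. ?G \<omega> \<and> \<bar>(\<Sum>i<n. D (\<zeta> i \<omega>)) / sqrt n\<bar> > s} \<le> prob (?A \<union> ?B)"
    proof (rule finite_measure_mono)
      have "x \<ge> s * sqrt n \<or> - x \<ge> s * sqrt n" if "\<bar>x / sqrt n\<bar> > s" for x
      proof -
        have "\<bar>x\<bar> > s * sqrt n" using that sq by (simp add: pos_less_divide_eq)
        then show ?thesis by linarith
      qed
      then show "{\<omega> \<in> space M. ?G \<omega> \<and> \<bar>(\<Sum>i<n. D (\<zeta> i \<omega>)) / sqrt n\<bar> > s} \<subseteq> ?A \<union> ?B"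
        unfolding sum_negf by blast
    qed measurable
    also have "\<dots> \<le> prob ?A + prob ?B" by (rule measure_Un_le) measurable
    also have "\<dots> \<le> exp (- (s\<^sup>2 / (2 * K * c\<^sup>2))) + exp (- (s\<^sup>2 / (2 * K * c\<^sup>2)))"
    proof (rule add_mono)
      show "prob ?A \<le> exp (- (s\<^sup>2 / (2 * K * c\<^sup>2)))"
        unfolding D_def by (rule self_normalized_tail[OF S \<nu> ind law g w bound pos])
      show "prob ?B \<le> exp (- (s\<^sup>2 / (2 * K * c\<^sup>2)))"
        unfolding neg[symmetric]
        by (rule self_normalized_tail[OF S \<nu> ind law _ w _ pos, of "\<lambda>z. - g z"]) (use bound in auto)
    qed
    also have "\<dots> = 2 * exp (- (s\<^sup>2 / (2 * K * c\<^sup>2)))" by simp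
    also have "\<dots> \<le> 2 * (fact m / (s\<^sup>2 / (2 * K * c\<^sup>2)) ^ m)"
      using pos by (intro mult_left_mono exp_minus_le_fact_div_power) auto
    also have "\<dots> = 2 * fact m * ((2 * K) * (c / s)\<^sup>2) ^ m"
      by (simp add: power_divide)
    also have "\<dots> = 2 * fact m * (2 * K) ^ m * (c / s) ^ (2 * m)"
      unfolding power_mult_distrib power_mult by simp
    finally show ?thesis .
qed

text \<open>The sample consists of pairs of covariate and noise. Under a product law, conditioning
  on the noise is integration over \<open>S\<close> with the second component held fixed.\<close>

locale regression_sample = prob_space M
  for M :: "'w measure" +
  fixes S :: "'u measure" and \<nu> :: "real measure" and \<zeta> :: "nat \<Rightarrow> 'w \<Rightarrow> 'u \<times> real"
  assumes prob_S: "prob_space S" and prob_\<nu>: "prob_space \<nu>" and sets_\<nu>[measurable_cong]: "sets \<nu> = sets borel"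
    and indep: "indep_vars (\<lambda>_. S \<Otimes>\<^sub>M \<nu>) \<zeta> UNIV"
    and law: "\<And>i. distr M (S \<Otimes>\<^sub>M \<nu>) (\<zeta> i) = S \<Otimes>\<^sub>M \<nu>"
    and noise_mean: "(\<integral>e. e \<partial>\<nu>) = 0" and noise_second: "integrable \<nu> (\<lambda>e. e\<^sup>2)"
begin

sublocale S: prob_space S by (rule prob_S)
sublocale N: prob_space \<nu> by (rule prob_\<nu>)
sublocale P: pair_prob_space S \<nu> ..

lemma space_\<nu>[simp]: "space \<nu> = UNIV"
  using sets_eq_imp_space_eq[OF sets_\<nu>] by simp

lemma \<zeta>_measurable[measurable]: "\<zeta> i \<in> measurable M (S \<Otimes>\<^sub>M \<nu>)"
  using indep by (auto simp: indep_vars_def)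

lemma noise_measurable[measurable]: "(\<lambda>\<omega>. snd (\<zeta> i \<omega>)) \<in> borel_measurable M"
proof -
  have "snd \<in> borel_measurable (S \<Otimes>\<^sub>M \<nu>)" by measurable
  then show ?thesis by (rule measurable_compose[OF \<zeta>_measurable])
qed

lemma snd_law: "distr (S \<Otimes>\<^sub>M \<nu>) \<nu> snd = \<nu>"
proof (rule measure_eqI)
  fix A assume "A \<in> sets (distr (S \<Otimes>\<^sub>M \<nu>) \<nu> snd)"
  then have A: "A \<in> sets \<nu>" by simp
  have "emeasure (distr (S \<Otimes>\<^sub>M \<nu>) \<nu> snd) A = emeasure (S \<Otimes>\<^sub>M \<nu>) (space S \<times> A)"
    using A sets.sets_into_space[OF A]
    by (subst emeasure_distr) (auto intro!: arg_cong[where f = "emeasure _"] simp: space_pair_measure)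
  then show "emeasure (distr (S \<Otimes>\<^sub>M \<nu>) \<nu> snd) A = emeasure \<nu> A"
    using A by (simp add: N.emeasure_pair_measure_Times S.emeasure_space_1)
qed simp

lemma integral_noise:
  fixes h :: "real \<Rightarrow> real"
  assumes [measurable]: "h \<in> borel_measurable \<nu>"
  shows "(\<integral>z. h (snd z) \<partial>(S \<Otimes>\<^sub>M \<nu>)) = (\<integral>e. h e \<partial>\<nu>)"
    and "integrable (S \<Otimes>\<^sub>M \<nu>) (\<lambda>z. h (snd z)) \<longleftrightarrow> integrable \<nu> h"
  using integral_distr[of snd "S \<Otimes>\<^sub>M \<nu>" \<nu> h] integrable_distr_eq[of snd "S \<Otimes>\<^sub>M \<nu>" \<nu> h]
  by (simp_all add: snd_law)

lemma integral_sample: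
  fixes h :: "'u \<times> real \<Rightarrow> real"
  assumes [measurable]: "h \<in> borel_measurable (S \<Otimes>\<^sub>M \<nu>)"
  shows "expectation (\<lambda>\<omega>. h (\<zeta> i \<omega>)) = (\<integral>z. h z \<partial>(S \<Otimes>\<^sub>M \<nu>))"
    and "integrable M (\<lambda>\<omega>. h (\<zeta> i \<omega>)) \<longleftrightarrow> integrable (S \<Otimes>\<^sub>M \<nu>) h"
  using integral_distr[of "\<zeta> i" M "S \<Otimes>\<^sub>M \<nu>" h] integrable_distr_eq[of "\<zeta> i" M "S \<Otimes>\<^sub>M \<nu>" h]
  by (simp_all add: law)

lemma noise_integrable: "integrable \<nu> (\<lambda>e. e)"
  by (rule N.square_integrable_imp_integrable[OF _ noise_second]) measurable

lemma weight_integrable: "integrable \<nu> (\<lambda>e. 1 + \<bar>e\<bar>)" "integrable \<nu> (\<lambda>e. (1 + \<bar>e\<bar>)\<^sup>2)"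
proof -
  show "integrable \<nu> (\<lambda>e. 1 + \<bar>e\<bar>)" using noise_integrable by auto
  have "(1 + \<bar>e\<bar>)\<^sup>2 = 1 + 2 * \<bar>e\<bar> + e\<^sup>2" for e :: real by (simp add: power2_sum)
  then show "integrable \<nu> (\<lambda>e. (1 + \<bar>e\<bar>)\<^sup>2)" using noise_integrable noise_second by auto
qed

definition empirical_process :: "nat \<Rightarrow> ('u \<times> real \<Rightarrow> real) \<Rightarrow> 'w \<Rightarrow> real" where
  "empirical_process n f \<omega> = ((\<Sum>i<n. f (\<zeta> i \<omega>)) - n * (\<integral>z. f z \<partial>(S \<Otimes>\<^sub>M \<nu>))) / sqrt n"

text \<open>The event on which the noise behaves. The first condition bounds the empirical second
  moment of the weights in the self-normalized tail; the second bounds the noise sum, the factor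
  that remains after conditional centering.\<close>

definition regular_event :: "nat \<Rightarrow> real \<Rightarrow> 'w set" where
  "regular_event n K = {\<omega> \<in> space M. (\<Sum>i<n. (1 + \<bar>snd (\<zeta> i \<omega>)\<bar>)\<^sup>2) \<le> K * n \<and>
     \<bar>\<Sum>i<n. snd (\<zeta> i \<omega>)\<bar> \<le> K * sqrt n}"

lemma regular_event_measurable[measurable]: "regular_event n K \<in> events"
  unfolding regular_event_def by measurable

lemma regular_event_likely:
  assumes "d > 0"
  shows "\<exists>K>0. \<forall>n\<ge>1. prob (space M - regular_event n K) \<le> d"
proof -
  define V where "V = (\<integral>e. (1 + \<bar>e\<bar>)\<^sup>2 \<partial>\<nu>)"
  have V: "V \<ge> 0" unfolding V_def by (rule integral_nonneg_AE) simp
  \<comment> \<open>Each condition fails with probability at most \<open>V / K\<close>: the first by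
    Markov, the second by Chebyshev, where \<open>K \<ge> 1\<close> absorbs the extra factor
    \<open>1 / K\<close>. Two moments of the noise suffice for both.\<close>
  define K where "K = max 1 (2 * V / d)"
  have K: "K \<ge> 1" "2 * V / d \<le> K" by (auto simp: K_def)
  have Kd: "2 * V \<le> K * d" using K(2) \<open>d > 0\<close> by (simp add: pos_divide_le_eq)
  have "prob (space M - regular_event n K) \<le> d" if n: "n \<ge> 1" for n
  proof -
    let ?A = "{\<omega> \<in> space M. (\<Sum>i<n. (1 + \<bar>snd (\<zeta> i \<omega>)\<bar>)\<^sup>2) \<ge> K * n}"
    let ?B = "{\<omega> \<in> space M. \<bar>\<Sum>i<n. snd (\<zeta> i \<omega>)\<bar> \<ge> K * sqrt n}"
    have n0: "real n > 0" using n by simp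
    have iw: "integrable M (\<lambda>\<omega>. (1 + \<bar>snd (\<zeta> i \<omega>)\<bar>)\<^sup>2)"
      and ew: "expectation (\<lambda>\<omega>. (1 + \<bar>snd (\<zeta> i \<omega>)\<bar>)\<^sup>2) = V" for i
      using integral_sample[of "\<lambda>z. (1 + \<bar>snd z\<bar>)\<^sup>2" i] integral_noise[of "\<lambda>e. (1 + \<bar>e\<bar>)\<^sup>2"] weight_integrable(2)
      by (simp_all add: V_def)
    have "prob ?A \<le> expectation (\<lambda>\<omega>. \<Sum>i<n. (1 + \<bar>snd (\<zeta> i \<omega>)\<bar>)\<^sup>2) / (K * n)"
      using iw K n0 by (intro integral_Markov_inequality_measure[where A = "{}"]) (auto intro!: sum_nonneg)
    also have "\<dots> = V / K" using iw ew n0 by simp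
    finally have A: "prob ?A \<le> V / K" .
    have ind: "indep_vars (\<lambda>_. borel) (\<lambda>i \<omega>. snd (\<zeta> i \<omega>)) UNIV"
      by (rule indep_vars_compose2[OF indep]) measurable
    have i2: "integrable M (\<lambda>\<omega>. (snd (\<zeta> i \<omega>))\<^sup>2)"
      and e2: "expectation (\<lambda>\<omega>. (snd (\<zeta> i \<omega>))\<^sup>2) \<le> V"
      and e1: "expectation (\<lambda>\<omega>. snd (\<zeta> i \<omega>)) = 0" for i
    proof -
      show "integrable M (\<lambda>\<omega>. (snd (\<zeta> i \<omega>))\<^sup>2)"
        using integral_sample(2)[of "\<lambda>z. (snd z)\<^sup>2" i] integral_noise(2)[of "\<lambda>e. e\<^sup>2"] noise_second by simp
      then show "expectation (\<lambda>\<omega>. (snd (\<zeta> i \<omega>))\<^sup>2) \<le> V"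
        unfolding ew[of i, symmetric] by (rule integral_mono[OF _ iw]) (auto simp: power2_sum)
      show "expectation (\<lambda>\<omega>. snd (\<zeta> i \<omega>)) = 0"
        using integral_sample(1)[of "\<lambda>z. snd z" i] integral_noise(1)[of "\<lambda>e. e"] noise_mean by simp
    qed
    note moment = indep_sum_second_moment[OF ind i2 e1, of n]
    have "prob ?B \<le> expectation (\<lambda>\<omega>. (\<Sum>i<n. snd (\<zeta> i \<omega>))\<^sup>2) / (K * sqrt n)\<^sup>2"
      using moment(1) K n0 by (intro prob_abs_ge_second_moment) auto
    also have "\<dots> \<le> (n * V) / (K * sqrt n)\<^sup>2"
      unfolding moment(2) using e2 sum_bounded_above[of "{..<n}" "\<lambda>i. expectation (\<lambda>\<omega>. (snd (\<zeta> i \<omega>))\<^sup>2)" V]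
      by (intro divide_right_mono) auto
    also have "(K * sqrt n)\<^sup>2 = n * (K * K)" by (simp add: power_mult_distrib power2_eq_square[of K])
    also have "(n * V) / (n * (K * K)) = (V / K) / K" using n0 by simp
    also have "\<dots> \<le> (V / K) / 1" using K V by (intro divide_left_mono) auto
    finally have B: "prob ?B \<le> V / K" by simp
    have "prob (space M - regular_event n K) \<le> prob (?A \<union> ?B)"
      by (rule finite_measure_mono) (auto simp: regular_event_def)
    also have "\<dots> \<le> prob ?A + prob ?B" by (rule measure_Un_le) measurable
    also have "\<dots> \<le> 2 * V / K" using A B by simp
    also have "\<dots> \<le> d" using Kd K by (simp add: pos_divide_le_eq mult.commute)
    finally show ?thesis .
  qed
  then show ?thesis using K(1) by (intro exI[of _ K]) auto
qed

text \<open>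
  The second clause makes the projection of \<open>f a\<close> onto functions of the noise an affine function
  of the noise, which holds for squared losses.
\<close>

definition lipschitz_family :: "real \<Rightarrow> ('b::euclidean_space \<Rightarrow> 'u \<times> real \<Rightarrow> real) \<Rightarrow> ('b \<Rightarrow> real) \<Rightarrow> bool" where
  "lipschitz_family L f \<beta> \<longleftrightarrow>
     (\<forall>a. f a \<in> borel_measurable (S \<Otimes>\<^sub>M \<nu>)) \<and>
     (\<forall>a e. norm a \<le> 1 \<longrightarrow> integrable S (\<lambda>u. f a (u, e)) \<and>
        (\<integral>u. f a (u, e) \<partial>S) = (\<integral>z. f a z \<partial>(S \<Otimes>\<^sub>M \<nu>)) + e * \<beta> a) \<and>
     (\<forall>a. norm a \<le> 1 \<longrightarrow> integrable (S \<Otimes>\<^sub>M \<nu>) (f a)) \<and>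
     (\<forall>a b e. norm a \<le> 1 \<longrightarrow> norm b \<le> 1 \<longrightarrow>
        (AE u in S. \<bar>f a (u, e) - f b (u, e)\<bar> \<le> L * norm (a - b) * (1 + \<bar>e\<bar>))) \<and>
     (\<forall>a b. norm a \<le> 1 \<longrightarrow> norm b \<le> 1 \<longrightarrow> \<bar>\<beta> a - \<beta> b\<bar> \<le> L * norm (a - b)) \<and>
     (\<forall>z. continuous_on (cball 0 1) (\<lambda>a. f a z))"

text \<open>At the noise value 0 the second clause of \<open>lipschitz_family\<close> identifies the
  full integral with an integral over the covariate alone, and the weight
  \<open>1 + \<bar>e\<bar>\<close> equals 1 there.\<close>

lemma lipschitz_family_integral_continuous:
  fixes f :: "'b::euclidean_space \<Rightarrow> 'u \<times> real \<Rightarrow> real"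
  assumes lf: "lipschitz_family L f \<beta>" and "L > 0"
  shows "continuous_on (cball 0 1) (\<lambda>a. \<integral>z. f a z \<partial>(S \<Otimes>\<^sub>M \<nu>))" "continuous_on (cball 0 1) \<beta>"
proof -
  have "L-lipschitz_on (cball 0 1) \<beta>"
    using lf \<open>L > 0\<close> by (auto simp: lipschitz_family_def lipschitz_on_def dist_norm)
  then show "continuous_on (cball 0 1) \<beta>" by (rule lipschitz_on_continuous_on)
  define F where "F a = (\<integral>z. f a z \<partial>(S \<Otimes>\<^sub>M \<nu>))" for a
  have le: "\<bar>F a - F b\<bar> \<le> L * norm (a - b)" if ab: "norm a \<le> 1" "norm b \<le> 1" for a b
  proof -
    have F0: "F c = (\<integral>u. f c (u, 0) \<partial>S)" "integrable S (\<lambda>u. f c (u, 0))" if "norm c \<le> 1" for c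
    proof -
      have "integrable S (\<lambda>u. f c (u, e)) \<and> (\<integral>u. f c (u, e) \<partial>S) = F c + e * \<beta> c" for e
        using lf that by (simp add: lipschitz_family_def F_def)
      from this[of 0] show "F c = (\<integral>u. f c (u, 0) \<partial>S)" "integrable S (\<lambda>u. f c (u, 0))" by auto
    qed
    have ae: "AE u in S. \<bar>f a (u, 0) - f b (u, 0)\<bar> \<le> L * norm (a - b) * (1 + \<bar>0\<bar>)"
      using lf ab by (simp only: lipschitz_family_def)
    have "\<bar>F a - F b\<bar> = \<bar>\<integral>u. f a (u, 0) - f b (u, 0) \<partial>S\<bar>"
      using F0 ab by simp
    also have "\<dots> \<le> (\<integral>u. \<bar>f a (u, 0) - f b (u, 0)\<bar> \<partial>S)" by (rule integral_abs_bound)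
    also have "\<dots> \<le> (\<integral>u. L * norm (a - b) \<partial>S)"
      using ae F0(2)[OF ab(1)] F0(2)[OF ab(2)] by (intro integral_mono_AE) auto
    finally show ?thesis by (simp add: S.prob_space)
  qed
  then have "L-lipschitz_on (cball 0 1) F"
    using \<open>L > 0\<close> by (auto simp: lipschitz_on_def dist_norm)
  then have "continuous_on (cball 0 1) F" by (rule lipschitz_on_continuous_on)
  then show "continuous_on (cball 0 1) (\<lambda>a. \<integral>z. f a z \<partial>(S \<Otimes>\<^sub>M \<nu>))" unfolding F_def .
qed

text \<open>The process splits into the conditionally centered sum \<open>X\<close>, to which
  chaining applies, and \<open>\<beta> a\<close> times the normalized noise sum, which is at most
  \<open>K\<close> in absolute value on the regular event. The constant is chosen before
  \<open>n\<close>, \<open>f\<close>, \<open>l\<close> and \<open>k\<close>, because later the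
  family is rescaled with \<open>n\<close>.\<close>

theorem empirical_process_modulus:
  fixes K L :: real
  assumes K: "K > 0" and L: "L > 0"
  shows "\<exists>C\<ge>0. \<forall>n\<ge>1. \<forall>(f :: 'b::euclidean_space \<Rightarrow> 'u \<times> real \<Rightarrow> real) \<beta> l k. lipschitz_family L f \<beta> \<longrightarrow> l > 0 \<longrightarrow>
    (\<exists>E\<in>events. prob E \<le> C * (1 / l) ^ (4 * DIM('b) + 2) * (1 / 2) ^ k \<and>
      (\<forall>\<omega>\<in>regular_event n K - E. \<forall>\<theta>\<in>cball 0 1.
        \<bar>empirical_process n (f \<theta>) \<omega> - empirical_process n (f (dyadic_trunc k \<theta>)) \<omega>\<bar>
          \<le> (2 * l + K * L * DIM('b)) / 2 ^ k))"
proof -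
  \<comment> \<open>Half of the chaining exponent: the self-normalized tail comes in even
    powers.\<close>
  define d where "d = 2 * DIM('b) + 1"
  define m where "m = 4 * DIM('b) + 2"
  have md: "m = 2 * d" by (simp add: m_def d_def)
  define K1 where "K1 = 2 * fact d * (2 * K) ^ d * L ^ m"
  have K1: "K1 \<ge> 0" using K L by (simp add: K1_def)
  define C where "C = 2 * 36 ^ DIM('b) * K1 * (2 * real DIM('b)) ^ m"
  have "\<exists>E\<in>events. prob E \<le> C * (1 / l) ^ m * (1 / 2) ^ k \<and>
      (\<forall>\<omega>\<in>regular_event n K - E. \<forall>\<theta>\<in>cball 0 1.
        \<bar>empirical_process n (f \<theta>) \<omega> - empirical_process n (f (dyadic_trunc k \<theta>)) \<omega>\<bar>
          \<le> (2 * l + K * L * DIM('b)) / 2 ^ k)"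
    if n: "n \<ge> 1" and lf: "lipschitz_family L f \<beta>" and l: "l > 0"
    for n k l and f :: "'b \<Rightarrow> 'u \<times> real \<Rightarrow> real" and \<beta>
  proof -
    have f[measurable]: "f a \<in> borel_measurable (S \<Otimes>\<^sub>M \<nu>)" for a
      using lf by (simp add: lipschitz_family_def)
    have sec: "integrable S (\<lambda>u. f a (u, e))" "(\<integral>u. f a (u, e) \<partial>S) = (\<integral>z. f a z \<partial>(S \<Otimes>\<^sub>M \<nu>)) + e * \<beta> a"
      if "norm a \<le> 1" for a e
      using lf that by (simp_all add: lipschitz_family_def)
    have lip: "AE u in S. \<bar>f a (u, e) - f b (u, e)\<bar> \<le> L * norm (a - b) * (1 + \<bar>e\<bar>)"
      if "norm a \<le> 1" "norm b \<le> 1" for a b e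
      using lf that by (simp only: lipschitz_family_def)
    define D where "D a z = f a z - (\<integral>u. f a (u, snd z) \<partial>S)" for a z
    define X where "X a \<omega> = (\<Sum>i<n. D a (\<zeta> i \<omega>)) / sqrt n" for a \<omega>
    have sq: "sqrt n > 0" using n by simp
    have [measurable]: "D a \<in> borel_measurable (S \<Otimes>\<^sub>M \<nu>)" for a unfolding D_def by measurable
    have X[measurable]: "X a \<in> borel_measurable M" for a unfolding X_def by measurable
    have process: "empirical_process n (f a) \<omega> = X a \<omega> + \<beta> a * ((\<Sum>i<n. snd (\<zeta> i \<omega>)) / sqrt n)"
      if "norm a \<le> 1" for a \<omega>
    proof -
      have "(\<Sum>i<n. D a (\<zeta> i \<omega>)) = (\<Sum>i<n. f a (\<zeta> i \<omega>)) - n * (\<integral>z. f a z \<partial>(S \<Otimes>\<^sub>M \<nu>)) - \<beta> a * (\<Sum>i<n. snd (\<zeta> i \<omega>))"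
        unfolding D_def sec(2)[OF that] by (simp add: sum_subtractf sum.distrib sum_distrib_left mult.commute)
      then show ?thesis
        by (simp add: empirical_process_def X_def diff_divide_distrib)
    qed
    have tail: "prob {\<omega> \<in> space M. \<omega> \<in> regular_event n K \<and> \<bar>X a \<omega> - X b \<omega>\<bar> > s} \<le> K1 * (norm (a - b) / s) ^ m"
      if ab: "norm a \<le> 1" "norm b \<le> 1" and s: "s > 0" for a b s
    proof (cases "a = b")
      case True
      then have empty: "{\<omega> \<in> space M. \<omega> \<in> regular_event n K \<and> \<bar>X a \<omega> - X b \<omega>\<bar> > s} = {}"
        using s by auto
      show ?thesis unfolding empty using K1 s by simp
    next
      case False
      then have c: "L * norm (a - b) > 0" using L by simp
      define g where "g z = f a z - f b z" for z
      have g[measurable]: "g \<in> borel_measurable (S \<Otimes>\<^sub>M \<nu>)" unfolding g_def by measurable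
      have Dg: "D a z - D b z = g z - (\<integral>u. g (u, snd z) \<partial>S)" for z
        using sec(1)[OF ab(1)] sec(1)[OF ab(2)] by (simp add: D_def g_def)
      have "X a \<omega> - X b \<omega> = (\<Sum>i<n. g (\<zeta> i \<omega>) - (\<integral>u. g (u, snd (\<zeta> i \<omega>)) \<partial>S)) / sqrt n" for \<omega>
        unfolding Dg[symmetric] by (simp add: X_def sum_subtractf diff_divide_distrib)
      then have "prob {\<omega> \<in> space M. \<omega> \<in> regular_event n K \<and> \<bar>X a \<omega> - X b \<omega>\<bar> > s} \<le>
        prob {\<omega> \<in> space M. (\<Sum>i<n. (1 + \<bar>snd (\<zeta> i \<omega>)\<bar>)\<^sup>2) \<le> K * n \<and>
          \<bar>(\<Sum>i<n. g (\<zeta> i \<omega>) - (\<integral>u. g (u, snd (\<zeta> i \<omega>)) \<partial>S)) / sqrt n\<bar> > s}"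
        by (intro finite_measure_mono) (auto simp: regular_event_def)
      also have "\<dots> \<le> 2 * fact d * (2 * K) ^ d * (L * norm (a - b) / s) ^ (2 * d)"
        using lip[OF ab] by (intro self_normalized_power_tail[OF prob_S prob_\<nu> indep law g _ _ c K s n, of "\<lambda>e. 1 + \<bar>e\<bar>"])
          (auto simp: g_def)
      also have "\<dots> = K1 * (norm (a - b) / s) ^ m"
        by (simp add: K1_def md power_mult_distrib power_divide)
      finally show ?thesis .
    qed
    have contf: "continuous_on (cball 0 1) (\<lambda>a. f a z)" for z
      using lf by (simp only: lipschitz_family_def)
    have cont: "continuous_on (cball 0 1) (\<lambda>a. X a \<omega>)" for \<omega>
    proof -
      have "continuous_on (cball 0 1) (\<lambda>a. (\<Sum>i<n. f a (\<zeta> i \<omega>) - ((\<integral>z. f a z \<partial>(S \<Otimes>\<^sub>M \<nu>)) + snd (\<zeta> i \<omega>) * \<beta> a)) / sqrt n)"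
        using contf lipschitz_family_integral_continuous[OF lf L] sq
        by (intro continuous_intros) auto
      then show ?thesis
        by (rule continuous_on_eq) (simp add: X_def D_def sec(2))
    qed
    obtain E where E: "E \<in> events" "prob E \<le> 2 * 36 ^ DIM('b) * K1 * (2 * DIM('b) / l) ^ m * (1 / 2) ^ k"
      "\<And>\<omega> \<theta>. \<omega> \<in> regular_event n K - E \<Longrightarrow> \<theta> \<in> cball 0 1 \<Longrightarrow> \<bar>X \<theta> \<omega> - X (dyadic_trunc k \<theta>) \<omega>\<bar> \<le> 2 * l / 2 ^ k"
      using chaining[OF X regular_event_measurable tail[unfolded m_def] cont K1 l, of k, folded m_def] by blast
    have "2 * 36 ^ DIM('b) * K1 * (2 * DIM('b) / l) ^ m * (1 / 2) ^ k = C * (1 / l) ^ m * (1 / 2) ^ k"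
      by (simp add: C_def power_divide)
    moreover have "\<bar>empirical_process n (f \<theta>) \<omega> - empirical_process n (f (dyadic_trunc k \<theta>)) \<omega>\<bar>
          \<le> (2 * l + K * L * DIM('b)) / 2 ^ k"
      if \<omega>: "\<omega> \<in> regular_event n K - E" and \<theta>: "\<theta> \<in> cball 0 1" for \<omega> \<theta>
    proof -
      let ?p = "dyadic_trunc k \<theta>"
      have n1: "norm \<theta> \<le> 1" "norm ?p \<le> 1" using \<theta> norm_dyadic_trunc_le[of k \<theta>] by auto
      define s where "s = (\<Sum>i<n. snd (\<zeta> i \<omega>)) / sqrt n"
      have "\<bar>\<Sum>i<n. snd (\<zeta> i \<omega>)\<bar> \<le> K * sqrt n" using \<omega> by (simp add: regular_event_def)
      then have s: "\<bar>s\<bar> \<le> K" using sq by (simp add: s_def pos_divide_le_eq)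
      have "\<bar>\<beta> \<theta> - \<beta> ?p\<bar> \<le> L * norm (\<theta> - ?p)" using lf n1 by (simp add: lipschitz_family_def)
      also have "\<dots> \<le> L * (DIM('b) / 4 ^ k)"
        using L norm_diff_dyadic_trunc_le[of \<theta> k] by (intro mult_left_mono) auto
      also have "\<dots> \<le> L * (DIM('b) / 2 ^ k)"
        using L by (intro mult_left_mono divide_left_mono power_mono) auto
      finally have "\<bar>\<beta> \<theta> - \<beta> ?p\<bar> * \<bar>s\<bar> \<le> L * (DIM('b) / 2 ^ k) * K"
        using s L by (intro mult_mono) auto
      then have 1: "\<bar>(\<beta> \<theta> - \<beta> ?p) * s\<bar> \<le> K * L * DIM('b) / 2 ^ k"
        by (simp add: abs_mult mult.commute mult.left_commute)
      have 2: "\<bar>X \<theta> \<omega> - X ?p \<omega>\<bar> \<le> 2 * l / 2 ^ k" by (rule E(3)[OF \<omega> \<theta>])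
      have "empirical_process n (f \<theta>) \<omega> - empirical_process n (f ?p) \<omega> = (X \<theta> \<omega> - X ?p \<omega>) + (\<beta> \<theta> - \<beta> ?p) * s"
        unfolding process[OF n1(1)] process[OF n1(2)] s_def[symmetric] by (simp add: left_diff_distrib)
      then show ?thesis
        using abs_triangle_ineq[of "X \<theta> \<omega> - X ?p \<omega>" "(\<beta> \<theta> - \<beta> ?p) * s"] 1 2 by (simp add: add_divide_distrib)
    qed
    ultimately show ?thesis using E(1,2) by (intro bexI[of _ E]) auto
  qed
  moreover have "C \<ge> 0" using K1 by (simp add: C_def)
  ultimately show ?thesis unfolding m_def by blast
qed

end


section \<open>The regression model\<close>

text \<open>The product is the combination of the rows of \<open>A\<close> with coefficients
  \<open>u $ i\<close>, so Cauchy-Schwarz over the rows bounds the operator norm by the Frobenius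
  norm.\<close>

lemma norm_transpose_mult_le:
  fixes A :: "real ^ 'q ^ 'd"
  shows "norm (transpose A *v u) \<le> norm A * norm u"
proof -
  have "transpose A *v u = (\<Sum>i\<in>UNIV. u $ i *\<^sub>R (A $ i))"
    by (simp add: vec_eq_iff matrix_vector_mult_def transpose_def mult.commute)
  then have "norm (transpose A *v u) \<le> (\<Sum>i\<in>UNIV. \<bar>u $ i\<bar> * norm (A $ i))"
    using norm_sum[of "\<lambda>i. u $ i *\<^sub>R (A $ i)" UNIV] by simp
  also have "\<dots> = (\<Sum>i\<in>UNIV. \<bar>norm (A $ i)\<bar> * \<bar>u $ i\<bar>)" by (simp add: mult.commute)
  also have "\<dots> \<le> L2_set (\<lambda>i. norm (A $ i)) UNIV * L2_set (\<lambda>i. u $ i) UNIV"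
    by (rule L2_set_mult_ineq)
  also have "\<dots> = norm A * norm u" by (simp add: norm_vec_def L2_set_def)
  finally show ?thesis .
qed

section \<open>Support functions and the action of automorphisms\<close>

lemma support_fun_0: "C \<noteq> {} \<Longrightarrow> support_fun C 0 = 0"
  by (simp add: support_fun_def)

lemma support_fun_lipschitz:
  assumes "bounded K" "K \<noteq> {}" "\<And>x. x \<in> K \<Longrightarrow> norm x \<le> R"
  shows "\<bar>support_fun K u - support_fun K v\<bar> \<le> R * norm (u - v)"
  using support_fun_diff_le[OF assms, of u v] support_fun_diff_le[OF assms, of v u]
  by (auto simp: norm_minus_commute abs_le_iff)

lemma support_fun_abs_le:
  assumes "bounded K" "K \<noteq> {}" "\<And>x. x \<in> K \<Longrightarrow> norm x \<le> R"
  shows "\<bar>support_fun K u\<bar> \<le> R * norm u"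
  using support_fun_lipschitz[OF assms, of u 0] by (simp add: support_fun_0 assms)

lemma support_fun_bdd_above:
  fixes K :: "'a::euclidean_space set"
  assumes "bounded K"
  shows "bdd_above ((\<lambda>x. x \<bullet> u) ` K)"
proof -
  obtain B where B: "\<And>x. x \<in> K \<Longrightarrow> norm x \<le> B" using assms by (auto simp: bounded_iff)
  show ?thesis
  proof (rule bdd_aboveI2)
    fix x assume "x \<in> K"
    then show "x \<bullet> u \<le> B * norm u"
      using norm_cauchy_schwarz[of x u] B[of x] mult_right_mono[of "norm x" B "norm u"] by auto
  qed
qed

lemma support_fun_scaleR:
  fixes K :: "'a::euclidean_space set"
  assumes "bounded K" "K \<noteq> {}" "t \<ge> 0"
  shows "support_fun K (t *\<^sub>R u) = t * support_fun K u"
proof (cases "t = 0")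
  case True then show ?thesis using assms support_fun_0[of K] by simp
next
  case False
  then have t: "t > 0" using assms by simp
  show ?thesis
  proof (rule antisym)
    show "support_fun K (t *\<^sub>R u) \<le> t * support_fun K u"
      unfolding support_fun_def[of K "t *\<^sub>R u"]
      using t cSUP_upper[OF _ support_fun_bdd_above[OF assms(1), of u]]
      by (intro cSUP_least[OF assms(2)]) (simp add: support_fun_def)
    have "support_fun K u \<le> support_fun K (t *\<^sub>R u) / t"
      unfolding support_fun_def[of K u]
      using t cSUP_upper[OF _ support_fun_bdd_above[OF assms(1), of "t *\<^sub>R u"]]
      by (intro cSUP_least[OF assms(2)]) (simp add: support_fun_def pos_le_divide_eq mult.commute)
    then show "t * support_fun K u \<le> support_fun K (t *\<^sub>R u)"
      using t by (simp add: pos_le_divide_eq mult.commute)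
  qed
qed

lemma support_fun_add_le:
  fixes K :: "'a::euclidean_space set"
  assumes "bounded K" "K \<noteq> {}"
  shows "support_fun K (u + v) \<le> support_fun K u + support_fun K v"
  unfolding support_fun_def[of K "u + v"]
proof (rule cSUP_least[OF assms(2)])
  fix x assume x: "x \<in> K"
  show "x \<bullet> (u + v) \<le> support_fun K u + support_fun K v"
    using cSUP_upper[OF x support_fun_bdd_above[OF assms(1), of u]]
      cSUP_upper[OF x support_fun_bdd_above[OF assms(1), of v]]
    by (simp add: support_fun_def inner_add_right)
qed

text \<open>Transposition moves \<open>g\<close> from the matrix to the points of \<open>C\<close>,
  and \<open>g\<close> maps \<open>C\<close> onto itself.\<close>

lemma support_fun_Aut:
  assumes "g \<in> Aut C"
  shows "support_fun C (transpose (A ** g) *v u) = support_fun C (transpose A *v u)"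
proof -
  have "support_fun C (transpose (A ** g) *v u) = (SUP x\<in>C. (g *v x) \<bullet> (transpose A *v u))"
    unfolding support_fun_def
    by (intro SUP_cong refl)
      (metis dot_lmul_matrix inner_commute matrix_transpose_mul matrix_vector_mul_assoc transpose_matrix_vector transpose_transpose)
  also have "\<dots> = support_fun C (transpose A *v u)"
    using assms by (simp add: support_fun_def Aut_def image_image[symmetric, of "\<lambda>y. y \<bullet> _" "\<lambda>x. g *v x"] del: transpose_matrix_vector)
  finally show ?thesis .
qed

lemma norm_matrix_mult_orthogonal:
  fixes A :: "real ^ 'q ^ 'd" and g :: "real ^ 'q ^ 'q"
  assumes "orthogonal_matrix g"
  shows "norm (A ** g) = norm A"
proof -
  have row: "(A ** g) $ i = transpose g *v (A $ i)" for i
    by (simp add: vec_eq_iff matrix_matrix_mult_def matrix_vector_mult_def transpose_def mult.commute)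
  have "orthogonal_transformation (\<lambda>x. transpose g *v x)"
    using assms by (simp add: orthogonal_transformation_matrix orthogonal_matrix_transpose del: transpose_matrix_vector)
  then have "norm (transpose g *v (A $ i)) = norm (A $ i)" for i
    by (rule orthogonal_transformation_norm)
  then show ?thesis by (simp only: norm_vec_def[of "A ** g"] norm_vec_def[of A] row)
qed

text \<open>Reflection preserves Lebesgue measure on the ball and commutes with radial projection.
  This is used to pass from \<open>hC A\<close> to \<open>hC (- A)\<close>, which is
  \<open>hC A\<close> at the antipode.\<close>

lemma sphere_uniform_uminus:
  "distr sphere_uniform borel uminus = (sphere_uniform :: 'a::euclidean_space measure)"
proof -
  let ?U = "uniform_measure lborel (cball (0::'a) 1)"
  have U: "distr ?U borel uminus = ?U"
  proof (rule measure_eqI)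
    fix A assume "A \<in> sets (distr ?U borel uminus)"
    then have A: "A \<in> sets borel" by simp
    have un: "uminus -` A \<in> sets borel"
      using measurable_sets[OF borel_measurable_uminus[OF measurable_ident] A] by simp
    have "emeasure (distr ?U borel uminus) A = emeasure ?U (uminus -` A)"
      using A by (subst emeasure_distr) auto
    also have "\<dots> = emeasure lborel (cball 0 1 \<inter> uminus -` A) / emeasure lborel (cball (0::'a) 1)"
      using un by simp
    also have "emeasure lborel (cball 0 1 \<inter> uminus -` A) = emeasure lborel (uminus -` (cball 0 1 \<inter> A))"
      by (intro arg_cong[where f = "emeasure lborel"]) auto
    also have "\<dots> = emeasure (distr lborel borel uminus) (cball 0 1 \<inter> A)"
      using A by (subst emeasure_distr) auto
    also have "distr lborel borel (uminus :: 'a \<Rightarrow> 'a) = lborel"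
      using lborel_affine[of "- 1" "0 :: 'a"] by (simp add: density_1)
    finally show "emeasure (distr ?U borel uminus) A = emeasure ?U A" using A by simp
  qed simp
  have "distr sphere_uniform borel uminus = distr ?U borel (uminus \<circ> (\<lambda>x. x /\<^sub>R norm x))"
    unfolding sphere_uniform_def by (rule distr_distr) auto
  also have "\<dots> = distr ?U borel ((\<lambda>x. x /\<^sub>R norm x) \<circ> uminus)"
    by (intro distr_cong) auto
  also have "\<dots> = distr (distr ?U borel uminus) borel (\<lambda>x. x /\<^sub>R norm x)"
    by (rule distr_distr[symmetric]) auto
  also have "\<dots> = sphere_uniform" unfolding U sphere_uniform_def ..
  finally show ?thesis .
qed

section \<open>Functions that are affine in the noise\<close>

context regression_sample begin

lemma noise_prob_UNIV[simp]: "N.prob UNIV = 1"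
  using N.prob_space by simp

text \<open>Fubini's theorem for \<open>a u + e * b u\<close>: the centered noise removes
  \<open>b\<close> from the full integral, whereas conditionally on the noise \<open>b\<close>
  contributes the slope.\<close>

lemma affine_in_noise:
  assumes [measurable]: "a \<in> borel_measurable S" "b \<in> borel_measurable S"
    and a: "integrable S a" and b: "integrable S b"
  shows "integrable (S \<Otimes>\<^sub>M \<nu>) (\<lambda>(u, e). a u + e * b u)"
    and "(\<integral>z. (case z of (u, e) \<Rightarrow> a u + e * b u) \<partial>(S \<Otimes>\<^sub>M \<nu>)) = (\<integral>u. a u \<partial>S)"
    and "integrable S (\<lambda>u. a u + e * b u)"
    and "(\<integral>u. a u + e * b u \<partial>S) = (\<integral>u. a u \<partial>S) + e * (\<integral>u. b u \<partial>S)"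
proof -
  show sec: "integrable S (\<lambda>u. a u + e * b u)"
    "(\<integral>u. a u + e * b u \<partial>S) = (\<integral>u. a u \<partial>S) + e * (\<integral>u. b u \<partial>S)" for e
    using a b by auto
  show int: "integrable (S \<Otimes>\<^sub>M \<nu>) (\<lambda>(u, e). a u + e * b u)"
  proof (rule P.Fubini_integrable)
    show "AE u in S. integrable \<nu> (\<lambda>e. case (u, e) of (u, e) \<Rightarrow> a u + e * b u)"
      using noise_integrable by (intro AE_I2) simp
    show "integrable S (\<lambda>u. \<integral>e. norm (case (u, e) of (u, e) \<Rightarrow> a u + e * b u) \<partial>\<nu>)"
    proof (rule Bochner_Integration.integrable_bound)
      show "integrable S (\<lambda>u. \<bar>a u\<bar> + (\<integral>e. \<bar>e\<bar> \<partial>\<nu>) * \<bar>b u\<bar>)" using a b by auto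
      have "(\<integral>e. \<bar>a u + e * b u\<bar> \<partial>\<nu>) \<le> \<bar>a u\<bar> + (\<integral>e. \<bar>e\<bar> \<partial>\<nu>) * \<bar>b u\<bar>" for u
      proof -
        have "(\<integral>e. \<bar>a u + e * b u\<bar> \<partial>\<nu>) \<le> (\<integral>e. \<bar>a u\<bar> + \<bar>e\<bar> * \<bar>b u\<bar> \<partial>\<nu>)"
          using noise_integrable
          by (intro integral_mono) (auto simp: abs_mult[symmetric] intro!: abs_triangle_ineq)
        also have "\<dots> = \<bar>a u\<bar> + (\<integral>e. \<bar>e\<bar> \<partial>\<nu>) * \<bar>b u\<bar>"
          using noise_integrable by (subst Bochner_Integration.integral_add) (auto simp: N.prob_space)
        finally show ?thesis .
      qed
      moreover have "0 \<le> (\<integral>e. \<bar>a u + e * b u\<bar> \<partial>\<nu>)" for u by (rule integral_nonneg_AE) simp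
      ultimately show "AE u in S. norm (\<integral>e. norm (case (u, e) of (u, e) \<Rightarrow> a u + e * b u) \<partial>\<nu>)
          \<le> norm (\<bar>a u\<bar> + (\<integral>e. \<bar>e\<bar> \<partial>\<nu>) * \<bar>b u\<bar>)"
        by (intro AE_I2) (simp add: abs_of_nonneg order_trans[OF _ abs_ge_self])
    qed measurable
  qed measurable
  have "(\<integral>z. (case z of (u, e) \<Rightarrow> a u + e * b u) \<partial>(S \<Otimes>\<^sub>M \<nu>)) = (\<integral>e. (\<integral>u. a u + e * b u \<partial>S) \<partial>\<nu>)"
    using P.integral_snd[OF int] by simp
  also have "\<dots> = (\<integral>u. a u \<partial>S)"
    unfolding sec(2) using noise_integrable noise_mean
    by (subst Bochner_Integration.integral_add) (auto simp: N.prob_space)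
  finally show "(\<integral>z. (case z of (u, e) \<Rightarrow> a u + e * b u) \<partial>(S \<Otimes>\<^sub>M \<nu>)) = (\<integral>u. a u \<partial>S)" .
qed

end

section \<open>The shape regression model in residual coordinates\<close>

locale shape_regression = prob_space M
  for M :: "'w measure" +
  fixes Kstar :: "(real ^ 'd) set" and C :: "(real ^ 'q) set" and \<nu> :: "real measure"
    and Z :: "nat \<Rightarrow> 'w \<Rightarrow> (real ^ 'd) \<times> real"
  assumes Kstar: "compact Kstar" "Kstar \<noteq> {}" and C: "compact C" "C \<noteq> {}"
    and noise_law: "prob_space \<nu>" "sets \<nu> = sets borel"
    and mean: "(\<integral>e. e \<partial>\<nu>) = 0" and second: "integrable \<nu> (\<lambda>e. e\<^sup>2)"
    and Z_indep: "indep_vars (\<lambda>_. borel) Z UNIV"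
    and Z_law: "\<And>i. distr M borel (Z i) = regression_law Kstar \<nu>"
begin

definition hK :: "real ^ 'd \<Rightarrow> real" where "hK = support_fun Kstar"
definition hC :: "real ^ 'q ^ 'd \<Rightarrow> real ^ 'd \<Rightarrow> real" where
  "hC A u = support_fun C (transpose A *v u)"
text \<open>A shear, inverse to \<open>observations\<close>, that turns the dependent pair of
  covariate and response into the independent pair of covariate and noise.\<close>

definition residuals :: "(real ^ 'd) \<times> real \<Rightarrow> (real ^ 'd) \<times> real" where
  "residuals = (\<lambda>(u, y). (u, y - hK u))"
definition observations :: "(real ^ 'd) \<times> real \<Rightarrow> (real ^ 'd) \<times> real" where
  "observations = (\<lambda>(u, e). (u, hK u + e))"
definition \<zeta> :: "nat \<Rightarrow> 'w \<Rightarrow> (real ^ 'd) \<times> real" where "\<zeta> i \<omega> = residuals (Z i \<omega>)"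
definition loss :: "real ^ 'q ^ 'd \<Rightarrow> (real ^ 'd) \<times> real \<Rightarrow> real" where
  "loss A = (\<lambda>(u, e). (hC A u - hK u - e)\<^sup>2)"

lemma residuals_observations: "residuals (observations z) = z"
  by (simp add: residuals_def observations_def split: prod.splits)

lemma observations_residuals: "observations (residuals z) = z"
  by (simp add: residuals_def observations_def split: prod.splits)

lemma loss_eq: "loss A z = sq_loss C A (observations z)"
  by (simp add: loss_def sq_loss_def observations_def hC_def split: prod.splits) (simp add: algebra_simps)

lemma loss_\<zeta>: "loss A (\<zeta> i \<omega>) = sq_loss C A (Z i \<omega>)"
  by (simp add: loss_eq \<zeta>_def observations_residuals)

lemma hK_continuous: "continuous_on UNIV hK"
  unfolding hK_def using Kstar by (intro continuous_support_fun compact_imp_bounded)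

lemma hC_continuous: "continuous_on UNIV (hC A)"
proof -
  have "continuous_on UNIV (\<lambda>u. support_fun C (transpose A *v u))"
    by (rule continuous_on_compose2[OF continuous_support_fun]) 
      (use C in \<open>auto intro: compact_imp_bounded matrix_vector_mult_linear_continuous_on simp del: transpose_matrix_vector\<close>)
  then show ?thesis by (simp only: hC_def[abs_def])
qed

lemma hK_measurable[measurable]: "hK \<in> borel_measurable borel"
  by (rule borel_measurable_continuous_onI[OF hK_continuous])

lemma hC_measurable[measurable]: "hC A \<in> borel_measurable borel"
  by (rule borel_measurable_continuous_onI[OF hC_continuous])

text \<open>One radius for both bodies. Being at least 1, it allows lower powers of \<open>R\<close>
  to be absorbed into the \<open>R\<^sup>2\<close> of \<open>Lip\<close>.\<close>

definition R :: real where
  "R = (SOME R. R \<ge> 1 \<and> (\<forall>x\<in>C. norm x \<le> R) \<and> (\<forall>y\<in>Kstar. norm y \<le> R))"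

lemma R: "R \<ge> 1" "x \<in> C \<Longrightarrow> norm x \<le> R" "y \<in> Kstar \<Longrightarrow> norm y \<le> R"
proof -
  obtain B where B: "\<forall>x\<in>C. norm x \<le> B"
    using compact_imp_bounded[OF C(1)] by (auto simp: bounded_iff)
  obtain B' where B': "\<forall>y\<in>Kstar. norm y \<le> B'"
    using compact_imp_bounded[OF Kstar(1)] by (auto simp: bounded_iff)
  have "\<exists>R\<ge>1. (\<forall>x\<in>C. norm x \<le> R) \<and> (\<forall>y\<in>Kstar. norm y \<le> R)"
    by (rule exI[of _ "max 1 (max B B')"]) (use B B' in \<open>auto simp: le_max_iff_disj\<close>)
  from someI_ex[OF this] have "R \<ge> 1 \<and> (\<forall>x\<in>C. norm x \<le> R) \<and> (\<forall>y\<in>Kstar. norm y \<le> R)"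
    unfolding R_def .
  then show "R \<ge> 1" "x \<in> C \<Longrightarrow> norm x \<le> R" "y \<in> Kstar \<Longrightarrow> norm y \<le> R" by auto
qed

lemma hK_le: "\<bar>hK u\<bar> \<le> R * norm u"
  unfolding hK_def using Kstar R by (intro support_fun_abs_le) (auto intro: compact_imp_bounded)

lemma hC_lipschitz: "\<bar>hC A u - hC B u\<bar> \<le> R * (norm (A - B) * norm u)"
proof -
  have "\<bar>hC A u - hC B u\<bar> \<le> R * norm (transpose A *v u - transpose B *v u)"
    unfolding hC_def using C R by (intro support_fun_lipschitz) (auto intro: compact_imp_bounded)
  also have "transpose A *v u - transpose B *v u = transpose (A - B) *v u"
    by (simp add: vec_eq_iff matrix_vector_mult_def transpose_def left_diff_distrib sum_subtractf
      del: transpose_matrix_vector)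
  also have "R * norm (transpose (A - B) *v u) \<le> R * (norm (A - B) * norm u)"
    using R(1) by (intro mult_left_mono norm_transpose_mult_le) auto
  finally show ?thesis .
qed

lemma hC_0: "hC 0 u = 0"
proof -
  have "transpose 0 *v u = (0 :: real ^ 'q)"
    by (simp add: vec_eq_iff matrix_vector_mult_def transpose_def del: transpose_matrix_vector)
  then show ?thesis using C by (simp add: hC_def support_fun_0 del: transpose_matrix_vector)
qed

lemma hC_le: "\<bar>hC A u\<bar> \<le> R * (norm A * norm u)"
  using hC_lipschitz[of A u 0] by (simp add: hC_0)

lemma hC_add_le: "hC (A + B) u \<le> hC A u + hC B u"
proof -
  have "transpose (A + B) *v u = transpose A *v u + transpose B *v u"
    by (simp add: vec_eq_iff matrix_vector_mult_def transpose_def distrib_right sum.distrib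
      del: transpose_matrix_vector)
  then show ?thesis
    unfolding hC_def using C by (simp only:) (intro support_fun_add_le compact_imp_bounded)
qed

lemma hC_scaleR: "t \<ge> 0 \<Longrightarrow> hC (t *\<^sub>R A) u = t * hC A u"
proof -
  assume t: "t \<ge> 0"
  have "transpose (t *\<^sub>R A) *v u = t *\<^sub>R (transpose A *v u)"
    by (simp add: vec_eq_iff matrix_vector_mult_def transpose_def sum_distrib_left mult.assoc
      del: transpose_matrix_vector)
  then show ?thesis
    unfolding hC_def using C t by (simp only:) (intro support_fun_scaleR compact_imp_bounded)
qed

lemma hC_uminus: "hC (- A) u = hC A (- u)"
proof -
  have "transpose (- A) *v u = transpose A *v (- u)"
    by (simp add: vec_eq_iff matrix_vector_mult_def transpose_def sum_negf
      del: transpose_matrix_vector)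
  then show ?thesis by (simp only: hC_def)
qed

lemma hC_Aut: "g \<in> Aut C \<Longrightarrow> hC (A ** g) u = hC A u"
  unfolding hC_def by (rule support_fun_Aut)

lemma sets_S: "sets (sphere_uniform \<Otimes>\<^sub>M \<nu>) = sets (borel :: ((real ^ 'd) \<times> real) measure)"
  unfolding borel_prod[symmetric] by (intro sets_pair_measure_cong) (simp_all add: noise_law)

lemma residuals_measurable[measurable]: "residuals \<in> borel \<rightarrow>\<^sub>M borel"
  unfolding residuals_def borel_prod[symmetric] by measurable

lemma observations_measurable[measurable]: "observations \<in> borel \<rightarrow>\<^sub>M borel"
  unfolding observations_def borel_prod[symmetric] by measurable

lemma regression_law_eq: "regression_law Kstar \<nu> = distr (sphere_uniform \<Otimes>\<^sub>M \<nu>) borel observations"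
  by (simp add: regression_law_def observations_def hK_def)

text \<open>The regression law is the image of the product law under \<open>observations\<close>, so
  undoing this shear returns independent residuals with the product law.\<close>

sublocale regression_sample M sphere_uniform \<nu> \<zeta>
proof (intro regression_sample.intro regression_sample_axioms.intro)
  show "prob_space M" by unfold_locales
  show "prob_space (sphere_uniform :: (real ^ 'd) measure)" by (rule prob_space_sphere_uniform)
  show "indep_vars (\<lambda>_. sphere_uniform \<Otimes>\<^sub>M \<nu>) \<zeta> UNIV"
    unfolding \<zeta>_def
    by (rule indep_vars_compose2[OF Z_indep])
      (simp add: measurable_cong_sets[OF refl sets_S])
  fix i
  have [measurable]: "Z i \<in> borel_measurable M" using Z_indep by (auto simp: indep_vars_def)
  have "distr M (sphere_uniform \<Otimes>\<^sub>M \<nu>) (\<zeta> i) = distr M borel (residuals \<circ> Z i)"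
    by (rule distr_cong[OF refl sets_S]) (simp add: \<zeta>_def)
  also have "\<dots> = distr (regression_law Kstar \<nu>) borel residuals"
    unfolding Z_law[of i, symmetric] by (rule distr_distr[symmetric]) measurable
  also have "\<dots> = distr (sphere_uniform \<Otimes>\<^sub>M \<nu>) borel (residuals \<circ> observations)"
    unfolding regression_law_eq
    by (rule distr_distr) (simp_all add: measurable_cong_sets[OF sets_S refl])
  also have "\<dots> = distr (sphere_uniform \<Otimes>\<^sub>M \<nu>) (sphere_uniform \<Otimes>\<^sub>M \<nu>) (\<lambda>z. z)"
    by (rule distr_cong[OF refl sets_S[symmetric]]) (simp add: residuals_observations)
  finally show "distr M (sphere_uniform \<Otimes>\<^sub>M \<nu>) (\<zeta> i) = sphere_uniform \<Otimes>\<^sub>M \<nu>"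
    by (simp add: distr_id2)
qed (fact noise_law mean second)+

lemma Z_measurable[measurable]: "Z i \<in> borel_measurable M"
  using Z_indep by (auto simp: indep_vars_def)

lemma loss_measurable[measurable]: "loss A \<in> borel_measurable (sphere_uniform \<Otimes>\<^sub>M \<nu>)"
  unfolding loss_def by measurable

lemma sq_loss_measurable[measurable]: "sq_loss C (A :: real ^ 'q ^ 'd) \<in> borel_measurable borel"
proof -
  have "loss A \<in> borel_measurable borel"
    using loss_measurable[of A] by (simp add: measurable_cong_sets[OF sets_S refl])
  then have "(\<lambda>z. loss A (residuals z)) \<in> borel_measurable borel" by measurable
  then show ?thesis by (simp add: loss_eq observations_residuals)
qed

lemma risk_eq: "risk C A (regression_law Kstar \<nu>) = (\<integral>z. loss A z \<partial>(sphere_uniform \<Otimes>\<^sub>M \<nu>))"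
proof -
  have "loss A = (\<lambda>z. sq_loss C A (observations z))" by (simp add: loss_eq fun_eq_iff)
  then show ?thesis
    unfolding risk_def regression_law_eq
    by (subst integral_distr) (simp_all add: measurable_cong_sets[OF sets_S refl])
qed

lemma AE_sphere: "AE u in (sphere_uniform :: (real ^ 'd) measure). norm u = 1"
  using AE_sphere_uniform by eventually_elim simp

lemma AE_sphere_pair: "AE z in (sphere_uniform :: (real ^ 'd) measure) \<Otimes>\<^sub>M \<nu>. norm (fst z) = 1"
proof (rule P.AE_pair_measure)
  show "{z \<in> space ((sphere_uniform :: (real ^ 'd) measure) \<Otimes>\<^sub>M \<nu>). norm (fst z) = 1} \<in> sets (sphere_uniform \<Otimes>\<^sub>M \<nu>)"
    by measurable
  show "AE u in (sphere_uniform :: (real ^ 'd) measure). AE e in \<nu>. norm (fst (u, e)) = 1"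
    using AE_sphere by eventually_elim simp
qed

lemma AE_all_sphere: "AE \<omega> in M. \<forall>i. norm (fst (\<zeta> i \<omega>)) = 1"
proof -
  have "AE \<omega> in M. norm (fst (\<zeta> i \<omega>)) = 1" for i
  proof -
    have "AE z in distr M (sphere_uniform \<Otimes>\<^sub>M \<nu>) (\<zeta> i). norm (fst z) = 1"
      unfolding law by (rule AE_sphere_pair)
    then show ?thesis by (subst (asm) AE_distr_iff) measurable
  qed
  then show ?thesis by (simp add: AE_all_countable)
qed

section \<open>Loss differences: Lipschitz bound and integrability\<close>

lemma sphere_integrable:
  fixes a :: "real ^ 'd \<Rightarrow> real"
  assumes "a \<in> borel_measurable borel" "\<And>u. norm u = 1 \<Longrightarrow> \<bar>a u\<bar> \<le> B"
  shows "integrable sphere_uniform a"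
  using assms AE_sphere by (intro S.integrable_const_bound[of _ B]) (auto elim: eventually_mono)

text \<open>The Lipschitz constant of the loss on the ball of radius \<open>b\<close>, up to the
  weight \<open>1 + \<bar>e\<bar>\<close>: in the factorized difference of squares one factor
  \<open>R\<close> comes from \<open>hC\<close>, and the other factor is at most
  \<open>2 * R * (b + 1)\<close> times the weight.\<close>

definition Lip :: "real \<Rightarrow> real" where "Lip b = 2 * R\<^sup>2 * (b + 1)"

lemma Lip_pos: "b \<ge> 0 \<Longrightarrow> Lip b > 0"
  using R(1) by (simp add: Lip_def)

text \<open>The square of the noise cancels, so the difference is affine in \<open>e\<close> with
  coefficients bounded on the sphere.\<close>

lemma loss_diff:
  "loss A (u, e) - loss B (u, e) =
    ((hC A u)\<^sup>2 - (hC B u)\<^sup>2 - 2 * hK u * (hC A u - hC B u)) + e * (- 2 * (hC A u - hC B u))"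
  by (simp add: loss_def power2_eq_square algebra_simps)

lemma loss_lipschitz:
  assumes "norm u = 1" "norm A \<le> b" "norm B \<le> b"
  shows "\<bar>loss A (u, e) - loss B (u, e)\<bar> \<le> Lip b * norm (A - B) * (1 + \<bar>e\<bar>)"
proof -
  have b: "b \<ge> 0" using assms(2) norm_ge_zero order_trans by blast
  have R0: "R \<ge> 0" "R \<ge> 1" using R(1) by auto
  have h: "\<bar>hC A u - hC B u\<bar> \<le> R * norm (A - B)" using hC_lipschitz[of A u B] assms(1) by simp
  have hA: "\<bar>hC D u\<bar> \<le> R * b" if "norm D \<le> b" for D
    using hC_le[of D u] assms(1) mult_left_mono[OF that R0(1)] by simp
  have K: "\<bar>hK u\<bar> \<le> R" using hK_le[of u] assms(1) by simp
  have "\<bar>hC A u + hC B u - 2 * hK u - 2 * e\<bar> \<le> 2 * R * b + 2 * R + 2 * \<bar>e\<bar>"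
    using hA[OF assms(2)] hA[OF assms(3)] K by (simp add: abs_le_iff; linarith)
  also have "\<dots> \<le> 2 * R * (b + 1) * (1 + \<bar>e\<bar>)"
  proof -
    have "1 * 1 * \<bar>e\<bar> \<le> R * (b + 1) * \<bar>e\<bar>" using R0 b by (intro mult_right_mono mult_mono) auto
    then show ?thesis by (simp add: algebra_simps)
  qed
  finally have s: "\<bar>hC A u + hC B u - 2 * hK u - 2 * e\<bar> \<le> 2 * R * (b + 1) * (1 + \<bar>e\<bar>)" .
  have "loss A (u, e) - loss B (u, e) = (hC A u - hC B u) * (hC A u + hC B u - 2 * hK u - 2 * e)"
    by (simp add: loss_def power2_eq_square algebra_simps)
  then have "\<bar>loss A (u, e) - loss B (u, e)\<bar> = \<bar>hC A u - hC B u\<bar> * \<bar>hC A u + hC B u - 2 * hK u - 2 * e\<bar>"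
    by (simp only: abs_mult)
  also have "\<dots> \<le> (R * norm (A - B)) * (2 * R * (b + 1) * (1 + \<bar>e\<bar>))"
    using h s R0 by (intro mult_mono) auto
  also have "\<dots> = Lip b * norm (A - B) * (1 + \<bar>e\<bar>)" by (simp add: Lip_def power2_eq_square algebra_simps)
  finally show ?thesis .
qed

lemma
  shows loss_diff_integrable: "integrable (sphere_uniform \<Otimes>\<^sub>M \<nu>) (\<lambda>z. loss A z - loss B z)"
    and loss_diff_section: "integrable sphere_uniform (\<lambda>u. loss A (u, e) - loss B (u, e))"
      "(\<integral>u. loss A (u, e) - loss B (u, e) \<partial>sphere_uniform) =
        (\<integral>z. loss A z - loss B z \<partial>(sphere_uniform \<Otimes>\<^sub>M \<nu>)) + e * (- 2 * (\<integral>u. hC A u - hC B u \<partial>sphere_uniform))"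
proof -
  define a where "a u = (hC A u)\<^sup>2 - (hC B u)\<^sup>2 - 2 * hK u * (hC A u - hC B u)" for u
  define b where "b u = - 2 * (hC A u - hC B u)" for u
  have am[measurable]: "a \<in> borel_measurable borel" unfolding a_def by measurable
  have bm[measurable]: "b \<in> borel_measurable borel" unfolding b_def by measurable
  have intb: "integrable sphere_uniform b"
  proof (rule sphere_integrable[OF bm])
    fix u :: "real ^ 'd" assume "norm u = 1"
    then show "\<bar>b u\<bar> \<le> 2 * (R * norm (A - B))"
      using hC_lipschitz[of A u B] by (simp only: b_def abs_mult) simp
  qed
  have inta: "integrable sphere_uniform a"
  proof (rule sphere_integrable[OF am])
    fix u :: "real ^ 'd" assume u: "norm u = 1"
    have "a u = loss A (u, 0) - loss B (u, 0)" unfolding loss_diff a_def by simp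
    then show "\<bar>a u\<bar> \<le> Lip (max (norm A) (norm B)) * norm (A - B)"
      using loss_lipschitz[OF u, of A "max (norm A) (norm B)" B 0] by simp
  qed
  have eq: "loss A (u, e) - loss B (u, e) = a u + e * b u" for u e
    unfolding loss_diff a_def b_def ..
  have eq': "(\<lambda>z. loss A z - loss B z) = (\<lambda>(u, e). a u + e * b u)"
    using eq by (auto simp: fun_eq_iff)
  note aff = affine_in_noise[of a b, OF _ _ inta intb]
  show "integrable (sphere_uniform \<Otimes>\<^sub>M \<nu>) (\<lambda>z. loss A z - loss B z)"
    unfolding eq' by (rule aff) simp_all
  show "integrable sphere_uniform (\<lambda>u. loss A (u, e) - loss B (u, e))"
    unfolding eq by (rule aff) simp_all
  have "(\<integral>u. b u \<partial>sphere_uniform) = - 2 * (\<integral>u. hC A u - hC B u \<partial>sphere_uniform)"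
    unfolding b_def by (rule integral_mult_right_zero)
  then show "(\<integral>u. loss A (u, e) - loss B (u, e) \<partial>sphere_uniform) =
        (\<integral>z. loss A z - loss B z \<partial>(sphere_uniform \<Otimes>\<^sub>M \<nu>)) + e * (- 2 * (\<integral>u. hC A u - hC B u \<partial>sphere_uniform))"
    unfolding eq eq' using aff(2,4) by simp
qed

end

text \<open>In the open unit ball the truncation of level 0 is the center, so chaining from level 0
  compares every parameter with the center. Boundary points such as basis vectors are fixed by it,
  whence the strict inequality.\<close>

lemma dyadic_trunc_0_eq_0:
  fixes x :: "'b::euclidean_space"
  assumes "norm x < 1" shows "dyadic_trunc 0 x = 0"
proof (rule euclidean_eqI)
  fix b :: 'b assume b: "b \<in> Basis"
  have "\<bar>x \<bullet> b\<bar> < 1" using Basis_le_norm[OF b, of x] assms by simp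
  then have "\<lfloor>\<bar>x \<bullet> b\<bar>\<rfloor> = 0" by (simp add: floor_eq_iff)
  then show "dyadic_trunc 0 x \<bullet> b = 0 \<bullet> b" using b by (simp add: dyadic_trunc_inner)
qed

context regression_sample begin

lemma empirical_process_uniform_bound:
  fixes K L :: real
  assumes K: "K > 0" and L: "L > 0"
  shows "\<exists>C\<ge>0. \<forall>n\<ge>1. \<forall>(f :: 'b::euclidean_space \<Rightarrow> 'u \<times> real \<Rightarrow> real) \<beta> l. lipschitz_family L f \<beta> \<longrightarrow> l > 0 \<longrightarrow>
    (\<exists>E\<in>events. prob E \<le> C * (1 / l) ^ (4 * DIM('b) + 2) \<and>
      (\<forall>\<omega>\<in>regular_event n K - E. \<forall>\<theta>. norm \<theta> < 1 \<longrightarrow>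
        \<bar>empirical_process n (f \<theta>) \<omega> - empirical_process n (f 0) \<omega>\<bar> \<le> 2 * l + K * L * DIM('b)))"
proof -
  obtain C where C: "C \<ge> 0" "\<And>n (f :: 'b \<Rightarrow> 'u \<times> real \<Rightarrow> real) \<beta> l k. n \<ge> 1 \<Longrightarrow> lipschitz_family L f \<beta> \<Longrightarrow> l > 0 \<Longrightarrow>
    \<exists>E\<in>events. prob E \<le> C * (1 / l) ^ (4 * DIM('b) + 2) * (1 / 2) ^ k \<and>
      (\<forall>\<omega>\<in>regular_event n K - E. \<forall>\<theta>\<in>cball 0 1.
        \<bar>empirical_process n (f \<theta>) \<omega> - empirical_process n (f (dyadic_trunc k \<theta>)) \<omega>\<bar>
          \<le> (2 * l + K * L * DIM('b)) / 2 ^ k)"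
    using empirical_process_modulus[OF K L, where 'b = 'b] by blast
  have "\<exists>E\<in>events. prob E \<le> C * (1 / l) ^ (4 * DIM('b) + 2) \<and>
      (\<forall>\<omega>\<in>regular_event n K - E. \<forall>\<theta>. norm \<theta> < 1 \<longrightarrow>
        \<bar>empirical_process n (f \<theta>) \<omega> - empirical_process n (f 0) \<omega>\<bar> \<le> 2 * l + K * L * DIM('b))"
    if n: "n \<ge> 1" "lipschitz_family L f \<beta>" "l > 0" for n l \<beta> and f :: "'b \<Rightarrow> 'u \<times> real \<Rightarrow> real"
  proof -
    obtain E where E: "E \<in> events" "prob E \<le> C * (1 / l) ^ (4 * DIM('b) + 2) * (1 / 2) ^ 0"
      "\<And>\<omega> \<theta>. \<omega> \<in> regular_event n K - E \<Longrightarrow> \<theta> \<in> cball 0 1 \<Longrightarrow>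
        \<bar>empirical_process n (f \<theta>) \<omega> - empirical_process n (f (dyadic_trunc 0 \<theta>)) \<omega>\<bar>
          \<le> (2 * l + K * L * DIM('b)) / 2 ^ 0"
      using C(2)[OF n, of 0] by blast
    have "\<bar>empirical_process n (f \<theta>) \<omega> - empirical_process n (f 0) \<omega>\<bar> \<le> 2 * l + K * L * DIM('b)"
      if "\<omega> \<in> regular_event n K - E" "norm \<theta> < 1" for \<omega> \<theta>
      using E(3)[OF that(1), of \<theta>] that(2) by (simp add: dyadic_trunc_0_eq_0)
    then show ?thesis using E(1,2) by (intro bexI[of _ E]) auto
  qed
  then show ?thesis using C(1) by blast
qed

end

section \<open>Rescaled losses as Lipschitz families; the risk\<close>

context shape_regression begin

lemma hC_param_continuous: "continuous_on X (\<lambda>A. hC A u)"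
proof -
  have "(R * norm u)-lipschitz_on X (\<lambda>A. hC A u)"
    using hC_lipschitz[of _ u] R(1) by (auto simp: lipschitz_on_def dist_norm mult_ac)
  then show ?thesis by (rule lipschitz_on_continuous_on)
qed

lemma loss_param_continuous: "continuous_on X (\<lambda>A. loss A z)"
  unfolding loss_def by (cases z) (auto intro!: continuous_intros hC_param_continuous)

lemma hC_diff_integrable: "integrable sphere_uniform (\<lambda>u. hC A u - hC B u)"
proof (rule sphere_integrable)
  show "\<bar>hC A u - hC B u\<bar> \<le> R * norm (A - B)" if "norm u = 1" for u
    using hC_lipschitz[of A u B] that by simp
qed measurable

lemma hC_diff_integral_le: "\<bar>\<integral>u. hC A u - hC B u \<partial>sphere_uniform\<bar> \<le> R * norm (A - B)"
proof -
  have "\<bar>\<integral>u. hC A u - hC B u \<partial>sphere_uniform\<bar> \<le> (\<integral>u. \<bar>hC A u - hC B u\<bar> \<partial>sphere_uniform)"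
    by (rule integral_abs_bound)
  also have "\<dots> \<le> (\<integral>u. R * norm (A - B) \<partial>(sphere_uniform :: (real ^ 'd) measure))"
  proof (rule integral_mono_AE)
    show "AE u in sphere_uniform. \<bar>hC A u - hC B u\<bar> \<le> R * norm (A - B)"
      using AE_sphere
    proof eventually_elim
      case (elim u)
      then show ?case using hC_lipschitz[of A u B] by simp
    qed
  qed (use hC_diff_integrable in auto)
  finally show ?thesis using S.prob_space by simp
qed

text \<open>Dividing the increments on a ball of radius \<rho> by \<rho> gives a family on the unit
  ball whose Lipschitz constant does not depend on \<rho>, as long as the ball stays within norm
  \<open>b\<close>. This lets one uniform bound serve large balls, shells and shrinking
  neighbourhoods alike.\<close>

lemma loss_family:
  assumes \<rho>: "\<rho> > 0" and b: "norm A0 + \<rho> \<le> b"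
  shows "lipschitz_family (Lip b) (\<lambda>a z. (loss (A0 + \<rho> *\<^sub>R a) z - loss A0 z) / \<rho>)
    (\<lambda>a. - 2 * (\<integral>u. hC (A0 + \<rho> *\<^sub>R a) u - hC A0 u \<partial>sphere_uniform) / \<rho>)"
  unfolding lipschitz_family_def
proof (intro conjI allI impI)
  have b0: "b \<ge> 0" using assms norm_ge_zero[of A0] by linarith
  have nb: "norm (A0 + \<rho> *\<^sub>R a) \<le> b" if "norm a \<le> 1" for a
  proof -
    have "norm (A0 + \<rho> *\<^sub>R a) \<le> norm A0 + \<rho> * norm a" using norm_triangle_ineq[of A0 "\<rho> *\<^sub>R a"] \<rho> by simp
    also have "\<dots> \<le> norm A0 + \<rho> * 1" using \<rho> that by (intro add_left_mono mult_left_mono) auto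
    finally show ?thesis using b by simp
  qed
  show "(\<lambda>z. (loss (A0 + \<rho> *\<^sub>R a) z - loss A0 z) / \<rho>) \<in> borel_measurable (sphere_uniform \<Otimes>\<^sub>M \<nu>)" for a
    by measurable
  show "integrable sphere_uniform (\<lambda>u. (loss (A0 + \<rho> *\<^sub>R a) (u, e) - loss A0 (u, e)) / \<rho>)" for a e
    using loss_diff_section(1) by (intro integrable_divide_zero) auto
  show "(\<integral>u. (loss (A0 + \<rho> *\<^sub>R a) (u, e) - loss A0 (u, e)) / \<rho> \<partial>sphere_uniform) =
      (\<integral>z. (loss (A0 + \<rho> *\<^sub>R a) z - loss A0 z) / \<rho> \<partial>(sphere_uniform \<Otimes>\<^sub>M \<nu>)) +
      e * (- 2 * (\<integral>u. hC (A0 + \<rho> *\<^sub>R a) u - hC A0 u \<partial>sphere_uniform) / \<rho>)" for a e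
    unfolding integral_divide_zero loss_diff_section(2) by (simp add: add_divide_distrib diff_divide_distrib)
  show "integrable (sphere_uniform \<Otimes>\<^sub>M \<nu>) (\<lambda>z. (loss (A0 + \<rho> *\<^sub>R a) z - loss A0 z) / \<rho>)" for a
    using loss_diff_integrable by (intro integrable_divide_zero) auto
  show "AE u in sphere_uniform. \<bar>(loss (A0 + \<rho> *\<^sub>R a) (u, e) - loss A0 (u, e)) / \<rho> - (loss (A0 + \<rho> *\<^sub>R a') (u, e) - loss A0 (u, e)) / \<rho>\<bar>
      \<le> Lip b * norm (a - a') * (1 + \<bar>e\<bar>)" if aa: "norm a \<le> 1" "norm a' \<le> 1" for a a' e
    using AE_sphere
  proof eventually_elim
    case (elim u)
    have "\<bar>loss (A0 + \<rho> *\<^sub>R a) (u, e) - loss (A0 + \<rho> *\<^sub>R a') (u, e)\<bar>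
      \<le> Lip b * norm (A0 + \<rho> *\<^sub>R a - (A0 + \<rho> *\<^sub>R a')) * (1 + \<bar>e\<bar>)"
      by (rule loss_lipschitz[OF elim nb[OF aa(1)] nb[OF aa(2)]])
    also have "norm (A0 + \<rho> *\<^sub>R a - (A0 + \<rho> *\<^sub>R a')) = \<rho> * norm (a - a')"
      using \<rho> by (simp flip: scaleR_diff_right)
    finally have "\<bar>loss (A0 + \<rho> *\<^sub>R a) (u, e) - loss (A0 + \<rho> *\<^sub>R a') (u, e)\<bar> \<le> (Lip b * norm (a - a') * (1 + \<bar>e\<bar>)) * \<rho>"
      by (simp add: mult_ac)
    then have "\<bar>loss (A0 + \<rho> *\<^sub>R a) (u, e) - loss (A0 + \<rho> *\<^sub>R a') (u, e)\<bar> / \<rho> \<le> Lip b * norm (a - a') * (1 + \<bar>e\<bar>)"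
      using \<rho> by (simp only: pos_divide_le_eq)
    moreover have "(loss (A0 + \<rho> *\<^sub>R a) (u, e) - loss A0 (u, e)) / \<rho> - (loss (A0 + \<rho> *\<^sub>R a') (u, e) - loss A0 (u, e)) / \<rho>
      = (loss (A0 + \<rho> *\<^sub>R a) (u, e) - loss (A0 + \<rho> *\<^sub>R a') (u, e)) / \<rho>"
      by (simp add: diff_divide_distrib)
    ultimately show ?case using \<rho> by (simp only: abs_divide abs_of_pos)
  qed
  show "\<bar>- 2 * (\<integral>u. hC (A0 + \<rho> *\<^sub>R a) u - hC A0 u \<partial>sphere_uniform) / \<rho> -
      - 2 * (\<integral>u. hC (A0 + \<rho> *\<^sub>R a') u - hC A0 u \<partial>sphere_uniform) / \<rho>\<bar> \<le> Lip b * norm (a - a')" for a a'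
  proof -
    have "(\<integral>u. hC (A0 + \<rho> *\<^sub>R a) u - hC A0 u \<partial>sphere_uniform) - (\<integral>u. hC (A0 + \<rho> *\<^sub>R a') u - hC A0 u \<partial>sphere_uniform)
      = (\<integral>u. hC (A0 + \<rho> *\<^sub>R a) u - hC (A0 + \<rho> *\<^sub>R a') u \<partial>sphere_uniform)"
      by (subst Bochner_Integration.integral_diff[symmetric]) (auto intro: hC_diff_integrable)
    also have "\<bar>\<dots>\<bar> \<le> R * norm (A0 + \<rho> *\<^sub>R a - (A0 + \<rho> *\<^sub>R a'))" by (rule hC_diff_integral_le)
    also have "norm (A0 + \<rho> *\<^sub>R a - (A0 + \<rho> *\<^sub>R a')) = \<rho> * norm (a - a')"
      using \<rho> by (simp flip: scaleR_diff_right)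
    finally have le: "\<bar>(\<integral>u. hC (A0 + \<rho> *\<^sub>R a) u - hC A0 u \<partial>sphere_uniform)
      - (\<integral>u. hC (A0 + \<rho> *\<^sub>R a') u - hC A0 u \<partial>sphere_uniform)\<bar> \<le> R * (\<rho> * norm (a - a'))" .
    have arith: "\<bar>- 2 * x / \<rho> - - 2 * y / \<rho>\<bar> \<le> 2 * (R * d)" if "\<bar>x - y\<bar> \<le> R * (\<rho> * d)" for x y d
    proof -
      have "- 2 * x / \<rho> - - 2 * y / \<rho> = (- 2 / \<rho>) * (x - y)" by (simp add: right_diff_distrib diff_divide_distrib)
      then have "\<bar>- 2 * x / \<rho> - - 2 * y / \<rho>\<bar> = (2 / \<rho>) * \<bar>x - y\<bar>" using \<rho> by (simp only: abs_mult) simp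
      also have "\<dots> \<le> (2 / \<rho>) * (R * (\<rho> * d))" using that \<rho> by (intro mult_left_mono) auto
      finally show ?thesis using \<rho> by simp
    qed
    have "2 * R * 1 \<le> 2 * R * (R * (b + 1))"
    proof -
      have "1 * 1 \<le> R * (b + 1)" using R(1) b0 by (intro mult_mono) auto
      then show ?thesis using R(1) by (intro mult_left_mono) auto
    qed
    then have "2 * R \<le> Lip b" by (simp add: Lip_def power2_eq_square mult.assoc)
    then have "2 * (R * norm (a - a')) \<le> Lip b * norm (a - a')"
      unfolding mult.assoc[symmetric] by (intro mult_right_mono) auto
    then show ?thesis using arith[OF le] by linarith
  qed
  show "continuous_on (cball 0 1) (\<lambda>a. (loss (A0 + \<rho> *\<^sub>R a) z - loss A0 z) / \<rho>)" for z
    using \<rho> by (intro continuous_intros continuous_on_compose2[OF loss_param_continuous]) auto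
qed

text \<open>The quadratic part of the loss as a function of the direction. It bounds the empirical
  second moment of \<open>hC\<close> from below for all directions at once. It does not involve the
  noise, so its slope is 0.\<close>

lemma square_family: "lipschitz_family (Lip 1) (\<lambda>A z. (hC A (fst z))\<^sup>2) (\<lambda>_. 0)"
  unfolding lipschitz_family_def
proof (intro conjI allI impI)
  have sq_int: "integrable sphere_uniform (\<lambda>u. (hC A u)\<^sup>2)" for A
  proof (rule sphere_integrable)
    show "\<bar>(hC A u)\<^sup>2\<bar> \<le> (R * norm A)\<^sup>2" if "norm u = 1" for u
      using hC_le[of A u] that R(1) by (auto simp: abs_le_square_iff[symmetric])
  qed measurable
  have aff: "integrable (sphere_uniform \<Otimes>\<^sub>M \<nu>) (\<lambda>(u, e). (hC A u)\<^sup>2)"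
    "(\<integral>z. (case z of (u, e) \<Rightarrow> (hC A u)\<^sup>2) \<partial>(sphere_uniform \<Otimes>\<^sub>M \<nu>)) = (\<integral>u. (hC A u)\<^sup>2 \<partial>sphere_uniform)" for A
    using affine_in_noise(1,2)[of "\<lambda>u. (hC A u)\<^sup>2" "\<lambda>_. 0"] sq_int[of A] by simp_all
  have eq: "(\<lambda>z. (hC A (fst z))\<^sup>2) = (\<lambda>(u, e). (hC A u)\<^sup>2)" for A by auto
  show "(\<lambda>z. (hC A (fst z))\<^sup>2) \<in> borel_measurable (sphere_uniform \<Otimes>\<^sub>M \<nu>)" for A by measurable
  show "integrable sphere_uniform (\<lambda>u. (hC A (fst (u, e)))\<^sup>2)" for A and e :: real using sq_int by simp
  show "integrable (sphere_uniform \<Otimes>\<^sub>M \<nu>) (\<lambda>z. (hC A (fst z))\<^sup>2)" for A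
    unfolding eq by (rule aff)
  show "(\<integral>u. (hC A (fst (u, e)))\<^sup>2 \<partial>sphere_uniform) = (\<integral>z. (hC A (fst z))\<^sup>2 \<partial>(sphere_uniform \<Otimes>\<^sub>M \<nu>)) + e * 0" for A e
    unfolding eq by (subst aff(2)) simp_all
  show "AE u in sphere_uniform. \<bar>(hC A (fst (u, e)))\<^sup>2 - (hC B (fst (u, e)))\<^sup>2\<bar> \<le> Lip 1 * norm (A - B) * (1 + \<bar>e\<bar>)"
    if ab: "norm A \<le> 1" "norm B \<le> 1" for A B e
    using AE_sphere
  proof eventually_elim
    case (elim u)
    have R0: "R \<ge> 0" using R(1) by simp
    have h: "\<bar>hC A u - hC B u\<bar> \<le> R * norm (A - B)" using hC_lipschitz[of A u B] elim by simp
    have "\<bar>hC A u\<bar> \<le> R * 1" "\<bar>hC B u\<bar> \<le> R * 1"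
      using hC_le[of A u] hC_le[of B u] elim mult_left_mono[OF ab(1) R0] mult_left_mono[OF ab(2) R0] by simp_all
    then have s: "\<bar>hC A u + hC B u\<bar> \<le> 2 * R" by linarith
    have "(hC A u)\<^sup>2 - (hC B u)\<^sup>2 = (hC A u - hC B u) * (hC A u + hC B u)"
      by (simp add: power2_eq_square algebra_simps)
    then have "\<bar>(hC A u)\<^sup>2 - (hC B u)\<^sup>2\<bar> = \<bar>hC A u - hC B u\<bar> * \<bar>hC A u + hC B u\<bar>" by (simp only: abs_mult)
    also have "\<dots> \<le> (R * norm (A - B)) * (2 * R)" using h s R0 by (intro mult_mono) auto
    also have "\<dots> \<le> Lip 1 * norm (A - B)" using R0 by (simp add: Lip_def power2_eq_square)
    also have "\<dots> * 1 \<le> Lip 1 * norm (A - B) * (1 + \<bar>e\<bar>)"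
      using Lip_pos[of 1] by (intro mult_left_mono) auto
    finally show ?case by simp
  qed
  show "\<bar>0 - 0\<bar> \<le> Lip 1 * norm (A - B)" for A B :: "real ^ 'q ^ 'd" using Lip_pos[of 1] by simp
  show "continuous_on (cball 0 1) (\<lambda>A. (hC A (fst z))\<^sup>2)" for z :: "(real ^ 'd) \<times> real"
    by (intro continuous_intros hC_param_continuous)
qed

lemma loss_integrable: "integrable (sphere_uniform \<Otimes>\<^sub>M \<nu>) (loss A)"
proof -
  have "integrable (sphere_uniform \<Otimes>\<^sub>M \<nu>) (loss 0)"
  proof (rule Bochner_Integration.integrable_bound)
    show "integrable (sphere_uniform \<Otimes>\<^sub>M \<nu>) (\<lambda>z :: (real ^ 'd) \<times> real. 2 * R\<^sup>2 + 2 * (snd z)\<^sup>2)"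
      using integral_noise(2)[of "\<lambda>e. e\<^sup>2"] noise_second
      by (intro Bochner_Integration.integrable_add integrable_mult_right P.integrable_const) simp_all
    show "AE z in sphere_uniform \<Otimes>\<^sub>M \<nu>. norm (loss 0 z) \<le> norm (2 * R\<^sup>2 + 2 * (snd z)\<^sup>2)"
      using AE_sphere_pair
    proof eventually_elim
      case (elim z)
      obtain u e where z: "z = (u, e)" by (cases z)
      have "\<bar>hK u\<bar> \<le> \<bar>R\<bar>" using hK_le[of u] elim z R(1) by simp
      then have "(hK u)\<^sup>2 \<le> R\<^sup>2" by (simp only: abs_le_square_iff)
      moreover have "(- hK u - e)\<^sup>2 \<le> 2 * (hK u)\<^sup>2 + 2 * e\<^sup>2"
        using zero_le_power2[of "hK u - e"] by (simp add: power2_eq_square algebra_simps)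
      ultimately show ?case by (simp add: loss_def z hC_0)
    qed
  qed measurable
  then have "integrable (sphere_uniform \<Otimes>\<^sub>M \<nu>) (\<lambda>z. (loss A z - loss 0 z) + loss 0 z)"
    using loss_diff_integrable by (intro Bochner_Integration.integrable_add)
  then show ?thesis by simp
qed

definition \<Phi> :: "real ^ 'q ^ 'd \<Rightarrow> real" where "\<Phi> A = (\<integral>z. loss A z \<partial>(sphere_uniform \<Otimes>\<^sub>M \<nu>))"

lemma \<Phi>_diff: "(\<integral>z. loss A z - loss B z \<partial>(sphere_uniform \<Otimes>\<^sub>M \<nu>)) = \<Phi> A - \<Phi> B"
  using loss_integrable by (simp add: \<Phi>_def)

lemma risk_\<Phi>: "risk C A (regression_law Kstar \<nu>) = \<Phi> A"
  by (simp add: risk_eq \<Phi>_def)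

lemma loss_sum_diff:
  assumes "n \<ge> 1"
  shows "(\<Sum>i<n. loss A (\<zeta> i \<omega>)) - (\<Sum>i<n. loss B (\<zeta> i \<omega>)) =
    sqrt n * empirical_process n (\<lambda>z. loss A z - loss B z) \<omega> + n * (\<Phi> A - \<Phi> B)"
  using assms by (simp add: empirical_process_def \<Phi>_diff sum_subtractf)

lemma empirical_process_scaled:
  "empirical_process n (\<lambda>z. f z / \<rho>) \<omega> = empirical_process n f \<omega> / \<rho>"
  by (simp add: empirical_process_def diff_divide_distrib sum_divide_distrib[symmetric] mult.commute)

lemma continuous_\<Phi>: "continuous_on UNIV \<Phi>"
proof -
  have "continuous_on (ball A0 1) \<Phi>" for A0
  proof -
    have "continuous_on (cball 0 1) (\<lambda>a. \<integral>z. (loss (A0 + 1 *\<^sub>R a) z - loss A0 z) / 1 \<partial>(sphere_uniform \<Otimes>\<^sub>M \<nu>))"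
      by (rule lipschitz_family_integral_continuous[OF loss_family Lip_pos]) auto
    then have "continuous_on (cball 0 1) (\<lambda>a. \<Phi> (A0 + a) - \<Phi> A0)" by (simp add: \<Phi>_diff)
    then have "continuous_on (cball 0 1) (\<lambda>a. (\<Phi> (A0 + a) - \<Phi> A0) + \<Phi> A0)"
      by (intro continuous_on_add continuous_on_const)
    then have cont: "continuous_on (cball 0 1) (\<lambda>a. \<Phi> (A0 + a))" by simp
    have "continuous_on (ball A0 1) (\<lambda>A. \<Phi> (A0 + (A - A0)))"
      by (rule continuous_on_compose2[OF cont, of _ "\<lambda>A. A - A0"])
        (auto intro!: continuous_intros simp: dist_norm norm_minus_commute)
    then show ?thesis by simp
  qed
  then have "isCont \<Phi> A0" for A0
    using continuous_on_eq_continuous_at[OF open_ball, of A0 1 \<Phi>] by simp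
  then show ?thesis by (simp add: continuous_at_imp_continuous_on)
qed

end


section \<open>Consistency\<close>

lemma power_tail_small:
  fixes c d :: real
  assumes "d > 0" shows "\<exists>l>0. c * (1 / l) ^ Suc m \<le> d"
proof -
  have "((\<lambda>l. c * (1 / l) ^ Suc m) \<longlongrightarrow> c * 0 ^ Suc m) at_top"
    by (intro tendsto_intros tendsto_divide_0[OF tendsto_const] filterlim_at_top_imp_at_infinity filterlim_ident)
  then have "\<forall>\<^sub>F l in at_top. c * (1 / l) ^ Suc m < d"
    using assms by (intro order_tendstoD(2)[of _ 0]) simp_all
  then have "\<forall>\<^sub>F l in at_top. l > 0 \<and> c * (1 / l) ^ Suc m < d"
    using eventually_gt_at_top by (rule eventually_conj[rotated])
  from eventually_happens'[OF trivial_limit_at_top_linorder this] show ?thesis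
    by (auto intro: less_imp_le)
qed

text \<open>\<open>At\<close> is the aligned estimator. Alignment is expressed by moving
  \<open>Ahat\<close> along its orbit while \<open>At\<close> stays fixed; this agrees with moving
  the estimator because automorphisms act by Frobenius isometries.\<close>

locale shape_estimator = shape_regression M Kstar C \<nu> Z
  for M :: "'w measure" and Kstar :: "(real ^ 'd) set" and C :: "(real ^ 'q) set" and \<nu> Z +
  fixes Ahat :: "real ^ 'q ^ 'd" and At :: "nat \<Rightarrow> 'w \<Rightarrow> real ^ 'q ^ 'd"
  assumes Aut_C: "Aut C \<subseteq> {g. orthogonal_matrix g}"
    and minimizers: "risk_minimizers C (regression_law Kstar \<nu>) = orbit Ahat C"
    and At_measurable: "\<And>n. n \<ge> 1 \<Longrightarrow> At n \<in> borel_measurable M"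
    and At_min: "\<And>n \<omega> B. n \<ge> 1 \<Longrightarrow> \<omega> \<in> space M \<Longrightarrow>
      (\<Sum>i<n. loss (At n \<omega>) (\<zeta> i \<omega>)) \<le> (\<Sum>i<n. loss B (\<zeta> i \<omega>))"
    and At_close: "\<And>n \<omega> g. n \<ge> 1 \<Longrightarrow> \<omega> \<in> space M \<Longrightarrow> g \<in> Aut C \<Longrightarrow>
      norm (Ahat - At n \<omega>) \<le> norm (Ahat ** g - At n \<omega>)"
begin

lemma minimizer_iff: "A \<in> orbit Ahat C \<longleftrightarrow> (\<forall>B. \<Phi> A \<le> \<Phi> B)"
  unfolding minimizers[symmetric] risk_minimizers_def argmin_set_def is_arg_min_def risk_\<Phi>
  by (auto simp: not_less)

lemma Ahat_in_orbit: "Ahat \<in> orbit Ahat C"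
  unfolding orbit_def using Aut_subgroup(1)[OF Aut_C] by (force intro!: image_eqI[of _ _ "mat 1"])

lemma \<Phi>_min: "\<Phi> Ahat \<le> \<Phi> A"
  using Ahat_in_orbit minimizer_iff by blast

lemma orbit_norm: "A \<in> orbit Ahat C \<Longrightarrow> norm A = norm Ahat"
  using Aut_C by (auto simp: orbit_def norm_matrix_mult_orthogonal)

text \<open>
  If \<open>hC A\<close> vanished almost everywhere for some \<open>A \<noteq> 0\<close>, the loss would be constant along the
  unbounded ray from \<open>Ahat\<close> in the direction \<open>A\<close>, whereas the set of minimizers is bounded.
\<close>

lemma hC_nontrivial:
  assumes A: "A \<noteq> 0"
  shows "\<not> (AE u in sphere_uniform. hC A u = 0)"
proof
  assume ae: "AE u in sphere_uniform. hC A u = 0"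
  \<comment> \<open>Bounding the increment along \<open>A\<close> from both sides by subadditivity
    involves \<open>hC A\<close> and \<open>hC (- A)\<close>; reflection invariance makes the second
    vanish almost everywhere too.\<close>
  then have "AE u in distr (sphere_uniform :: (real ^ 'd) measure) borel uminus. hC A u = 0"
    by (simp only: sphere_uniform_uminus)
  then have ae': "AE u in (sphere_uniform :: (real ^ 'd) measure). hC A (- u) = 0"
    by (subst (asm) AE_distr_iff) measurable
  \<comment> \<open>With this \<open>t\<close> the shift has norm
    \<open>2 * norm Ahat + norm A\<close>, which leads out of the sphere through \<open>Ahat\<close>
    that contains all minimizers.\<close>
  define t where "t = 2 * norm Ahat / norm A + 1"
  have t: "t > 0" using A by (simp add: t_def add_nonneg_pos)
  have "AE u in (sphere_uniform :: (real ^ 'd) measure). hC (Ahat + t *\<^sub>R A) u = hC Ahat u"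
    using ae ae'
  proof eventually_elim
    case (elim u)
    have "hC (Ahat + t *\<^sub>R A) u \<le> hC Ahat u + t * hC A u"
      using hC_add_le[of Ahat "t *\<^sub>R A" u] hC_scaleR[of t A u] t by simp
    moreover have "hC Ahat u \<le> hC (Ahat + t *\<^sub>R A) u + t * hC (- A) u"
      using hC_add_le[of "Ahat + t *\<^sub>R A" "t *\<^sub>R (- A)" u] hC_scaleR[of t "- A" u] t by simp
    ultimately show ?case using elim by (simp add: hC_uminus)
  qed
  then have "AE z in (sphere_uniform :: (real ^ 'd) measure) \<Otimes>\<^sub>M \<nu>. hC (Ahat + t *\<^sub>R A) (fst z) = hC Ahat (fst z)"
  proof (intro P.AE_pair_measure)
    show "{z \<in> space ((sphere_uniform :: (real ^ 'd) measure) \<Otimes>\<^sub>M \<nu>). hC (Ahat + t *\<^sub>R A) (fst z) = hC Ahat (fst z)}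
      \<in> sets (sphere_uniform \<Otimes>\<^sub>M \<nu>)"
      by measurable
  qed (auto elim: eventually_mono)
  then have "AE z in sphere_uniform \<Otimes>\<^sub>M \<nu>. loss (Ahat + t *\<^sub>R A) z = loss Ahat z"
    by eventually_elim (auto simp: loss_def split: prod.splits)
  then have "\<Phi> (Ahat + t *\<^sub>R A) = \<Phi> Ahat"
    unfolding \<Phi>_def by (intro integral_cong_AE) measurable
  then have "norm (Ahat + t *\<^sub>R A) = norm Ahat"
    using minimizer_iff \<Phi>_min by (intro orbit_norm) simp
  moreover have "t * norm A \<le> norm (Ahat + t *\<^sub>R A) + norm Ahat"
    using norm_triangle_ineq4[of "Ahat + t *\<^sub>R A" Ahat] t by simp
  moreover have "t * norm A = 2 * norm Ahat + norm A"
    using A by (simp add: t_def field_simps)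
  ultimately show False using A by simp
qed

definition sq_mean :: "real ^ 'q ^ 'd \<Rightarrow> real" where
  "sq_mean A = (\<integral>z. (hC A (fst z))\<^sup>2 \<partial>(sphere_uniform \<Otimes>\<^sub>M \<nu>))"

lemma sq_mean_lower_bound: "\<exists>c>0. \<forall>A. norm A = 1 \<longrightarrow> sq_mean A \<ge> c"
proof (cases "sphere (0 :: real ^ 'q ^ 'd) 1 = {}")
  case True
  then show ?thesis by (intro exI[of _ 1]) auto
next
  case False
  have "continuous_on (cball 0 1) sq_mean"
    unfolding sq_mean_def by (rule lipschitz_family_integral_continuous[OF square_family Lip_pos]) simp
  then have "continuous_on (sphere 0 1) sq_mean" by (rule continuous_on_subset) auto
  from continuous_attains_inf[OF compact_sphere False this]
  obtain A0 where A0: "norm A0 = 1" "\<And>A. norm A = 1 \<Longrightarrow> sq_mean A0 \<le> sq_mean A" by auto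
  have int: "integrable (sphere_uniform \<Otimes>\<^sub>M \<nu>) (\<lambda>z. (hC A0 (fst z))\<^sup>2)"
    using square_family A0(1) unfolding lipschitz_family_def by auto
  have "sq_mean A0 \<ge> 0" unfolding sq_mean_def by (rule integral_nonneg_AE) simp
  moreover have "sq_mean A0 \<noteq> 0"
  proof
    assume "sq_mean A0 = 0"
    then have "AE z in sphere_uniform \<Otimes>\<^sub>M \<nu>. (hC A0 (fst z))\<^sup>2 = 0"
      unfolding sq_mean_def by (subst (asm) integral_nonneg_eq_0_iff_AE[OF int]) auto
    then have "AE z in sphere_uniform \<Otimes>\<^sub>M \<nu>. hC A0 (fst z) = 0" by simp
    then have "AE u in sphere_uniform. AE e in \<nu>. hC A0 (fst (u, e)) = 0"
      by (rule P.AE_pair)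
    then have "AE u in sphere_uniform. hC A0 u = 0" by simp
    moreover have "A0 \<noteq> 0" using A0(1) by auto
    ultimately show False using hC_nontrivial by blast
  qed
  ultimately show ?thesis using A0(2) by (intro exI[of _ "sq_mean A0"]) auto
qed

lemma sphere_event: "\<exists>E\<in>events. prob E = 0 \<and> (\<forall>\<omega>\<in>space M - E. \<forall>i. norm (fst (\<zeta> i \<omega>)) = 1)"
proof -
  from AE_E[OF AE_all_sphere] obtain E where
    "{\<omega> \<in> space M. \<not> (\<forall>i. norm (fst (\<zeta> i \<omega>)) = 1)} \<subseteq> E" "emeasure M E = 0" "E \<in> events" by blast
  then show ?thesis by (intro bexI[of _ E]) (auto simp: measure_def)
qed

lemma regular_weight_sum:
  assumes "\<omega> \<in> regular_event n K"
  shows "(\<Sum>i<n. 1 + \<bar>snd (\<zeta> i \<omega>)\<bar>) \<le> K * n"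
proof -
  have "(\<Sum>i<n. 1 + \<bar>snd (\<zeta> i \<omega>)\<bar>) \<le> (\<Sum>i<n. (1 + \<bar>snd (\<zeta> i \<omega>)\<bar>)\<^sup>2)"
    by (intro sum_mono) (simp add: power2_eq_square distrib_right distrib_left)
  then show ?thesis using assms by (simp add: regular_event_def)
qed

lemma uniform_bound_likely:
  assumes "d > 0" "K > 0" "L > 0"
  shows "\<exists>B\<ge>0. \<forall>n\<ge>1. \<forall>(f :: real ^ 'q ^ 'd \<Rightarrow> (real ^ 'd) \<times> real \<Rightarrow> real) \<beta>. lipschitz_family L f \<beta> \<longrightarrow>
    (\<exists>E\<in>events. prob E \<le> d \<and> (\<forall>\<omega>\<in>regular_event n K - E. \<forall>\<theta>. norm \<theta> < 1 \<longrightarrow>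
        \<bar>empirical_process n (f \<theta>) \<omega> - empirical_process n (f 0) \<omega>\<bar> \<le> B))"
proof -
  let ?D = "DIM(real ^ 'q ^ 'd)"
  obtain C where C: "\<And>n (f :: real ^ 'q ^ 'd \<Rightarrow> (real ^ 'd) \<times> real \<Rightarrow> real) \<beta> l. n \<ge> 1 \<Longrightarrow> lipschitz_family L f \<beta> \<Longrightarrow> l > 0 \<Longrightarrow>
    (\<exists>E\<in>events. prob E \<le> C * (1 / l) ^ (4 * ?D + 2) \<and>
      (\<forall>\<omega>\<in>regular_event n K - E. \<forall>\<theta>. norm \<theta> < 1 \<longrightarrow>
        \<bar>empirical_process n (f \<theta>) \<omega> - empirical_process n (f 0) \<omega>\<bar> \<le> 2 * l + K * L * ?D))"
    using empirical_process_uniform_bound[OF assms(2,3), where 'b = "real ^ 'q ^ 'd"] by blast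
  obtain l where l: "l > 0" "C * (1 / l) ^ (4 * ?D + 2) \<le> d"
    using power_tail_small[OF assms(1), of C "4 * ?D + 1"] by auto
  have "\<exists>E\<in>events. prob E \<le> d \<and> (\<forall>\<omega>\<in>regular_event n K - E. \<forall>\<theta>. norm \<theta> < 1 \<longrightarrow>
        \<bar>empirical_process n (f \<theta>) \<omega> - empirical_process n (f 0) \<omega>\<bar> \<le> 2 * l + K * L * ?D)"
    if "n \<ge> 1" "lipschitz_family L f \<beta>" for n \<beta> and f :: "real ^ 'q ^ 'd \<Rightarrow> (real ^ 'd) \<times> real \<Rightarrow> real"
    using C[OF that l(1)] l(2) by (meson order_trans)
  moreover have "2 * l + K * L * ?D \<ge> 0" using l(1) assms by simp
  ultimately show ?thesis by blast
qed

text \<open>Comparison with the parameter 0. For a parameter of norm \<open>r\<close> the quadratic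
  part of the empirical loss is at least \<open>r\<^sup>2 * n * c / 2\<close> and the linear part is
  at most \<open>2 * R\<^sup>2 * r * K * n\<close> in absolute value, so a minimizer satisfies
  \<open>r \<le> 4 * R\<^sup>2 * K / c\<close>.\<close>

lemma At_bounded:
  assumes d: "d > 0" and K: "K > 0"
  shows "\<exists>b. \<exists>N\<ge>1. \<forall>n\<ge>N. \<exists>E\<in>events. prob E \<le> d \<and> (\<forall>\<omega>\<in>regular_event n K - E. norm (At n \<omega>) \<le> b)"
proof -
  obtain c where c: "c > 0" "\<And>A. norm A = 1 \<Longrightarrow> sq_mean A \<ge> c" using sq_mean_lower_bound by blast
  have L1: "Lip 1 > 0" by (simp add: Lip_pos)
  obtain B where B: "B \<ge> 0" "\<And>n (f :: real ^ 'q ^ 'd \<Rightarrow> (real ^ 'd) \<times> real \<Rightarrow> real) \<beta>. n \<ge> 1 \<Longrightarrow> lipschitz_family (Lip 1) f \<beta> \<Longrightarrow>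
    (\<exists>E\<in>events. prob E \<le> d \<and> (\<forall>\<omega>\<in>regular_event n K - E. \<forall>\<theta>. norm \<theta> < 1 \<longrightarrow>
        \<bar>empirical_process n (f \<theta>) \<omega> - empirical_process n (f 0) \<omega>\<bar> \<le> B))"
    using uniform_bound_likely[OF d K L1] by blast
  obtain E0 where E0: "E0 \<in> events" "prob E0 = 0" "\<And>\<omega> i. \<omega> \<in> space M - E0 \<Longrightarrow> norm (fst (\<zeta> i \<omega>)) = 1"
    using sphere_event by blast
  \<comment> \<open>From here on the fluctuation \<open>B / sqrt n\<close> is at most half of the
    lower bound \<open>c / 4\<close> for the mean of the squares.\<close>
  define N where "N = nat \<lceil>(8 * B / c)\<^sup>2\<rceil> + 1"
  have large: "B / sqrt n \<le> c / 8" if "n \<ge> N" for n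
  proof -
    have "(8 * B / c)\<^sup>2 \<le> n" using that by (simp add: N_def) linarith
    then have "8 * B / c \<le> sqrt n" by (rule real_le_rsqrt)
    moreover have "sqrt n > 0" using that by (simp add: N_def)
    ultimately show ?thesis using c(1) by (simp add: field_simps)
  qed
  have "\<exists>E\<in>events. prob E \<le> d \<and> (\<forall>\<omega>\<in>regular_event n K - E. norm (At n \<omega>) \<le> 4 * R\<^sup>2 * K / c)"
    if n: "n \<ge> N" for n
  proof -
    have n1: "n \<ge> 1" "real n > 0" "sqrt n > 0" using n by (auto simp: N_def)
    obtain E where E: "E \<in> events" "prob E \<le> d" "\<And>\<omega> \<theta>. \<omega> \<in> regular_event n K - E \<Longrightarrow> norm \<theta> < 1 \<Longrightarrow>
        \<bar>empirical_process n (\<lambda>z. (hC \<theta> (fst z))\<^sup>2) \<omega> - empirical_process n (\<lambda>z. (hC 0 (fst z))\<^sup>2) \<omega>\<bar> \<le> B"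
      using B(2)[OF n1(1) square_family] by blast
    have "norm (At n \<omega>) \<le> 4 * R\<^sup>2 * K / c" if \<omega>: "\<omega> \<in> regular_event n K - (E \<union> E0)" for \<omega>
    proof (rule ccontr)
      assume contr: "\<not> norm (At n \<omega>) \<le> 4 * R\<^sup>2 * K / c"
      define A where "A = At n \<omega>"
      have \<omega>M: "\<omega> \<in> space M" using \<omega> by (simp add: regular_event_def)
      have u1: "norm (fst (\<zeta> i \<omega>)) = 1" for i using E0(3) \<omega> \<omega>M by blast
      have "4 * R\<^sup>2 * K / c \<ge> 0" using K c(1) by simp
      then have A: "norm A > 0" using contr unfolding A_def by linarith
      \<comment> \<open>The direction is scaled to norm \<open>1 / 2\<close> to lie in the open unit
        ball of the uniform bound; by homogeneity this divides \<open>sq_mean\<close> by 4.\<close>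
      define \<theta> where "\<theta> = (1 / (2 * norm A)) *\<^sub>R A"
      have A\<theta>: "A = (2 * norm A) *\<^sub>R \<theta>" using A by (simp add: \<theta>_def)
      have \<theta>: "norm \<theta> < 1" using A by (simp add: \<theta>_def)
      define \<theta>1 where "\<theta>1 = (1 / norm A) *\<^sub>R A"
      have "norm \<theta>1 = 1" using A by (simp add: \<theta>1_def)
      have \<theta>\<theta>1: "\<theta> = (1 / 2) *\<^sub>R \<theta>1" by (simp add: \<theta>_def \<theta>1_def)
      have "sq_mean \<theta> = sq_mean \<theta>1 / 4"
        unfolding sq_mean_def \<theta>\<theta>1 by (simp add: hC_scaleR power_mult_distrib power2_eq_square[of "1/2"] power_divide)
      then have q: "sq_mean \<theta> \<ge> c / 4" using c(2)[OF \<open>norm \<theta>1 = 1\<close>] by simp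
      have "empirical_process n (\<lambda>z. (hC 0 (fst z))\<^sup>2) \<omega> = 0"
        by (simp add: empirical_process_def hC_0)
      then have "\<bar>empirical_process n (\<lambda>z. (hC \<theta> (fst z))\<^sup>2) \<omega>\<bar> \<le> B"
        using E(3)[of \<omega> \<theta>] \<omega> \<theta> by simp
      then have "((\<Sum>i<n. (hC \<theta> (fst (\<zeta> i \<omega>)))\<^sup>2) - n * sq_mean \<theta>) / sqrt n \<ge> - B"
        unfolding empirical_process_def sq_mean_def by (simp only: abs_le_iff minus_le_iff)
      then have "(\<Sum>i<n. (hC \<theta> (fst (\<zeta> i \<omega>)))\<^sup>2) \<ge> n * sq_mean \<theta> - B * sqrt n"
        using n1 by (simp add: pos_le_divide_eq)
      moreover have "B * sqrt n \<le> n * (c / 8)"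
      proof -
        have "B / sqrt n * n \<le> c / 8 * n" using large[OF n] n1 by (intro mult_right_mono) auto
        moreover have "B / sqrt n * n = B * sqrt n"
          using real_div_sqrt[of n] by (metis of_nat_0_le_iff times_divide_eq_left times_divide_eq_right)
        ultimately have "B * sqrt n \<le> c / 8 * n" by (simp only:)
        then show ?thesis by (simp add: mult.commute)
      qed
      moreover have "n * (c / 4) \<le> n * sq_mean \<theta>" using q by (intro mult_left_mono) auto
      ultimately have sq: "(\<Sum>i<n. (hC \<theta> (fst (\<zeta> i \<omega>)))\<^sup>2) \<ge> n * (c / 8)" by (simp add: field_simps)
      have hA: "hC A u = 2 * norm A * hC \<theta> u" for u
        by (subst A\<theta>) (rule hC_scaleR, simp)
      have diff: "loss A (\<zeta> i \<omega>) - loss 0 (\<zeta> i \<omega>) \<ge>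
          (2 * norm A)\<^sup>2 * (hC \<theta> (fst (\<zeta> i \<omega>)))\<^sup>2 - 2 * R\<^sup>2 * norm A * (1 + \<bar>snd (\<zeta> i \<omega>)\<bar>)" for i
      proof -
        obtain u e where z: "\<zeta> i \<omega> = (u, e)" by (cases "\<zeta> i \<omega>")
        have u: "norm u = 1" using u1[of i] z by simp
        have "\<bar>hK u + e\<bar> \<le> R * (1 + \<bar>e\<bar>)"
        proof -
          have "1 * \<bar>e\<bar> \<le> R * \<bar>e\<bar>" using R(1) by (intro mult_right_mono) auto
          then show ?thesis using hK_le[of u] u by (simp add: distrib_left)
        qed
        moreover have "\<bar>hC A u\<bar> \<le> R * norm A" using hC_le[of A u] u by simp
        ultimately have "\<bar>(hK u + e) * hC A u\<bar> \<le> (R * (1 + \<bar>e\<bar>)) * (R * norm A)"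
          unfolding abs_mult using R(1) by (intro mult_mono) auto
        then have "(hK u + e) * hC A u \<le> R\<^sup>2 * norm A * (1 + \<bar>e\<bar>)"
          by (simp add: power2_eq_square mult_ac)
        moreover have "loss A (u, e) - loss 0 (u, e) = (hC A u)\<^sup>2 - 2 * ((hK u + e) * hC A u)"
          unfolding loss_def by (simp add: hC_0 power2_eq_square algebra_simps)
        moreover have "(hC A u)\<^sup>2 = (2 * norm A)\<^sup>2 * (hC \<theta> u)\<^sup>2" unfolding hA power_mult_distrib ..
        ultimately show ?thesis unfolding z by simp
      qed
      have "0 \<ge> (\<Sum>i<n. loss A (\<zeta> i \<omega>)) - (\<Sum>i<n. loss 0 (\<zeta> i \<omega>))"
        using At_min[OF n1(1) \<omega>M, of 0] by (simp add: A_def)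
      also have "(\<Sum>i<n. loss A (\<zeta> i \<omega>)) - (\<Sum>i<n. loss 0 (\<zeta> i \<omega>)) \<ge>
          (\<Sum>i<n. (2 * norm A)\<^sup>2 * (hC \<theta> (fst (\<zeta> i \<omega>)))\<^sup>2 - 2 * R\<^sup>2 * norm A * (1 + \<bar>snd (\<zeta> i \<omega>)\<bar>))"
        unfolding sum_subtractf[symmetric] by (intro sum_mono diff)
      finally have "(2 * norm A)\<^sup>2 * (\<Sum>i<n. (hC \<theta> (fst (\<zeta> i \<omega>)))\<^sup>2)
          \<le> 2 * R\<^sup>2 * norm A * (\<Sum>i<n. 1 + \<bar>snd (\<zeta> i \<omega>)\<bar>)"
        by (simp only: sum_subtractf sum_distrib_left[symmetric])
      also have "\<dots> \<le> 2 * R\<^sup>2 * norm A * (K * n)"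
        using regular_weight_sum[of \<omega> n K] \<omega> by (intro mult_left_mono) auto
      finally have "(2 * norm A)\<^sup>2 * (n * (c / 8)) \<le> 2 * R\<^sup>2 * norm A * (K * n)"
        by (rule order_trans[OF mult_left_mono[OF sq zero_le_power2]])
      then have "(norm A * n) * (norm A * c) \<le> (norm A * n) * (4 * R\<^sup>2 * K)"
        by (simp add: power2_eq_square mult_ac)
      then have "norm A * c \<le> 4 * R\<^sup>2 * K" using A n1 by simp
      then have "norm A \<le> 4 * R\<^sup>2 * K / c" using c(1) by (simp add: pos_le_divide_eq)
      then show False using contr by (simp add: A_def)
    qed
    moreover have "prob (E \<union> E0) \<le> d"
      using measure_Un_le[OF E(1) E0(1)] E(2) E0(2) by simp
    ultimately show ?thesis using E(1) E0(1) by (intro bexI[of _ "E \<union> E0"]) auto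
  qed
  moreover have "N \<ge> 1" by (simp add: N_def)
  ultimately show ?thesis by blast
qed

text \<open>On the compact set \<open>Q\<close> of bounded parameters away from the orbit the risk
  exceeds its minimum by some \<gamma>, while the fluctuations are of order
  \<open>1 / sqrt n\<close>. Alignment makes the distance to the orbit the distance to
  \<open>Ahat\<close>, so an estimator far from \<open>Ahat\<close> lies in
  \<open>Q\<close>.\<close>

lemma At_consistent:
  assumes \<eta>: "\<eta> > 0" and d: "d > 0" and K: "K > 0"
  shows "\<exists>N\<ge>1. \<forall>n\<ge>N. \<exists>E\<in>events. prob E \<le> d \<and> (\<forall>\<omega>\<in>regular_event n K - E. norm (At n \<omega> - Ahat) < \<eta>)"
proof -
  obtain b N0 where b: "N0 \<ge> 1" "\<And>n. n \<ge> N0 \<Longrightarrow> \<exists>E\<in>events. prob E \<le> d / 2 \<and> (\<forall>\<omega>\<in>regular_event n K - E. norm (At n \<omega>) \<le> b)"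
    using At_bounded[of "d / 2" K] d K by auto
  \<comment> \<open>The open ball of this radius around \<open>Ahat\<close> contains every parameter
    of norm at most \<open>b\<close>.\<close>
  define \<rho> where "\<rho> = \<bar>b\<bar> + norm Ahat + 1"
  have \<rho>: "\<rho> > 0" by (simp add: \<rho>_def add_nonneg_pos)
  define L where "L = Lip (norm Ahat + \<rho>)"
  have L: "L > 0" using \<rho> by (simp add: L_def Lip_pos)
  obtain B where B: "B \<ge> 0" "\<And>n (f :: real ^ 'q ^ 'd \<Rightarrow> (real ^ 'd) \<times> real \<Rightarrow> real) \<beta>. n \<ge> 1 \<Longrightarrow> lipschitz_family L f \<beta> \<Longrightarrow>
    (\<exists>E\<in>events. prob E \<le> d / 2 \<and> (\<forall>\<omega>\<in>regular_event n K - E. \<forall>\<theta>. norm \<theta> < 1 \<longrightarrow>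
        \<bar>empirical_process n (f \<theta>) \<omega> - empirical_process n (f 0) \<omega>\<bar> \<le> B))"
    using uniform_bound_likely[OF half_gt_zero[OF d] K L] by blast
  define Q where "Q = cball 0 b \<inter> {A. \<forall>g\<in>Aut C. \<eta> \<le> norm (Ahat ** g - A)}"
  have "closed {A. \<forall>g\<in>Aut C. \<eta> \<le> norm (Ahat ** g - A)}"
    unfolding Collect_ball_eq by (intro closed_INT ballI closed_Collect_le continuous_intros)
  then have "compact Q" unfolding Q_def by (intro compact_Int_closed) auto
  have "\<exists>\<gamma>>0. \<forall>A\<in>Q. \<Phi> A - \<Phi> Ahat \<ge> \<gamma>"
  proof (cases "Q = {}")
    case False
    obtain A0 where A0: "A0 \<in> Q" "\<And>A. A \<in> Q \<Longrightarrow> \<Phi> A0 \<le> \<Phi> A"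
      using continuous_attains_inf[OF \<open>compact Q\<close> False continuous_on_subset[OF continuous_\<Phi>]] by auto
    have "A0 \<notin> orbit Ahat C"
    proof
      assume "A0 \<in> orbit Ahat C"
      then obtain g where "g \<in> Aut C" "A0 = Ahat ** g" by (auto simp: orbit_def)
      then have "\<eta> \<le> norm (A0 - A0)" using A0(1) by (auto simp: Q_def)
      then show False using \<eta> by simp
    qed
    then have "\<Phi> Ahat < \<Phi> A0"
      unfolding minimizer_iff using \<Phi>_min by (meson le_less_trans not_le)
    then show ?thesis using A0(2) by (intro exI[of _ "\<Phi> A0 - \<Phi> Ahat"]) auto
  next
    case True
    then show ?thesis by (intro exI[of _ 1]) auto
  qed
  then obtain \<gamma> where \<gamma>: "\<gamma> > 0" "\<And>A. A \<in> Q \<Longrightarrow> \<Phi> A - \<Phi> Ahat \<ge> \<gamma>" by blast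
  define N where "N = max N0 (nat \<lceil>(\<rho> * B / \<gamma>)\<^sup>2\<rceil> + 1)"
  have "\<exists>E\<in>events. prob E \<le> d \<and> (\<forall>\<omega>\<in>regular_event n K - E. norm (At n \<omega> - Ahat) < \<eta>)"
    if n: "n \<ge> N" for n
  proof -
    have n1: "n \<ge> N0" "n \<ge> 1" "real n > 0" "sqrt n > 0" using n by (auto simp: N_def)
    have "(\<rho> * B / \<gamma>)\<^sup>2 < n" using n by (simp add: N_def) linarith
    then have "sqrt ((\<rho> * B / \<gamma>)\<^sup>2) < sqrt n" by (rule real_sqrt_less_mono)
    then have "\<rho> * B / \<gamma> < sqrt n" using \<rho> B(1) \<gamma>(1) by simp
    then have big: "\<rho> * B < sqrt n * \<gamma>" using \<gamma>(1) by (simp add: pos_divide_less_eq)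
    obtain E1 where E1: "E1 \<in> events" "prob E1 \<le> d / 2" "\<And>\<omega>. \<omega> \<in> regular_event n K - E1 \<Longrightarrow> norm (At n \<omega>) \<le> b"
      using b(2)[OF n1(1)] by blast
    have fam: "lipschitz_family L (\<lambda>a z. (loss (Ahat + \<rho> *\<^sub>R a) z - loss Ahat z) / \<rho>)
        (\<lambda>a. - 2 * (\<integral>u. hC (Ahat + \<rho> *\<^sub>R a) u - hC Ahat u \<partial>sphere_uniform) / \<rho>)"
      unfolding L_def by (rule loss_family[OF \<rho>]) simp
    obtain E2 where E2: "E2 \<in> events" "prob E2 \<le> d / 2" "\<And>\<omega> a. \<omega> \<in> regular_event n K - E2 \<Longrightarrow> norm a < 1 \<Longrightarrow>
        \<bar>empirical_process n (\<lambda>z. (loss (Ahat + \<rho> *\<^sub>R a) z - loss Ahat z) / \<rho>) \<omega>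
          - empirical_process n (\<lambda>z. (loss (Ahat + \<rho> *\<^sub>R 0) z - loss Ahat z) / \<rho>) \<omega>\<bar> \<le> B"
      using B(2)[OF n1(2) fam] by blast
    have "norm (At n \<omega> - Ahat) < \<eta>" if \<omega>: "\<omega> \<in> regular_event n K - (E1 \<union> E2)" for \<omega>
    proof (rule ccontr)
      assume contr: "\<not> norm (At n \<omega> - Ahat) < \<eta>"
      define A where "A = At n \<omega>"
      have \<omega>M: "\<omega> \<in> space M" using \<omega> by (simp add: regular_event_def)
      have Ab: "norm A \<le> b" using E1(3) \<omega> by (simp add: A_def)
      have "\<eta> \<le> norm (Ahat - A)" using contr by (simp add: A_def norm_minus_commute)
      then have "A \<in> Q"
        using Ab At_close[OF n1(2) \<omega>M] by (auto simp: Q_def A_def intro: order_trans)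
      define a where "a = (1 / \<rho>) *\<^sub>R (A - Ahat)"
      have "norm (A - Ahat) < \<rho>" using norm_triangle_ineq4[of A Ahat] Ab by (simp add: \<rho>_def)
      then have a: "norm a < 1" using \<rho> by (simp add: a_def)
      have Aa: "Ahat + \<rho> *\<^sub>R a = A" using \<rho> by (simp add: a_def)
      have "\<bar>empirical_process n (\<lambda>z. loss A z - loss Ahat z) \<omega> / \<rho>\<bar> \<le> B"
        using E2(3)[of \<omega> a] \<omega> a unfolding Aa empirical_process_scaled
        by (simp add: empirical_process_def[of n "\<lambda>z. 0"])
      then have "\<bar>empirical_process n (\<lambda>z. loss A z - loss Ahat z) \<omega>\<bar> \<le> \<rho> * B"
        using \<rho> by (simp add: abs_divide pos_divide_le_eq mult.commute)
      then have "sqrt n * empirical_process n (\<lambda>z. loss A z - loss Ahat z) \<omega> \<ge> sqrt n * - (\<rho> * B)"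
        using n1 by (intro mult_left_mono) auto
      moreover have "n * (\<Phi> A - \<Phi> Ahat) \<ge> n * \<gamma>" using \<gamma>(2)[OF \<open>A \<in> Q\<close>] by (intro mult_left_mono) auto
      moreover have "sqrt n * empirical_process n (\<lambda>z. loss A z - loss Ahat z) \<omega> + n * (\<Phi> A - \<Phi> Ahat) \<le> 0"
        using At_min[OF n1(2) \<omega>M, of Ahat] unfolding loss_sum_diff[OF n1(2), symmetric] A_def by simp
      ultimately have "n * \<gamma> \<le> sqrt n * (\<rho> * B)" by simp
      also have "\<dots> < sqrt n * (sqrt n * \<gamma>)" using big n1 by (intro mult_strict_left_mono) auto
      also have "\<dots> = n * \<gamma>" by (simp flip: mult.assoc)
      finally show False by simp
    qed
    moreover have "prob (E1 \<union> E2) \<le> d" using measure_Un_le[OF E1(1) E2(1)] E1(2) E2(2) by simp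
    ultimately show ?thesis using E1(1) E2(1) by (intro bexI[of _ "E1 \<union> E2"]) auto
  qed
  moreover have "N \<ge> 1" using b(1) by (simp add: N_def)
  ultimately show ?thesis by blast
qed

end


section \<open>The local empirical process\<close>

lemma differentiable_imp_GDERIV:
  fixes f :: "'a::euclidean_space \<Rightarrow> real"
  assumes "f differentiable (at x)"
  shows "\<exists>D. GDERIV f x :> D"
proof -
  obtain F where F: "(f has_derivative F) (at x)" using assms unfolding differentiable_def by blast
  then have lin: "linear F" by (simp add: has_derivative_linear)
  define D where "D = (\<Sum>b\<in>Basis. F b *\<^sub>R b)"
  have "F h = h \<bullet> D" for h
  proof -
    have "F h = F (\<Sum>b\<in>Basis. (h \<bullet> b) *\<^sub>R b)" by (simp add: euclidean_representation)
    also have "\<dots> = (\<Sum>b\<in>Basis. (h \<bullet> b) * F b)" using lin by (simp add: linear_sum linear_cmul)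
    also have "\<dots> = h \<bullet> D" by (simp add: D_def inner_sum_right mult.commute)
    finally show ?thesis .
  qed
  then have "F = (\<lambda>h. h \<bullet> D)" by auto
  then show ?thesis using F unfolding gderiv_def by auto
qed

lemma GDERIV_minimum:
  fixes f :: "'a::real_inner \<Rightarrow> real"
  assumes f: "GDERIV f x :> D" and min: "\<And>y. f x \<le> f y"
  shows "D = 0"
proof -
  have "(\<lambda>n. (f (x + (1 / real (Suc n)) *\<^sub>R - D) - f x) / (1 / real (Suc n))) \<longlonglongrightarrow> - D \<bullet> D"
    by (rule GDERIV_sequence[OF f LIMSEQ_Suc[OF lim_1_over_n]]) simp
  moreover have "(f (x + (1 / real (Suc n)) *\<^sub>R - D) - f x) / (1 / real (Suc n)) \<ge> 0" for n
    using min by (intro divide_nonneg_nonneg) auto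
  ultimately have "- D \<bullet> D \<ge> 0" by (intro LIMSEQ_le_const) auto
  then show ?thesis by (metis inner_eq_zero_iff inner_ge_zero inner_minus_left neg_0_le_iff_le order_antisym)
qed

lemma (in regression_sample) empirical_process_second_moment:
  assumes [measurable]: "f \<in> borel_measurable (S \<Otimes>\<^sub>M \<nu>)"
    and f2: "integrable (S \<Otimes>\<^sub>M \<nu>) (\<lambda>z. (f z)\<^sup>2)" and n: "n \<ge> 1"
  shows "integrable M (\<lambda>\<omega>. (empirical_process n f \<omega>)\<^sup>2)"
    and "expectation (\<lambda>\<omega>. (empirical_process n f \<omega>)\<^sup>2) \<le> (\<integral>z. (f z)\<^sup>2 \<partial>(S \<Otimes>\<^sub>M \<nu>))"
proof -
  have f1: "integrable (S \<Otimes>\<^sub>M \<nu>) f"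
    by (rule P.square_integrable_imp_integrable[OF _ f2]) measurable
  define \<mu> where "\<mu> = (\<integral>z. f z \<partial>(S \<Otimes>\<^sub>M \<nu>))"
  define X where "X i \<omega> = f (\<zeta> i \<omega>) - \<mu>" for i \<omega>
  have emp: "empirical_process n f \<omega> = (\<Sum>i<n. X i \<omega>) / sqrt n" for \<omega>
    by (simp add: empirical_process_def X_def sum_subtractf \<mu>_def)
  have ind: "indep_vars (\<lambda>_. borel) X UNIV"
    unfolding X_def by (rule indep_vars_compose2[OF indep, of "\<lambda>_ z. f z - \<mu>"]) measurable
  have i1: "integrable M (\<lambda>\<omega>. f (\<zeta> i \<omega>))" "expectation (\<lambda>\<omega>. f (\<zeta> i \<omega>)) = \<mu>" for i
    using integral_sample[of f i] f1 by (simp_all add: \<mu>_def)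
  have i2: "integrable M (\<lambda>\<omega>. (f (\<zeta> i \<omega>))\<^sup>2)"
    "expectation (\<lambda>\<omega>. (f (\<zeta> i \<omega>))\<^sup>2) = (\<integral>z. (f z)\<^sup>2 \<partial>(S \<Otimes>\<^sub>M \<nu>))" for i
    using integral_sample[of "\<lambda>z. (f z)\<^sup>2" i] f2 by simp_all
  have sq: "(X i \<omega>)\<^sup>2 = (f (\<zeta> i \<omega>))\<^sup>2 - 2 * \<mu> * f (\<zeta> i \<omega>) + \<mu>\<^sup>2" for i \<omega>
    by (simp add: X_def power2_eq_square algebra_simps)
  have X2: "integrable M (\<lambda>\<omega>. (X i \<omega>)\<^sup>2)" for i unfolding sq using i1 i2 by simp
  have X1: "expectation (X i) = 0" for i unfolding X_def using i1 by (simp add: prob_space)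
  have Xv: "expectation (\<lambda>\<omega>. (X i \<omega>)\<^sup>2) \<le> (\<integral>z. (f z)\<^sup>2 \<partial>(S \<Otimes>\<^sub>M \<nu>))" for i
  proof -
    have "expectation (\<lambda>\<omega>. (X i \<omega>)\<^sup>2) = (\<integral>z. (f z)\<^sup>2 \<partial>(S \<Otimes>\<^sub>M \<nu>)) - \<mu>\<^sup>2"
      unfolding sq using i1 i2 by (simp add: prob_space power2_eq_square)
    then show ?thesis by simp
  qed
  note moment = indep_sum_second_moment[OF ind X2 X1, of n]
  have emp2: "(empirical_process n f \<omega>)\<^sup>2 = (\<Sum>i<n. X i \<omega>)\<^sup>2 / n" for \<omega>
    by (simp add: emp power_divide)
  show "integrable M (\<lambda>\<omega>. (empirical_process n f \<omega>)\<^sup>2)"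
    unfolding emp2 using moment(1) by simp
  have "expectation (\<lambda>\<omega>. (empirical_process n f \<omega>)\<^sup>2) = (\<Sum>i<n. expectation (\<lambda>\<omega>. (X i \<omega>)\<^sup>2)) / n"
    unfolding emp2 using moment by simp
  also have "\<dots> \<le> (n * (\<integral>z. (f z)\<^sup>2 \<partial>(S \<Otimes>\<^sub>M \<nu>))) / n"
    using sum_bounded_above[of "{..<n}", OF Xv] by (intro divide_right_mono) auto
  finally show "expectation (\<lambda>\<omega>. (empirical_process n f \<omega>)\<^sup>2) \<le> (\<integral>z. (f z)\<^sup>2 \<partial>(S \<Otimes>\<^sub>M \<nu>))"
    using n by simp
qed

locale shape_asymptotics = shape_estimator M Kstar C \<nu> Z Ahat At
  for M :: "'w measure" and Kstar :: "(real ^ 'd) set" and C :: "(real ^ 'q) set" and \<nu> Z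
    and Ahat :: "real ^ 'q ^ 'd" and At +
  fixes \<Gamma> :: "real ^ 'q ^ 'd \<Rightarrow> real ^ 'q ^ 'd"
  assumes support_diff: "AE (u, y) in regression_law Kstar \<nu>.
      support_fun C differentiable (at (transpose Ahat *v u))"
    and hessian: "has_hessian \<Phi> \<Gamma> Ahat"
begin

definition grad :: "(real ^ 'd) \<times> real \<Rightarrow> real ^ 'q ^ 'd" where
  "grad z = gradient (\<lambda>A. loss A z) Ahat"

lemma loss_continuous: "continuous_on UNIV (loss A)"
  unfolding loss_def case_prod_beta
  by (intro continuous_intros continuous_on_compose2[OF hC_continuous] continuous_on_compose2[OF hK_continuous]) auto

lemma grad_measurable[measurable]: "grad \<in> borel_measurable (sphere_uniform \<Otimes>\<^sub>M \<nu>)"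
proof -
  have "grad \<in> borel_measurable borel"
    unfolding grad_def using borel_measurable_gradient[OF loss_continuous] .
  then show ?thesis by (simp only: measurable_cong_sets[OF sets_S refl])
qed

lemma loss_GDERIV: "AE z in sphere_uniform \<Otimes>\<^sub>M \<nu>. GDERIV (\<lambda>A. loss A z) Ahat :> grad z"
proof -
  have "AE z in distr (sphere_uniform \<Otimes>\<^sub>M \<nu>) borel observations.
      support_fun C differentiable (at (transpose Ahat *v fst z))"
    using support_diff unfolding regression_law_eq by eventually_elim auto
  then have "AE z in sphere_uniform \<Otimes>\<^sub>M \<nu>. support_fun C differentiable (at (transpose Ahat *v fst (observations z)))"
    by (rule AE_distrD[rotated]) (simp add: measurable_cong_sets[OF sets_S refl])
  then show ?thesis
  proof eventually_elim
    case (elim z)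
    obtain u e where z: "z = (u, e)" by (cases z)
    have d: "support_fun C differentiable (at (transpose Ahat *v u))"
      using elim by (simp add: z observations_def)
    have lin: "linear (\<lambda>A :: real ^ 'q ^ 'd. transpose A *v u)"
      by (rule linearI) (simp_all add: vec_eq_iff matrix_vector_mult_def transpose_def distrib_right
          sum.distrib sum_distrib_left mult.assoc del: transpose_matrix_vector)
    then have "(\<lambda>A :: real ^ 'q ^ 'd. transpose A *v u) differentiable (at Ahat)"
      by (rule linear_imp_differentiable)
    then have "(\<lambda>A. support_fun C (transpose A *v u)) differentiable (at Ahat)"
      using differentiable_chain_at[of "\<lambda>A. transpose A *v u" Ahat "support_fun C"] d by (simp add: comp_def del: transpose_matrix_vector)
    then have "(\<lambda>A. hC A u) differentiable (at Ahat)" by (simp only: hC_def)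
    then have "(\<lambda>A. (hC A u - hK u - e)\<^sup>2) differentiable (at Ahat)"
      by (intro derivative_intros)
    then have "(\<lambda>A. loss A z) differentiable (at Ahat)" by (simp add: loss_def z)
    from differentiable_imp_GDERIV[OF this] obtain D where D: "GDERIV (\<lambda>A. loss A z) Ahat :> D" ..
    then show ?case using gradient_eq[OF D] by (simp add: grad_def)
  qed
qed

text \<open>The constant for all perturbations of \<open>Ahat\<close> of norm at most 1; the local
  arguments below keep to this range.\<close>

definition LA :: real where "LA = Lip (norm Ahat + 1)"

lemma LA_pos: "LA > 0" unfolding LA_def by (rule Lip_pos) simp

section \<open>Difference quotients and the gradient of the loss\<close>

lemma quotient_bound:
  assumes "norm u = 1" "t > 0" "t * norm h \<le> 1"
  shows "\<bar>(loss (Ahat + t *\<^sub>R h) (u, e) - loss Ahat (u, e)) / t\<bar> \<le> LA * norm h * (1 + \<bar>e\<bar>)"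
proof -
  have "norm (Ahat + t *\<^sub>R h) \<le> norm Ahat + 1"
    using norm_triangle_ineq[of Ahat "t *\<^sub>R h"] assms by simp
  then have "\<bar>loss (Ahat + t *\<^sub>R h) (u, e) - loss Ahat (u, e)\<bar> \<le> LA * norm (Ahat + t *\<^sub>R h - Ahat) * (1 + \<bar>e\<bar>)"
    unfolding LA_def by (intro loss_lipschitz[OF assms(1)]) auto
  also have "\<dots> = (LA * norm h * (1 + \<bar>e\<bar>)) * t" using assms by simp
  finally show ?thesis using assms by (simp add: abs_divide pos_divide_le_eq)
qed

lemma envelope_integrable:
  "integrable ((sphere_uniform :: (real ^ 'd) measure) \<Otimes>\<^sub>M \<nu>) (\<lambda>z. c * (1 + \<bar>snd z\<bar>))"
  "integrable ((sphere_uniform :: (real ^ 'd) measure) \<Otimes>\<^sub>M \<nu>) (\<lambda>z. (c * (1 + \<bar>snd z\<bar>))\<^sup>2)"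
  using integral_noise(2)[of "\<lambda>e. c * (1 + \<bar>e\<bar>)"] integral_noise(2)[of "\<lambda>e. (c * (1 + \<bar>e\<bar>))\<^sup>2"]
    integrable_mult_right[OF weight_integrable(1), of c] integrable_mult_right[OF weight_integrable(2), of "c\<^sup>2"]
  by (simp_all add: power_mult_distrib)

context
  fixes h :: "real ^ 'q ^ 'd" and t :: "nat \<Rightarrow> real"
  assumes t: "t \<longlonglongrightarrow> 0" "\<And>n. t n > 0" "\<And>n. t n * norm h \<le> 1"
begin

definition quot :: "nat \<Rightarrow> (real ^ 'd) \<times> real \<Rightarrow> real" where
  "quot n z = (loss (Ahat + t n *\<^sub>R h) z - loss Ahat z) / t n"

lemma quot_measurable: "quot n \<in> borel_measurable (sphere_uniform \<Otimes>\<^sub>M \<nu>)"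
  unfolding quot_def by measurable

lemma quot_tendsto: "AE z in sphere_uniform \<Otimes>\<^sub>M \<nu>. (\<lambda>n. quot n z) \<longlonglongrightarrow> h \<bullet> grad z"
  using loss_GDERIV
proof eventually_elim
  case (elim z)
  show ?case unfolding quot_def
    by (rule GDERIV_sequence[OF elim t(1)]) (use t(2) in \<open>simp add: less_imp_neq[symmetric]\<close>)
qed

lemma quot_bound: "AE z in sphere_uniform \<Otimes>\<^sub>M \<nu>. \<bar>quot n z\<bar> \<le> LA * norm h * (1 + \<bar>snd z\<bar>)"
  using AE_sphere_pair
proof eventually_elim
  case (elim z)
  obtain u e where z: "z = (u, e)" by (cases z)
  show ?case using quotient_bound[of u "t n" h e] elim t by (simp add: quot_def z)
qed

lemma grad_bound': "AE z in sphere_uniform \<Otimes>\<^sub>M \<nu>. \<bar>h \<bullet> grad z\<bar> \<le> LA * norm h * (1 + \<bar>snd z\<bar>)"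
proof -
  have "AE z in sphere_uniform \<Otimes>\<^sub>M \<nu>. \<forall>n. \<bar>quot n z\<bar> \<le> LA * norm h * (1 + \<bar>snd z\<bar>)"
    unfolding AE_all_countable using quot_bound by blast
  with quot_tendsto show ?thesis
  proof eventually_elim
    case (elim z)
    from tendsto_rabs[OF elim(1)] show ?case
      by (rule LIMSEQ_le_const2) (use elim(2) in auto)
  qed
qed

text \<open>Dominated convergence exchanges limit and integral, so the mean is a directional
  derivative of the risk, which vanishes at the minimizer \<open>Ahat\<close>.\<close>

lemma grad_mean_zero: "(\<integral>z. h \<bullet> grad z \<partial>(sphere_uniform \<Otimes>\<^sub>M \<nu>)) = 0"
proof -
  have "(\<lambda>n. \<integral>z. quot n z \<partial>(sphere_uniform \<Otimes>\<^sub>M \<nu>)) \<longlonglongrightarrow> (\<integral>z. h \<bullet> grad z \<partial>(sphere_uniform \<Otimes>\<^sub>M \<nu>))"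
    by (rule integral_dominated_convergence[where w = "\<lambda>z. LA * norm h * (1 + \<bar>snd z\<bar>)"])
      (use quot_tendsto quot_bound envelope_integrable quot_measurable in auto)
  moreover have "(\<integral>z. quot n z \<partial>(sphere_uniform \<Otimes>\<^sub>M \<nu>)) = (\<Phi> (Ahat + t n *\<^sub>R h) - \<Phi> Ahat) / t n" for n
    unfolding quot_def integral_divide_zero \<Phi>_diff ..
  moreover have "(\<lambda>n. (\<Phi> (Ahat + t n *\<^sub>R h) - \<Phi> Ahat) / t n) \<longlonglongrightarrow> h \<bullet> 0"
  proof (rule GDERIV_sequence[OF _ t(1)])
    from hessian obtain D where D: "GDERIV \<Phi> Ahat :> D"
      unfolding has_hessian_def by (metis eventually_nhds_x_imp_x)
    then show "GDERIV \<Phi> Ahat :> 0" using GDERIV_minimum[OF D \<Phi>_min] by simp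
  qed (use t(2) in \<open>simp add: less_imp_neq[symmetric]\<close>)
  ultimately show ?thesis using LIMSEQ_unique by simp
qed

text \<open>The loss is differentiable at \<open>Ahat\<close> in mean square: the quotients converge
  almost everywhere, and their envelope is square integrable since the noise has two
  moments.\<close>

lemma quot_square_limit:
  "(\<lambda>n. \<integral>z. (quot n z - h \<bullet> grad z)\<^sup>2 \<partial>(sphere_uniform \<Otimes>\<^sub>M \<nu>)) \<longlonglongrightarrow> 0"
  "integrable (sphere_uniform \<Otimes>\<^sub>M \<nu>) (\<lambda>z. (quot n z - h \<bullet> grad z)\<^sup>2)"
proof -
  let ?w = "\<lambda>z :: (real ^ 'd) \<times> real. (2 * (LA * norm h) * (1 + \<bar>snd z\<bar>))\<^sup>2"
  have bnd: "AE z in sphere_uniform \<Otimes>\<^sub>M \<nu>. norm ((quot n z - h \<bullet> grad z)\<^sup>2) \<le> ?w z" for n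
    using quot_bound[of n] grad_bound'
  proof eventually_elim
    case (elim z)
    have "\<bar>quot n z - h \<bullet> grad z\<bar> \<le> \<bar>2 * (LA * norm h) * (1 + \<bar>snd z\<bar>)\<bar>"
      using elim by (simp add: abs_le_iff; linarith)
    then show ?case by (simp only: abs_le_square_iff real_norm_def abs_power2)
  qed
  have meas: "(\<lambda>z. (quot n z - h \<bullet> grad z)\<^sup>2) \<in> borel_measurable (sphere_uniform \<Otimes>\<^sub>M \<nu>)" for n
    using quot_measurable[of n] by measurable
  have "(\<lambda>n. \<integral>z. (quot n z - h \<bullet> grad z)\<^sup>2 \<partial>(sphere_uniform \<Otimes>\<^sub>M \<nu>)) \<longlonglongrightarrow> (\<integral>z. 0 \<partial>((sphere_uniform :: (real ^ 'd) measure) \<Otimes>\<^sub>M \<nu>))"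
  proof (rule integral_dominated_convergence[where w = ?w])
    show "AE z in sphere_uniform \<Otimes>\<^sub>M \<nu>. (\<lambda>n. (quot n z - h \<bullet> grad z)\<^sup>2) \<longlonglongrightarrow> 0"
      using quot_tendsto
    proof eventually_elim
      case (elim z)
      have "(\<lambda>n. (quot n z - h \<bullet> grad z)\<^sup>2) \<longlonglongrightarrow> (h \<bullet> grad z - h \<bullet> grad z)\<^sup>2" by (intro tendsto_intros elim)
      then show ?case by simp
    qed
  qed (use bnd meas envelope_integrable in auto)
  then show "(\<lambda>n. \<integral>z. (quot n z - h \<bullet> grad z)\<^sup>2 \<partial>(sphere_uniform \<Otimes>\<^sub>M \<nu>)) \<longlonglongrightarrow> 0" by simp
  show "integrable (sphere_uniform \<Otimes>\<^sub>M \<nu>) (\<lambda>z. (quot n z - h \<bullet> grad z)\<^sup>2)"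
    by (rule Bochner_Integration.integrable_bound[OF envelope_integrable(2) meas])
      (use bnd in \<open>auto elim: eventually_mono\<close>)
qed

end

text \<open>A concrete step sequence, with which the facts about the gradient become free of the
  sequence.\<close>

lemma small_steps:
  fixes h :: "real ^ 'q ^ 'd"
  defines "t \<equiv> \<lambda>n. (1 / (1 + norm h)) * (1 / real (Suc n))"
  shows "t \<longlonglongrightarrow> 0" "t n > 0" "t n * norm h \<le> 1"
proof -
  have "t \<longlonglongrightarrow> (1 / (1 + norm h)) * 0"
    unfolding t_def by (intro tendsto_mult tendsto_const LIMSEQ_Suc[OF lim_1_over_n])
  then show "t \<longlonglongrightarrow> 0" by simp
  have p: "1 + norm h > 0" by (simp add: add_pos_nonneg)
  then show "t n > 0" by (simp add: t_def)
  have "(1 / (1 + norm h)) * (1 / real (Suc n)) \<le> (1 / (1 + norm h)) * 1"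
    using p by (intro mult_left_mono) auto
  then have "t n * norm h \<le> (1 / (1 + norm h)) * norm h"
    unfolding t_def by (intro mult_right_mono) auto
  also have "\<dots> \<le> 1" using p by simp
  finally show "t n * norm h \<le> 1" .
qed

lemma grad_expectation: "(\<integral>z. h \<bullet> grad z \<partial>(sphere_uniform \<Otimes>\<^sub>M \<nu>)) = 0"
  by (rule grad_mean_zero[OF small_steps])

lemma grad_bound: "AE z in sphere_uniform \<Otimes>\<^sub>M \<nu>. \<bar>h \<bullet> grad z\<bar> \<le> LA * norm h * (1 + \<bar>snd z\<bar>)"
  by (rule grad_bound'[OF small_steps])

lemma grad_square_integrable: "integrable (sphere_uniform \<Otimes>\<^sub>M \<nu>) (\<lambda>z. (h \<bullet> grad z)\<^sup>2)"
proof (rule Bochner_Integration.integrable_bound[OF envelope_integrable(2)[of "LA * norm h"]])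
  show "AE z in sphere_uniform \<Otimes>\<^sub>M \<nu>. norm ((h \<bullet> grad z)\<^sup>2) \<le> norm ((LA * norm h * (1 + \<bar>snd z\<bar>))\<^sup>2)"
    using grad_bound[of h]
  proof eventually_elim
    case (elim z)
    then have "\<bar>h \<bullet> grad z\<bar> \<le> \<bar>LA * norm h * (1 + \<bar>snd z\<bar>)\<bar>" by linarith
    then show ?case by (simp only: abs_le_square_iff real_norm_def abs_power2)
  qed
qed measurable

lemma grad_product_integrable: "integrable (sphere_uniform \<Otimes>\<^sub>M \<nu>) (\<lambda>z. (h \<bullet> grad z) * (k \<bullet> grad z))"
proof -
  have "(h \<bullet> grad z) * (k \<bullet> grad z) = (((h + k) \<bullet> grad z)\<^sup>2 - (h \<bullet> grad z)\<^sup>2 - (k \<bullet> grad z)\<^sup>2) / 2" for z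
    by (simp add: inner_add_left power2_eq_square algebra_simps)
  moreover have "integrable (sphere_uniform \<Otimes>\<^sub>M \<nu>) (\<lambda>z. (((h + k) \<bullet> grad z)\<^sup>2 - (h \<bullet> grad z)\<^sup>2 - (k \<bullet> grad z)\<^sup>2) / 2)"
    by (intro integrable_divide_zero Bochner_Integration.integrable_diff grad_square_integrable)
  ultimately show ?thesis by (simp only:)
qed

section \<open>The normalized score and the local process\<close>

definition scaled_score :: "nat \<Rightarrow> 'w \<Rightarrow> real ^ 'q ^ 'd" where
  "scaled_score n \<omega> = (1 / sqrt n) *\<^sub>R (\<Sum>i<n. grad (\<zeta> i \<omega>))"

text \<open>For positive \<open>n\<close> this is the summed, not averaged, increment of the loss
  from \<open>Ahat\<close> to the point displaced by \<open>h / sqrt n\<close>, minus its mean. It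
  is the stochastic part of the local criterion; the mean supplies the quadratic part.\<close>

definition local_process :: "nat \<Rightarrow> real ^ 'q ^ 'd \<Rightarrow> 'w \<Rightarrow> real" where
  "local_process n h \<omega> = sqrt n * empirical_process n (\<lambda>z. loss (Ahat + (1 / sqrt n) *\<^sub>R h) z - loss Ahat z) \<omega>"

lemma grad_\<zeta>_measurable[measurable]: "(\<lambda>\<omega>. grad (\<zeta> i \<omega>)) \<in> borel_measurable M"
  by measurable

lemma scaled_score_measurable[measurable]: "scaled_score n \<in> borel_measurable M"
  unfolding scaled_score_def by measurable

lemma local_process_measurable[measurable]: "local_process n h \<in> borel_measurable M"
  unfolding local_process_def empirical_process_def by measurable

text \<open>The difference is the empirical process of the quotient minus the gradient; the score
  needs no centering because the gradient has mean 0. Its variance is at most the mean square of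
  that function, which tends to 0, so Chebyshev applies.\<close>

lemma local_process_pointwise:
  assumes \<kappa>: "\<kappa> > 0"
  shows "(\<lambda>n. prob {\<omega> \<in> space M. \<bar>local_process n h \<omega> - h \<bullet> scaled_score n \<omega>\<bar> \<ge> \<kappa>}) \<longlonglongrightarrow> 0"
proof -
  \<comment> \<open>The facts about \<open>quot\<close> require \<open>t n * norm h \<le> 1\<close>
    at every index; starting at \<open>N\<close> ensures this, and the offset is removed at the
    end.\<close>
  define N where "N = nat \<lceil>(norm h)\<^sup>2\<rceil> + 1"
  define t where "t n = 1 / sqrt (real (n + N))" for n
  have N: "(norm h)\<^sup>2 \<le> N" "N \<ge> 1" unfolding N_def by linarith+
  have t: "t \<longlonglongrightarrow> 0" "\<And>n. t n > 0" "\<And>n. t n * norm h \<le> 1"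
  proof -
    have "(\<lambda>n. 1 / sqrt (real n)) \<longlonglongrightarrow> 0"
      by (intro tendsto_divide_0[OF tendsto_const] filterlim_at_top_imp_at_infinity
          filterlim_compose[OF sqrt_at_top filterlim_real_sequentially])
    then show "t \<longlonglongrightarrow> 0" unfolding t_def by (rule LIMSEQ_ignore_initial_segment)
    show p: "t n > 0" for n using N by (simp add: t_def)
    show "t n * norm h \<le> 1" for n
    proof -
      have "norm h \<le> sqrt (real (n + N))" using N by (intro real_le_rsqrt) simp
      then show ?thesis using N by (simp add: t_def)
    qed
  qed
  define f where "f n z = quot h t n z - h \<bullet> grad z" for n z
  have fm: "f n \<in> borel_measurable (sphere_uniform \<Otimes>\<^sub>M \<nu>)" for n
    unfolding f_def using quot_measurable[OF t, of n] by measurable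
  note lim = quot_square_limit[OF t, folded f_def]
  have int1: "integrable (sphere_uniform \<Otimes>\<^sub>M \<nu>) (\<lambda>z. h \<bullet> grad z)"
    by (rule P.square_integrable_imp_integrable[OF _ grad_square_integrable]) measurable
  have eq: "local_process (n + N) h \<omega> - h \<bullet> scaled_score (n + N) \<omega> = empirical_process (n + N) (f n) \<omega>" for n \<omega>
  proof -
    have s: "sqrt (real (n + N)) > 0" using N by simp
    have quot: "quot h t n z = sqrt (real (n + N)) * (loss (Ahat + (1 / sqrt (real (n + N))) *\<^sub>R h) z - loss Ahat z)" for z
      unfolding quot_def[OF t] by (simp add: t_def mult.commute)
    have int2: "integrable (sphere_uniform \<Otimes>\<^sub>M \<nu>) (quot h t n)"
      unfolding quot using loss_diff_integrable by (intro integrable_mult_right)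
    have "(\<integral>z. f n z \<partial>(sphere_uniform \<Otimes>\<^sub>M \<nu>)) = (\<integral>z. quot h t n z \<partial>(sphere_uniform \<Otimes>\<^sub>M \<nu>))"
      unfolding f_def using int1 int2 by (simp add: grad_expectation)
    then have "empirical_process (n + N) (f n) \<omega> = empirical_process (n + N) (quot h t n) \<omega>
        - (\<Sum>i<n + N. h \<bullet> grad (\<zeta> i \<omega>)) / sqrt (real (n + N))"
      by (simp add: empirical_process_def f_def sum_subtractf diff_divide_distrib)
    moreover have "(\<Sum>i<n + N. h \<bullet> grad (\<zeta> i \<omega>)) / sqrt (real (n + N)) = h \<bullet> scaled_score (n + N) \<omega>"
      by (simp add: scaled_score_def inner_sum_right)
    moreover have "empirical_process (n + N) (quot h t n) \<omega> = local_process (n + N) h \<omega>"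
      unfolding local_process_def empirical_process_def quot integral_mult_right_zero sum_distrib_left[symmetric]
      by (simp add: right_diff_distrib mult.left_commute)
    ultimately show ?thesis by simp
  qed
  have le: "prob {\<omega> \<in> space M. \<bar>local_process (n + N) h \<omega> - h \<bullet> scaled_score (n + N) \<omega>\<bar> \<ge> \<kappa>}
      \<le> (\<integral>z. (f n z)\<^sup>2 \<partial>(sphere_uniform \<Otimes>\<^sub>M \<nu>)) / \<kappa>\<^sup>2" for n
  proof -
    have n1: "n + N \<ge> 1" using N by simp
    note second = empirical_process_second_moment[OF fm[of n] lim(2)[of n] n1]
    have m: "(\<lambda>\<omega>. empirical_process (n + N) (f n) \<omega>) \<in> borel_measurable M"
      unfolding eq[symmetric] using local_process_measurable scaled_score_measurable
      by (intro borel_measurable_diff borel_measurable_inner borel_measurable_const) auto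
    have "prob {\<omega> \<in> space M. \<bar>local_process (n + N) h \<omega> - h \<bullet> scaled_score (n + N) \<omega>\<bar> \<ge> \<kappa>}
      \<le> expectation (\<lambda>\<omega>. (empirical_process (n + N) (f n) \<omega>)\<^sup>2) / \<kappa>\<^sup>2"
      unfolding eq by (intro prob_abs_ge_second_moment m second(1) \<kappa>)
    also have "\<dots> \<le> (\<integral>z. (f n z)\<^sup>2 \<partial>(sphere_uniform \<Otimes>\<^sub>M \<nu>)) / \<kappa>\<^sup>2"
      using second(2) by (intro divide_right_mono) auto
    finally show ?thesis .
  qed
  have "(\<lambda>n. (\<integral>z. (f n z)\<^sup>2 \<partial>(sphere_uniform \<Otimes>\<^sub>M \<nu>)) / \<kappa>\<^sup>2) \<longlonglongrightarrow> 0 / \<kappa>\<^sup>2"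
    using lim(1) \<kappa> by (intro tendsto_divide tendsto_const) auto
  then have lim2: "(\<lambda>n. (\<integral>z. (f n z)\<^sup>2 \<partial>(sphere_uniform \<Otimes>\<^sub>M \<nu>)) / \<kappa>\<^sup>2) \<longlonglongrightarrow> 0" by simp
  have "(\<lambda>n. prob {\<omega> \<in> space M. \<bar>local_process (n + N) h \<omega> - h \<bullet> scaled_score (n + N) \<omega>\<bar> \<ge> \<kappa>}) \<longlonglongrightarrow> 0"
  proof (rule tendsto_sandwich[OF _ _ tendsto_const lim2])
    show "\<forall>\<^sub>F n in sequentially. 0 \<le> prob {\<omega> \<in> space M. \<bar>local_process (n + N) h \<omega> - h \<bullet> scaled_score (n + N) \<omega>\<bar> \<ge> \<kappa>}"
      by (intro always_eventually allI measure_nonneg)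
  qed (intro always_eventually allI le)
  then show ?thesis by (rule LIMSEQ_offset)
qed

end


section \<open>Rate of convergence and limit law\<close>

locale shape_normality = shape_asymptotics M Kstar C \<nu> Z Ahat At \<Gamma>
  for M :: "'w measure" and Kstar :: "(real ^ 'd) set" and C :: "(real ^ 'q) set" and \<nu> Z
    and Ahat :: "real ^ 'q ^ 'd" and At \<Gamma> +
  assumes hessian_pos: "\<And>H. H \<in> orthogonal_comp (tangent_space (orbit Ahat C) Ahat) \<Longrightarrow> H \<noteq> 0 \<Longrightarrow> H \<bullet> \<Gamma> H > 0"
begin

definition Tperp :: "(real ^ 'q ^ 'd) set" where
  "Tperp = orthogonal_comp (tangent_space (orbit Ahat C) Ahat)"

lemma Tperp_subspace: "subspace Tperp"
  unfolding Tperp_def by (rule subspace_orthogonal_comp)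

text \<open>First-order condition: along a smooth curve in the orbit through \<open>Ahat\<close> the
  squared distance to \<open>At n \<omega>\<close> has a minimum at time 0, so its derivative there
  vanishes.\<close>

lemma At_perp:
  assumes n: "n \<ge> 1" and \<omega>: "\<omega> \<in> space M"
  shows "At n \<omega> - Ahat \<in> Tperp"
  unfolding Tperp_def orthogonal_comp_def
proof (intro CollectI ballI)
  fix v assume "v \<in> tangent_space (orbit Ahat C) Ahat"
  then obtain e and c :: "nat \<Rightarrow> real \<Rightarrow> real ^ 'q ^ 'd" where e: "e > 0"
    and c: "\<And>k t. t \<in> {-e<..<e} \<Longrightarrow> (c k has_vector_derivative c (Suc k) t) (at t)"
      "\<And>t. t \<in> {-e<..<e} \<Longrightarrow> c 0 t \<in> orbit Ahat C" "c 0 0 = Ahat" "c 1 0 = v"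
    unfolding tangent_space_def by blast
  define B where "B = At n \<omega>"
  define \<phi> where "\<phi> s = (c 0 s - B) \<bullet> (c 0 s - B)" for s
  have "(c 0 has_vector_derivative v) (at 0)" using c(1)[of 0 0] c(4) e by simp
  then have "((\<lambda>s. c 0 s - B) has_vector_derivative v) (at 0)"
    using has_vector_derivative_diff[OF _ has_vector_derivative_const, of "c 0" v "at 0" B] by simp
  from bounded_bilinear.has_vector_derivative[OF bounded_bilinear_inner this this]
  have "DERIV \<phi> 0 :> (Ahat - B) \<bullet> v + v \<bullet> (Ahat - B)"
    unfolding \<phi>_def has_real_derivative_iff_has_vector_derivative by (simp add: c(3))
  moreover have "\<phi> 0 \<le> \<phi> s" if s: "\<bar>0 - s\<bar> < e" for s
  proof -
    have "c 0 s \<in> orbit Ahat C" using s by (intro c(2)) auto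
    then obtain g where "g \<in> Aut C" "c 0 s = Ahat ** g" by (auto simp: orbit_def)
    then have "norm (Ahat - B) \<le> norm (c 0 s - B)" using At_close[OF n \<omega>] by (simp add: B_def)
    then show ?thesis by (simp add: \<phi>_def c(3) norm_le)
  qed
  ultimately have "(Ahat - B) \<bullet> v + v \<bullet> (Ahat - B) = 0"
    using DERIV_local_min[of \<phi> _ 0 e] e by blast
  then have "v \<bullet> (Ahat - B) = 0" by (simp add: inner_commute)
  then show "orthogonal v (At n \<omega> - Ahat)"
    by (simp add: orthogonal_def inner_diff_right B_def)
qed

lemma \<Gamma>_linear: "linear \<Gamma>"
  using has_hessianE[OF hessian] bounded_linear.linear by metis

lemma \<Gamma>_symmetric: "\<Gamma> u \<bullet> v = u \<bullet> \<Gamma> v"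
  by (rule has_hessian_symmetric[OF hessian])

text \<open>Compactness of the unit sphere of \<open>Tperp\<close> and homogeneity of degree two
  turn positivity into a uniform bound. If \<open>Tperp\<close> is trivial, any constant
  works.\<close>

lemma hessian_lower_bound: "\<exists>c>0. \<forall>v\<in>Tperp. c * (norm v)\<^sup>2 \<le> v \<bullet> \<Gamma> v"
proof (cases "Tperp \<inter> sphere 0 1 = {}")
  case True
  have "v = 0" if "v \<in> Tperp" for v
  proof (rule ccontr)
    assume "v \<noteq> 0"
    then have "(1 / norm v) *\<^sub>R v \<in> Tperp \<inter> sphere 0 1"
      using that subspace_scale[OF Tperp_subspace] by simp
    then show False using True by blast
  qed
  then have "1 * (norm v)\<^sup>2 \<le> v \<bullet> \<Gamma> v" if "v \<in> Tperp" for v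
    using that linear_0[OF \<Gamma>_linear] by force
  then show ?thesis using zero_less_one by blast
next
  case False
  have "compact (Tperp \<inter> sphere 0 1)"
    by (intro closed_Int_compact closed_subspace Tperp_subspace compact_sphere)
  moreover have "continuous_on (Tperp \<inter> sphere 0 1) (\<lambda>v. v \<bullet> \<Gamma> v)"
    using \<Gamma>_linear by (intro continuous_intros linear_continuous_on) (simp add: linear_conv_bounded_linear)
  ultimately obtain v0 where v0: "v0 \<in> Tperp" "norm v0 = 1"
    "\<And>v. v \<in> Tperp \<Longrightarrow> norm v = 1 \<Longrightarrow> v0 \<bullet> \<Gamma> v0 \<le> v \<bullet> \<Gamma> v"
    using continuous_attains_inf[OF _ False, of "\<lambda>v. v \<bullet> \<Gamma> v"] by auto
  have "v0 \<noteq> 0" using v0(2) by auto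
  then have pos: "v0 \<bullet> \<Gamma> v0 > 0" using hessian_pos v0(1) by (simp add: Tperp_def)
  have "(v0 \<bullet> \<Gamma> v0) * (norm v)\<^sup>2 \<le> v \<bullet> \<Gamma> v" if v: "v \<in> Tperp" for v
  proof (cases "v = 0")
    case False
    define w where "w = (1 / norm v) *\<^sub>R v"
    have w: "w \<in> Tperp" "norm w = 1" "v = norm v *\<^sub>R w"
      using v False subspace_scale[OF Tperp_subspace] by (auto simp: w_def)
    have "v \<bullet> \<Gamma> v = (w \<bullet> \<Gamma> w) * (norm v)\<^sup>2"
      by (subst (1 2) w(3)) (simp add: linear_cmul[OF \<Gamma>_linear] power2_eq_square)
    then show ?thesis using v0(3)[OF w(1,2)] by (simp add: mult_right_mono)
  qed (simp add: linear_0[OF \<Gamma>_linear])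
  then show ?thesis using pos by blast
qed

lemma \<Phi>_expansion:
  assumes "e > 0"
  shows "\<exists>d>0. \<forall>v. norm v < d \<longrightarrow> \<bar>\<Phi> (Ahat + v) - \<Phi> Ahat - (v \<bullet> \<Gamma> v) / 2\<bar> \<le> e * (norm v)\<^sup>2"
proof (rule has_hessian_critical_expansion[OF hessian _ assms])
  from hessian obtain D where D: "GDERIV \<Phi> Ahat :> D"
    unfolding has_hessian_def by (metis eventually_nhds_x_imp_x)
  then show "GDERIV \<Phi> Ahat :> 0" using GDERIV_minimum[OF D \<Phi>_min] by simp
qed

lemma \<Phi>_growth:
  "\<exists>c>0. \<exists>\<eta>>0. \<forall>v\<in>Tperp. norm v < \<eta> \<longrightarrow> c * (norm v)\<^sup>2 \<le> \<Phi> (Ahat + v) - \<Phi> Ahat"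
proof -
  obtain c where c: "c > 0" "\<And>v. v \<in> Tperp \<Longrightarrow> c * (norm v)\<^sup>2 \<le> v \<bullet> \<Gamma> v"
    using hessian_lower_bound by blast
  \<comment> \<open>The quadratic term is at least \<open>c / 2\<close> times the squared norm, and
    half of this is given up to the remainder.\<close>
  have c4: "c / 4 > 0" using c(1) by simp
  obtain d where d: "d > 0"
    "\<And>v. norm v < d \<Longrightarrow> \<bar>\<Phi> (Ahat + v) - \<Phi> Ahat - (v \<bullet> \<Gamma> v) / 2\<bar> \<le> c / 4 * (norm v)\<^sup>2"
    using \<Phi>_expansion[OF c4] by blast
  have "c / 4 * (norm v)\<^sup>2 \<le> \<Phi> (Ahat + v) - \<Phi> Ahat" if "v \<in> Tperp" "norm v < d" for v
  proof -
    have "- (c / 4 * (norm v)\<^sup>2) \<le> \<Phi> (Ahat + v) - \<Phi> Ahat - (v \<bullet> \<Gamma> v) / 2"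
      using d(2)[OF that(2)] by (simp only: abs_le_iff minus_le_iff)
    moreover have "c / 4 * (norm v)\<^sup>2 = (c * (norm v)\<^sup>2) / 4" by simp
    ultimately show ?thesis using c(2)[OF that(1)] by linarith
  qed
  then show ?thesis using c4 d(1) by blast
qed

text \<open>
  Peeling: the parameter space is cut into the shells \<open>2 ^ j \<le> sqrt n * norm (A - Ahat) < 2 ^ (j + 1)\<close>;
  on each shell the quadratic growth of the risk beats the fluctuations of the empirical process.
\<close>

lemma At_rate:
  assumes d: "d > 0" and K: "K > 0"
  shows "\<exists>b. \<exists>N\<ge>1. \<forall>n\<ge>N. \<exists>E\<in>events. prob E \<le> d \<and>
    (\<forall>\<omega>\<in>regular_event n K - E. sqrt n * norm (At n \<omega> - Ahat) \<le> b)"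
proof -
  let ?D = "DIM(real ^ 'q ^ 'd)"
  obtain c \<eta>0 where c: "c > 0" "\<eta>0 > 0"
    "\<And>v. v \<in> Tperp \<Longrightarrow> norm v < \<eta>0 \<Longrightarrow> c * (norm v)\<^sup>2 \<le> \<Phi> (Ahat + v) - \<Phi> Ahat"
    using \<Phi>_growth by blast
  \<comment> \<open>The outer radius of a shell is at most twice the norm of a point in it, so the
    bound \<open>1 / 2\<close> keeps the relevant radii at most 1, where the constant
    \<open>LA\<close> is valid.\<close>
  define \<eta> where "\<eta> = min \<eta>0 (1 / 2)"
  have \<eta>: "\<eta> > 0" "\<eta> \<le> \<eta>0" "\<eta> \<le> 1 / 2" using c(2) by (auto simp: \<eta>_def)
  obtain N where N: "N \<ge> 1" "\<And>n. n \<ge> N \<Longrightarrow> \<exists>E\<in>events. prob E \<le> d / 2 \<and>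
      (\<forall>\<omega>\<in>regular_event n K - E. norm (At n \<omega> - Ahat) < \<eta>)"
    using At_consistent[OF \<eta>(1) half_gt_zero[OF d] K] by blast
  define m where "m = 4 * ?D + 2"
  obtain B where B: "B \<ge> 0" "\<And>n (f :: real ^ 'q ^ 'd \<Rightarrow> (real ^ 'd) \<times> real \<Rightarrow> real) \<beta> l. n \<ge> 1 \<Longrightarrow> lipschitz_family LA f \<beta> \<Longrightarrow> l > 0 \<Longrightarrow>
    (\<exists>E\<in>events. prob E \<le> B * (1 / l) ^ m \<and>
      (\<forall>\<omega>\<in>regular_event n K - E. \<forall>\<theta>. norm \<theta> < 1 \<longrightarrow>
        \<bar>empirical_process n (f \<theta>) \<omega> - empirical_process n (f 0) \<omega>\<bar> \<le> 2 * l + K * LA * ?D))"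
    using empirical_process_uniform_bound[OF K LA_pos, where 'b = "real ^ 'q ^ 'd"] unfolding m_def by blast
  \<comment> \<open>In shell \<open>j\<close> the threshold is \<open>\<tau> * 2 ^ j\<close>,
    growing with \<open>j\<close> to make the probabilities summable. It contributes
    \<open>2 ^ Suc j * 2 * \<tau> * 2 ^ j = c / 4 * (2 ^ j)\<^sup>2\<close>, a quarter of the
    quadratic growth.\<close>
  define \<tau> where "\<tau> = c / 16"
  have \<tau>: "\<tau> > 0" using c(1) by (simp add: \<tau>_def)
  define Q where "Q = B * (1 / \<tau>) ^ m"
  have Q: "Q \<ge> 0" using B(1) \<tau> by (simp add: Q_def)
  define V where "V = K * LA * ?D"
  have V: "V \<ge> 0" using K LA_pos by (simp add: V_def)
  \<comment> \<open>The innermost shell is chosen so far out that the term with \<open>V\<close>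
    uses less than half of the quadratic growth and the exceptional sets of all shells together have
    probability below \<open>d / 2\<close>.\<close>
  have "\<forall>\<^sub>F J in sequentially. 4 * V / c < 2 ^ J"
  proof -
    obtain J0 where "4 * V / c < 2 ^ J0" using real_arch_pow[of 2 "4 * V / c"] by auto
    then have "4 * V / c < 2 ^ J" if "J \<ge> J0" for J
      using power_increasing[OF that, of "2 :: real"] by linarith
    then show ?thesis by (rule eventually_sequentiallyI)
  qed
  moreover have "\<forall>\<^sub>F J in sequentially. Q * (2 * (1 / 2) ^ J) < d / 2"
  proof -
    have "(\<lambda>J. Q * (2 * (1 / 2) ^ J)) \<longlonglongrightarrow> Q * (2 * 0)"
      by (intro tendsto_mult tendsto_const LIMSEQ_realpow_zero) auto
    then show ?thesis using d by (intro order_tendstoD(2)[of _ 0]) simp_all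
  qed
  ultimately obtain J where J: "4 * V / c < 2 ^ J" "Q * (2 * (1 / 2) ^ J) < d / 2"
    using eventually_happens[OF eventually_conj] by (metis (mono_tags, lifting) sequentially_bot)
  have "\<exists>E\<in>events. prob E \<le> d \<and> (\<forall>\<omega>\<in>regular_event n K - E. sqrt n * norm (At n \<omega> - Ahat) \<le> 2 ^ J)"
    if n: "n \<ge> N" for n
  proof -
    have n1: "n \<ge> 1" "sqrt n > 0" using n N(1) by auto
    obtain E1 where E1: "E1 \<in> events" "prob E1 \<le> d / 2" "\<And>\<omega>. \<omega> \<in> regular_event n K - E1 \<Longrightarrow> norm (At n \<omega> - Ahat) < \<eta>"
      using N(2)[OF n] by blast
    define \<rho> where "\<rho> j = 2 ^ Suc j / sqrt n" for j
    have \<rho>: "\<rho> j > 0" for j using n1 by (simp add: \<rho>_def)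
    have shells: "\<exists>E\<in>events. prob E \<le> Q * (1 / 2) ^ j \<and> (\<rho> j \<le> 1 \<longrightarrow> (\<forall>\<omega>\<in>regular_event n K - E. \<forall>\<theta>. norm \<theta> < 1 \<longrightarrow>
        \<bar>empirical_process n (\<lambda>z. loss (Ahat + \<rho> j *\<^sub>R \<theta>) z - loss Ahat z) \<omega>\<bar> \<le> \<rho> j * (2 * (\<tau> * 2 ^ j) + V)))" for j
    proof (cases "\<rho> j \<le> 1")
      case True
      have fam: "lipschitz_family LA (\<lambda>a z. (loss (Ahat + \<rho> j *\<^sub>R a) z - loss Ahat z) / \<rho> j)
          (\<lambda>a. - 2 * (\<integral>u. hC (Ahat + \<rho> j *\<^sub>R a) u - hC Ahat u \<partial>sphere_uniform) / \<rho> j)"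
        unfolding LA_def using True by (intro loss_family[OF \<rho>]) simp
      have l: "\<tau> * 2 ^ j > 0" using \<tau> by simp
      obtain E where E: "E \<in> events" "prob E \<le> B * (1 / (\<tau> * 2 ^ j)) ^ m"
        "\<And>\<omega> \<theta>. \<omega> \<in> regular_event n K - E \<Longrightarrow> norm \<theta> < 1 \<Longrightarrow>
          \<bar>empirical_process n (\<lambda>z. (loss (Ahat + \<rho> j *\<^sub>R \<theta>) z - loss Ahat z) / \<rho> j) \<omega>
            - empirical_process n (\<lambda>z. (loss (Ahat + \<rho> j *\<^sub>R 0) z - loss Ahat z) / \<rho> j) \<omega>\<bar> \<le> 2 * (\<tau> * 2 ^ j) + V"
        using B(2)[OF n1(1) fam l] unfolding V_def by blast
      have "\<bar>empirical_process n (\<lambda>z. loss (Ahat + \<rho> j *\<^sub>R \<theta>) z - loss Ahat z) \<omega>\<bar> \<le> \<rho> j * (2 * (\<tau> * 2 ^ j) + V)"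
        if "\<omega> \<in> regular_event n K - E" "norm \<theta> < 1" for \<omega> \<theta>
      proof -
        have "\<bar>empirical_process n (\<lambda>z. loss (Ahat + \<rho> j *\<^sub>R \<theta>) z - loss Ahat z) \<omega> / \<rho> j\<bar> \<le> 2 * (\<tau> * 2 ^ j) + V"
          using E(3)[OF that] unfolding empirical_process_scaled by (simp add: empirical_process_def[of n "\<lambda>z. 0"])
        then show ?thesis using \<rho>[of j] by (simp add: abs_divide pos_divide_le_eq mult.commute)
      qed
      moreover have "B * (1 / (\<tau> * 2 ^ j)) ^ m \<le> Q * (1 / 2) ^ j"
      proof -
        have "(1 / (\<tau> * 2 ^ j)) ^ m = (1 / \<tau>) ^ m * ((1 / 2) ^ j) ^ m"
          by (simp add: power_divide power_mult_distrib)
        moreover have "((1 / 2 :: real) ^ j) ^ m \<le> ((1 / 2) ^ j) ^ 1"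
          by (rule power_decreasing) (auto simp: m_def power_le_one)
        ultimately have "B * (1 / (\<tau> * 2 ^ j)) ^ m \<le> B * ((1 / \<tau>) ^ m * (1 / 2) ^ j)"
          using B(1) \<tau> by (simp only: power_one_right) (intro mult_left_mono, auto)
        then show ?thesis by (simp add: Q_def mult.assoc)
      qed
      ultimately show ?thesis using E(1,2) by (intro bexI[of _ E]) auto
    next
      case False
      \<comment> \<open>Shells of radius above 1 carry no bound; consistency keeps the estimator out
        of them.\<close>
      then show ?thesis using Q by (intro bexI[of _ "{}"]) auto
    qed
    define shell where "shell j E \<longleftrightarrow> E \<in> events \<and> prob E \<le> Q * (1 / 2) ^ j \<and> (\<rho> j \<le> 1 \<longrightarrow> (\<forall>\<omega>\<in>regular_event n K - E. \<forall>\<theta>. norm \<theta> < 1 \<longrightarrow>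
        \<bar>empirical_process n (\<lambda>z. loss (Ahat + \<rho> j *\<^sub>R \<theta>) z - loss Ahat z) \<omega>\<bar> \<le> \<rho> j * (2 * (\<tau> * 2 ^ j) + V)))" for j E
    have "\<exists>E. shell j E" for j using shells[of j] unfolding shell_def by blast
    then obtain E2 where "\<And>j. shell j (E2 j)" by metis
    then have E2: "\<And>j. E2 j \<in> events" "\<And>j. prob (E2 j) \<le> Q * (1 / 2) ^ j"
      "\<And>j \<omega> \<theta>. \<rho> j \<le> 1 \<Longrightarrow> \<omega> \<in> regular_event n K - E2 j \<Longrightarrow> norm \<theta> < 1 \<Longrightarrow>
        \<bar>empirical_process n (\<lambda>z. loss (Ahat + \<rho> j *\<^sub>R \<theta>) z - loss Ahat z) \<omega>\<bar> \<le> \<rho> j * (2 * (\<tau> * 2 ^ j) + V)"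
      unfolding shell_def by blast+
    define E3 where "E3 = (\<Union>i. E2 (J + i))"
    have E3: "E3 \<in> events" unfolding E3_def using E2(1) by auto
    have sums: "(\<lambda>i. Q * (1 / 2) ^ (J + i)) sums (Q * (2 * (1 / 2) ^ J))"
      by (rule sums_mult[OF geometric_tail_sum])
    have sm: "summable (\<lambda>i. prob (E2 (J + i)))"
      by (rule summable_comparison_test'[OF sums_summable[OF sums], where N = 0]) (use E2(2) in auto)
    have "prob E3 \<le> (\<Sum>i. prob (E2 (J + i)))"
      unfolding E3_def using E2(1) by (intro finite_measure_subadditive_countably[OF _ sm]) auto
    also have "\<dots> \<le> (\<Sum>i. Q * (1 / 2) ^ (J + i))"
      by (rule suminf_le[OF E2(2) sm sums_summable[OF sums]])
    also have "\<dots> = Q * (2 * (1 / 2) ^ J)" using sums by (simp add: sums_iff)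
    finally have PE3: "prob E3 \<le> d / 2" using J(2) by simp
    have "sqrt n * norm (At n \<omega> - Ahat) \<le> 2 ^ J" if \<omega>: "\<omega> \<in> regular_event n K - (E1 \<union> E3)" for \<omega>
    proof (rule ccontr)
      assume contr: "\<not> sqrt n * norm (At n \<omega> - Ahat) \<le> 2 ^ J"
      have \<omega>M: "\<omega> \<in> space M" using \<omega> by (simp add: regular_event_def)
      define v where "v = At n \<omega> - Ahat"
      define x where "x = sqrt n * norm v"
      have x: "2 ^ J < x" using contr by (simp add: x_def v_def)
      have "(1::real) \<le> 2 ^ J" by (rule one_le_power) simp
      then have "1 \<le> x" using x by linarith
      \<comment> \<open>The shell of \<open>x\<close> is found as the binary exponent of its
        floor.\<close>
      then have "1 \<le> nat \<lfloor>x\<rfloor>" by (simp add: nat_le_eq_zle le_floor_iff le_nat_iff)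
      then obtain j where j: "2 ^ j \<le> nat \<lfloor>x\<rfloor>" "nat \<lfloor>x\<rfloor> < 2 ^ (j + 1)"
        using ex_power_ivl1[of 2 "nat \<lfloor>x\<rfloor>"] by auto
      have jx: "2 ^ j \<le> x" "x < 2 ^ Suc j"
      proof -
        have x0: "x \<ge> 0" by (simp add: x_def)
        have "real (2 ^ j) \<le> real (nat \<lfloor>x\<rfloor>)" using j(1) by (rule of_nat_mono)
        also have "\<dots> \<le> x" using x0 by simp
        finally show "2 ^ j \<le> x" by simp
        have "Suc (nat \<lfloor>x\<rfloor>) \<le> 2 ^ Suc j" using j(2) by simp
        then have "real (Suc (nat \<lfloor>x\<rfloor>)) \<le> real (2 ^ Suc j)" by (rule of_nat_mono)
        moreover have "x < real (Suc (nat \<lfloor>x\<rfloor>))" using x0 by simp linarith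
        ultimately show "x < 2 ^ Suc j" by simp
      qed
      have "J \<le> j"
      proof (rule ccontr)
        assume "\<not> J \<le> j"
        then have "(2::real) ^ Suc j \<le> 2 ^ J" by (intro power_increasing) auto
        then show False using jx(2) x by simp
      qed
      have v\<eta>: "norm v < \<eta>" using E1(3) \<omega> by (simp add: v_def)
      have v\<rho>: "norm v < \<rho> j" using jx(2) n1(2) by (simp add: \<rho>_def x_def pos_less_divide_eq mult.commute)
      have "\<rho> j \<le> 2 * norm v"
        using jx(1) n1(2) by (simp add: \<rho>_def x_def pos_divide_le_eq mult.commute)
      then have \<rho>1: "\<rho> j \<le> 1" using v\<eta> \<eta>(3) by simp
      define \<theta> where "\<theta> = (1 / \<rho> j) *\<^sub>R v"
      have \<theta>: "norm \<theta> < 1" "Ahat + \<rho> j *\<^sub>R \<theta> = At n \<omega>" using \<rho>[of j] v\<rho> by (auto simp: \<theta>_def v_def)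
      have "\<omega> \<notin> E2 j"
      proof
        assume "\<omega> \<in> E2 j"
        then have "\<omega> \<in> E2 (J + (j - J))" using \<open>J \<le> j\<close> by simp
        then show False using \<omega> unfolding E3_def by blast
      qed
      then have emp: "\<bar>empirical_process n (\<lambda>z. loss (At n \<omega>) z - loss Ahat z) \<omega>\<bar> \<le> \<rho> j * (2 * (\<tau> * 2 ^ j) + V)"
        using E2(3)[OF \<rho>1 _ \<theta>(1)] \<omega> unfolding \<theta>(2) by blast
      have "c * (norm v)\<^sup>2 \<le> \<Phi> (At n \<omega>) - \<Phi> Ahat"
        using c(3)[OF At_perp[OF n1(1) \<omega>M]] v\<eta> \<eta>(2) by (simp add: v_def)
      then have "n * (c * (norm v)\<^sup>2) \<le> n * (\<Phi> (At n \<omega>) - \<Phi> Ahat)" by (intro mult_left_mono) auto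
      moreover have "sqrt n * empirical_process n (\<lambda>z. loss (At n \<omega>) z - loss Ahat z) \<omega> + n * (\<Phi> (At n \<omega>) - \<Phi> Ahat) \<le> 0"
        using At_min[OF n1(1) \<omega>M, of Ahat] unfolding loss_sum_diff[OF n1(1), symmetric] by simp
      moreover have "sqrt n * - (\<rho> j * (2 * (\<tau> * 2 ^ j) + V)) \<le> sqrt n * empirical_process n (\<lambda>z. loss (At n \<omega>) z - loss Ahat z) \<omega>"
        using emp n1 by (intro mult_left_mono) auto
      ultimately have "n * (c * (norm v)\<^sup>2) \<le> sqrt n * (\<rho> j * (2 * (\<tau> * 2 ^ j) + V))" by simp
      moreover have "sqrt n * (\<rho> j * (2 * (\<tau> * 2 ^ j) + V)) = 2 ^ Suc j * (2 * (\<tau> * 2 ^ j) + V)"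
        using n1 by (simp add: \<rho>_def)
      moreover have "n * (c * (norm v)\<^sup>2) = c * x\<^sup>2" by (simp add: x_def power_mult_distrib)
      moreover have "c * (2 ^ j)\<^sup>2 \<le> c * x\<^sup>2"
        using jx(1) c(1) by (intro mult_left_mono power_mono) auto
      ultimately have "c * (2 ^ j)\<^sup>2 \<le> 2 ^ Suc j * (2 * (\<tau> * 2 ^ j) + V)" by linarith
      then have "2 ^ j * (c * 2 ^ j) \<le> 2 ^ j * (c / 4 * 2 ^ j + 2 * V)"
        by (simp add: \<tau>_def power2_eq_square algebra_simps)
      then have "c * 2 ^ j \<le> c / 4 * 2 ^ j + 2 * V" by simp
      moreover have "4 * V < c * 2 ^ j"
      proof -
        have "4 * V < 2 ^ J * c" using J(1) c(1) by (simp add: pos_divide_less_eq)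
        also have "\<dots> \<le> 2 ^ j * c" using \<open>J \<le> j\<close> c(1) by (intro mult_right_mono power_increasing) auto
        finally show ?thesis by (simp add: mult.commute)
      qed
      moreover have "c * 2 ^ j > 0" using c(1) by simp
      ultimately show False by simp
    qed
    moreover have "prob (E1 \<union> E3) \<le> d" using measure_Un_le[OF E1(1) E3] E1(2) PE3 by simp
    ultimately show ?thesis using E1(1) E3 by (intro bexI[of _ "E1 \<union> E3"]) auto
  qed
  then show ?thesis using N(1) by blast
qed

end

section \<open>Quadratic approximation of the empirical risk and linearization\<close>

context shape_normality begin

lemma score_indep: "indep_vars (\<lambda>_. borel) (\<lambda>i \<omega>. grad (\<zeta> i \<omega>)) UNIV"
  by (rule indep_vars_compose2[OF indep]) simp

lemma score_second_moment:
  "integrable M (\<lambda>\<omega>. (grad (\<zeta> i \<omega>) \<bullet> h)\<^sup>2)"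
  "expectation (\<lambda>\<omega>. (grad (\<zeta> i \<omega>) \<bullet> h)\<^sup>2) = (\<integral>z. (h \<bullet> grad z)\<^sup>2 \<partial>(sphere_uniform \<Otimes>\<^sub>M \<nu>))"
  using integral_sample[of "\<lambda>z. (grad z \<bullet> h)\<^sup>2" i] grad_square_integrable[of h]
  by (simp_all add: inner_commute)

lemma score_mean: "expectation (\<lambda>\<omega>. grad (\<zeta> i \<omega>) \<bullet> h) = 0"
  using integral_sample(1)[of "\<lambda>z. grad z \<bullet> h" i] grad_expectation[of h] by (simp add: inner_commute)

lemma score_bounded:
  assumes "d > 0"
  shows "\<exists>s>0. \<forall>n\<ge>1. prob {\<omega> \<in> space M. norm (scaled_score n \<omega>) \<ge> s} \<le> d"
proof -
  define q where "q h = (\<integral>z. (h \<bullet> grad z)\<^sup>2 \<partial>(sphere_uniform \<Otimes>\<^sub>M \<nu>))" for h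
  define t where "t = (\<Sum>b\<in>Basis. q b) + 1"
  have "q h \<ge> 0" for h unfolding q_def by (rule integral_nonneg_AE) simp
  then have t: "t > 0" "(\<Sum>b\<in>Basis. q b) \<le> t" by (simp_all add: t_def add_nonneg_pos sum_nonneg)
  define s where "s = sqrt (t / d)"
  have s: "s > 0" "t / s\<^sup>2 = d" using t(1) assms by (simp_all add: s_def)
  have "prob {\<omega> \<in> space M. norm (scaled_score n \<omega>) \<ge> s} \<le> d" if n: "n \<ge> 1" for n
  proof -
    note second = normalized_sum_second_moment[OF score_indep score_second_moment(1) score_mean score_second_moment(2) n,
        folded scaled_score_def q_def]
    have "prob {\<omega> \<in> space M. \<bar>norm (scaled_score n \<omega>)\<bar> \<ge> s} \<le> expectation (\<lambda>\<omega>. (norm (scaled_score n \<omega>))\<^sup>2) / s\<^sup>2"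
      by (rule prob_abs_ge_second_moment[OF _ second(1) s(1)]) measurable
    also have "\<dots> \<le> t / s\<^sup>2" unfolding second(2) using t(2) by (rule divide_right_mono) simp
    finally show ?thesis using s(2) by simp
  qed
  then show ?thesis using s(1) by blast
qed

text \<open>The error is split into three parts of size \<open>\<kappa> / 3\<close>: the local
  process between \<open>h\<close> and its truncation by chaining, the linear form between them by
  Cauchy-Schwarz, and the finitely many net points by pointwise convergence. The level
  \<open>k\<close> is fixed before \<open>n\<close> grows.\<close>

lemma local_process_uniform:
  assumes b: "b > 0" and \<kappa>: "\<kappa> > 0" and d: "d > 0" and K: "K > 0"
  shows "\<exists>N\<ge>1. \<forall>n\<ge>N. \<exists>E\<in>events. prob E \<le> d \<and>
    (\<forall>\<omega>\<in>regular_event n K - E. \<forall>h. norm h \<le> b \<longrightarrow> \<bar>local_process n h \<omega> - h \<bullet> scaled_score n \<omega>\<bar> \<le> \<kappa>)"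
proof -
  let ?D = "DIM(real ^ 'q ^ 'd)"
  have d3: "d / 3 > 0" and \<kappa>3: "\<kappa> / 3 > 0" using d \<kappa> by auto
  obtain s where s: "s > 0" "\<And>n. n \<ge> 1 \<Longrightarrow> prob {\<omega> \<in> space M. norm (scaled_score n \<omega>) \<ge> s} \<le> d / 3"
    using score_bounded[OF d3] by blast
  obtain B where B: "B \<ge> 0" "\<And>n (f :: real ^ 'q ^ 'd \<Rightarrow> (real ^ 'd) \<times> real \<Rightarrow> real) \<beta> l k. n \<ge> 1 \<Longrightarrow> lipschitz_family LA f \<beta> \<Longrightarrow> l > 0 \<Longrightarrow>
    (\<exists>E\<in>events. prob E \<le> B * (1 / l) ^ (4 * ?D + 2) * (1 / 2) ^ k \<and>
      (\<forall>\<omega>\<in>regular_event n K - E. \<forall>\<theta>\<in>cball 0 1.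
        \<bar>empirical_process n (f \<theta>) \<omega> - empirical_process n (f (dyadic_trunc k \<theta>)) \<omega>\<bar>
          \<le> (2 * l + K * LA * ?D) / 2 ^ k))"
    using empirical_process_modulus[OF K LA_pos, where 'b = "real ^ 'q ^ 'd"] by blast
  \<comment> \<open>The chaining threshold is \<open>l = 1\<close>; the smallness comes from the
    level \<open>k\<close> instead.\<close>
  define V where "V = 2 * 1 + K * LA * ?D"
  have V: "V \<ge> 0" using K LA_pos by (simp add: V_def)
  \<comment> \<open>Collects the constants that \<open>(1 / 2) ^ k\<close> has to beat: the
    probability of the chaining exception and the two truncation errors.\<close>
  define W where "W = B + b * V + b * ?D * s"
  have "(\<lambda>k. W * (1 / 2) ^ k) \<longlonglongrightarrow> W * 0"
    by (intro tendsto_mult tendsto_const LIMSEQ_realpow_zero) auto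
  then have "\<forall>\<^sub>F k in sequentially. W * (1 / 2) ^ k < min (d / 3) (\<kappa> / 3)"
    using d3 \<kappa>3 by (intro order_tendstoD(2)[of _ 0]) simp_all
  then obtain k where k: "W * (1 / 2) ^ k < min (d / 3) (\<kappa> / 3)"
    using eventually_happens'[OF sequentially_bot] by blast
  have small: "x * (1 / 2) ^ k \<le> d / 3" "x * (1 / 2) ^ k \<le> \<kappa> / 3" if "x \<le> W" for x
  proof -
    have "x * (1 / 2) ^ k \<le> W * (1 / 2) ^ k" using that by (intro mult_right_mono) auto
    then show "x * (1 / 2) ^ k \<le> d / 3" "x * (1 / 2) ^ k \<le> \<kappa> / 3"
      using k unfolding min_less_iff_conj by linarith+
  qed
  have BW: "B \<le> W" "b * V \<le> W" "b * ?D * s \<le> W" using B(1) b V s(1) by (auto simp: W_def)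
  define F where "F n = (\<Union>a\<in>(dyadic_net k :: (real ^ 'q ^ 'd) set).
      {\<omega> \<in> space M. \<bar>local_process n (b *\<^sub>R a) \<omega> - (b *\<^sub>R a) \<bullet> scaled_score n \<omega>\<bar> \<ge> \<kappa> / 3})" for n
  have F: "F n \<in> events" for n unfolding F_def using finite_dyadic_net by (intro sets.finite_UN) auto
  have "(\<lambda>n. \<Sum>a\<in>(dyadic_net k :: (real ^ 'q ^ 'd) set).
      prob {\<omega> \<in> space M. \<bar>local_process n (b *\<^sub>R a) \<omega> - (b *\<^sub>R a) \<bullet> scaled_score n \<omega>\<bar> \<ge> \<kappa> / 3}) \<longlonglongrightarrow> (\<Sum>a\<in>(dyadic_net k :: (real ^ 'q ^ 'd) set). 0)"
    by (intro tendsto_sum local_process_pointwise \<kappa>3)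
  then have "\<forall>\<^sub>F n in sequentially. (\<Sum>a\<in>(dyadic_net k :: (real ^ 'q ^ 'd) set).
      prob {\<omega> \<in> space M. \<bar>local_process n (b *\<^sub>R a) \<omega> - (b *\<^sub>R a) \<bullet> scaled_score n \<omega>\<bar> \<ge> \<kappa> / 3}) < d / 3"
    using d3 by (intro order_tendstoD(2)[of _ 0]) simp_all
  then obtain N0 where N0: "\<And>n. n \<ge> N0 \<Longrightarrow> (\<Sum>a\<in>(dyadic_net k :: (real ^ 'q ^ 'd) set).
      prob {\<omega> \<in> space M. \<bar>local_process n (b *\<^sub>R a) \<omega> - (b *\<^sub>R a) \<bullet> scaled_score n \<omega>\<bar> \<ge> \<kappa> / 3}) < d / 3"
    by (auto simp: eventually_sequentially)
  have PF: "prob (F n) \<le> d / 3" if "n \<ge> N0" for n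
  proof -
    have "prob (F n) \<le> (\<Sum>a\<in>(dyadic_net k :: (real ^ 'q ^ 'd) set).
      prob {\<omega> \<in> space M. \<bar>local_process n (b *\<^sub>R a) \<omega> - (b *\<^sub>R a) \<bullet> scaled_score n \<omega>\<bar> \<ge> \<kappa> / 3})"
      unfolding F_def by (rule finite_measure_subadditive_finite[OF finite_dyadic_net]) auto
    then show ?thesis using N0[OF that] by simp
  qed
  \<comment> \<open>The condition \<open>b\<^sup>2 \<le> n\<close> makes the radius
    \<open>b / sqrt n\<close> of the rescaled ball at most 1, as \<open>LA\<close> requires.\<close>
  define N where "N = max (max N0 1) (nat \<lceil>b\<^sup>2\<rceil>)"
  have "\<exists>E\<in>events. prob E \<le> d \<and>
    (\<forall>\<omega>\<in>regular_event n K - E. \<forall>h. norm h \<le> b \<longrightarrow> \<bar>local_process n h \<omega> - h \<bullet> scaled_score n \<omega>\<bar> \<le> \<kappa>)"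
    if n: "n \<ge> N" for n
  proof -
    have n1: "n \<ge> 1" "n \<ge> N0" "sqrt n > 0" using n by (auto simp: N_def)
    have "b\<^sup>2 \<le> n" using n by (simp add: N_def)
    then have bn: "b \<le> sqrt n" by (rule real_le_rsqrt)
    define \<rho> where "\<rho> = b / sqrt n"
    have \<rho>: "\<rho> > 0" "\<rho> \<le> 1" using b bn n1 by (simp_all add: \<rho>_def)
    have fam: "lipschitz_family LA (\<lambda>a z. (loss (Ahat + \<rho> *\<^sub>R a) z - loss Ahat z) / \<rho>)
        (\<lambda>a. - 2 * (\<integral>u. hC (Ahat + \<rho> *\<^sub>R a) u - hC Ahat u \<partial>sphere_uniform) / \<rho>)"
      unfolding LA_def using \<rho> by (intro loss_family) auto
    obtain E1 where E1: "E1 \<in> events" "prob E1 \<le> B * (1 / 1) ^ (4 * ?D + 2) * (1 / 2) ^ k"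
      "\<And>\<omega> a. \<omega> \<in> regular_event n K - E1 \<Longrightarrow> a \<in> cball 0 1 \<Longrightarrow>
        \<bar>empirical_process n (\<lambda>z. (loss (Ahat + \<rho> *\<^sub>R a) z - loss Ahat z) / \<rho>) \<omega>
          - empirical_process n (\<lambda>z. (loss (Ahat + \<rho> *\<^sub>R dyadic_trunc k a) z - loss Ahat z) / \<rho>) \<omega>\<bar> \<le> V / 2 ^ k"
      using B(2)[OF n1(1) fam zero_less_one, of k] unfolding V_def by blast
    have PE1: "prob E1 \<le> d / 3" using E1(2) small(1)[OF BW(1)] by simp
    define E2 where "E2 = {\<omega> \<in> space M. norm (scaled_score n \<omega>) \<ge> s}"
    have E2: "E2 \<in> events" "prob E2 \<le> d / 3" unfolding E2_def using s(2)[OF n1(1)] by auto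
    have LP: "local_process n (b *\<^sub>R a) \<omega> = b * empirical_process n (\<lambda>z. (loss (Ahat + \<rho> *\<^sub>R a) z - loss Ahat z) / \<rho>) \<omega>" for a \<omega>
      unfolding empirical_process_scaled local_process_def using b n1 by (simp add: \<rho>_def)
    have "\<bar>local_process n h \<omega> - h \<bullet> scaled_score n \<omega>\<bar> \<le> \<kappa>"
      if \<omega>: "\<omega> \<in> regular_event n K - (E1 \<union> E2 \<union> F n)" and h: "norm h \<le> b" for \<omega> h
    proof -
      have \<omega>M: "\<omega> \<in> space M" using \<omega> by (simp add: regular_event_def)
      define a where "a = (1 / b) *\<^sub>R h"
      have a: "a \<in> cball 0 1" "h = b *\<^sub>R a" using b h by (auto simp: a_def)
      define p where "p = dyadic_trunc k a"
      have p: "p \<in> dyadic_net k" using a(1) by (simp add: p_def dyadic_net_def)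
      have 1: "\<bar>local_process n (b *\<^sub>R a) \<omega> - local_process n (b *\<^sub>R p) \<omega>\<bar> \<le> \<kappa> / 3"
      proof -
        have "b * \<bar>empirical_process n (\<lambda>z. (loss (Ahat + \<rho> *\<^sub>R a) z - loss Ahat z) / \<rho>) \<omega>
          - empirical_process n (\<lambda>z. (loss (Ahat + \<rho> *\<^sub>R p) z - loss Ahat z) / \<rho>) \<omega>\<bar> \<le> b * (V / 2 ^ k)"
          unfolding p_def using E1(3) \<omega> a(1) b by (intro mult_left_mono) auto
        also have "\<dots> = b * V * (1 / 2) ^ k" by (simp add: power_divide)
        also have "\<dots> \<le> \<kappa> / 3" by (rule small(2)[OF BW(2)])
        finally show ?thesis unfolding LP right_diff_distrib[symmetric] using b by (simp add: abs_mult)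
      qed
      have 2: "\<bar>(b *\<^sub>R a) \<bullet> scaled_score n \<omega> - (b *\<^sub>R p) \<bullet> scaled_score n \<omega>\<bar> \<le> \<kappa> / 3"
      proof -
        have "\<bar>(b *\<^sub>R a) \<bullet> scaled_score n \<omega> - (b *\<^sub>R p) \<bullet> scaled_score n \<omega>\<bar> = b * \<bar>(a - p) \<bullet> scaled_score n \<omega>\<bar>"
          using b by (simp add: inner_diff_left abs_mult right_diff_distrib[symmetric])
        also have "\<dots> \<le> b * (norm (a - p) * norm (scaled_score n \<omega>))"
          using b by (intro mult_left_mono Cauchy_Schwarz_ineq2) auto
        also have "\<dots> \<le> b * (?D / 4 ^ k * s)"
          using b s(1) \<omega> \<omega>M norm_diff_dyadic_trunc_le[of a k]
          by (intro mult_left_mono mult_mono) (auto simp: E2_def p_def)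
        also have "\<dots> \<le> b * (?D / 2 ^ k * s)"
          using b s(1) by (intro mult_left_mono mult_right_mono divide_left_mono power_mono) auto
        also have "\<dots> = b * ?D * s * (1 / 2) ^ k" by (simp add: power_divide)
        also have "\<dots> \<le> \<kappa> / 3" by (rule small(2)[OF BW(3)])
        finally show ?thesis .
      qed
      have 3: "\<bar>local_process n (b *\<^sub>R p) \<omega> - (b *\<^sub>R p) \<bullet> scaled_score n \<omega>\<bar> \<le> \<kappa> / 3"
      proof -
        have "\<omega> \<notin> {\<omega> \<in> space M. \<bar>local_process n (b *\<^sub>R p) \<omega> - (b *\<^sub>R p) \<bullet> scaled_score n \<omega>\<bar> \<ge> \<kappa> / 3}"
          using \<omega> p unfolding F_def by blast
        then show ?thesis using \<omega>M by simp
      qed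
      have "\<bar>x - y\<bar> \<le> \<kappa>" if "\<bar>x - x'\<bar> \<le> \<kappa> / 3" "\<bar>y - y'\<bar> \<le> \<kappa> / 3" "\<bar>x' - y'\<bar> \<le> \<kappa> / 3" for x x' y y' :: real
        using that by linarith
      from this[OF 1 2 3] show ?thesis unfolding a(2) .
    qed
    moreover have "prob (E1 \<union> E2 \<union> F n) \<le> d"
      using measure_Un_le[OF sets.Un[OF E1(1) E2(1)] F[of n]] measure_Un_le[OF E1(1) E2(1)] PE1 E2(2) PF[OF n1(2)] by linarith
    ultimately show ?thesis using E1(1) E2(1) F by (intro bexI[of _ "E1 \<union> E2 \<union> F n"]) auto
  qed
  moreover have "N \<ge> 1" by (simp add: N_def)
  ultimately show ?thesis by blast
qed

abbreviation "\<Gamma>inv \<equiv> compression_inverse Tperp \<Gamma>"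

lemma \<Gamma>_pos: "h \<in> Tperp \<Longrightarrow> h \<noteq> 0 \<Longrightarrow> h \<bullet> \<Gamma> h > 0"
  using hessian_pos by (simp add: Tperp_def)

lemma \<Gamma>inv_in: "\<Gamma>inv x \<in> Tperp"
  by (rule compression_inverse_in[OF Tperp_subspace \<Gamma>_linear \<Gamma>_symmetric]) (rule \<Gamma>_pos)

lemma \<Gamma>inv_inner: "v \<in> Tperp \<Longrightarrow> v \<bullet> \<Gamma> (\<Gamma>inv x) = v \<bullet> x"
  by (rule compression_inverse_inner[OF Tperp_subspace \<Gamma>_linear \<Gamma>_symmetric]) (rule \<Gamma>_pos)

lemma \<Gamma>inv_linear: "linear \<Gamma>inv"
  by (rule linear_compression_inverse[OF Tperp_subspace \<Gamma>_linear \<Gamma>_symmetric]) (rule \<Gamma>_pos)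

lemma \<Gamma>inv_symmetric: "\<Gamma>inv x \<bullet> y = x \<bullet> \<Gamma>inv y"
  by (rule compression_inverse_symmetric[OF Tperp_subspace \<Gamma>_linear \<Gamma>_symmetric]) (rule \<Gamma>_pos)

text \<open>Completing the square: \<open>k\<close> is the critical point of the form on
  \<open>Tperp\<close>, so the linear term of the expansion around it vanishes in the directions of
  \<open>Tperp\<close>.\<close>

lemma quadratic_identity:
  assumes h: "h \<in> Tperp" and k: "k = - \<Gamma>inv s"
  shows "(h \<bullet> s + (h \<bullet> \<Gamma> h) / 2) - (k \<bullet> s + (k \<bullet> \<Gamma> k) / 2) = ((h - k) \<bullet> \<Gamma> (h - k)) / 2"
proof -
  have kT: "k \<in> Tperp" unfolding k by (intro subspace_neg Tperp_subspace \<Gamma>inv_in)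
  have ks: "v \<bullet> s = - (v \<bullet> \<Gamma> k)" if "v \<in> Tperp" for v
    using \<Gamma>inv_inner[OF that, of s] by (simp add: k linear_neg[OF \<Gamma>_linear])
  have "k \<bullet> \<Gamma> h = h \<bullet> \<Gamma> k" using \<Gamma>_symmetric[of k h] by (simp add: inner_commute)
  then show ?thesis
    unfolding ks[OF h] ks[OF kT]
    by (simp add: linear_diff[OF \<Gamma>_linear] inner_diff_left inner_diff_right field_simps)
qed

text \<open>The rescaled estimator \<open>h\<close> and the minimizer \<open>k\<close> of the
  quadratic form both lie in \<open>Tperp\<close> and in one ball, on which the empirical increment
  \<open>L\<close> is within \<open>2 * \<kappa>\<close> of the form. Minimality of the estimator
  bounds the gap of the form by \<open>4 * \<kappa>\<close>, and strict convexity on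
  \<open>Tperp\<close> turns the gap into a distance.\<close>

lemma At_linearization:
  assumes e: "e > 0"
  shows "(\<lambda>n. prob {\<omega> \<in> space M. norm (sqrt n *\<^sub>R (At n \<omega> - Ahat) - - \<Gamma>inv (scaled_score n \<omega>)) > e}) \<longlonglongrightarrow> 0"
proof (rule LIMSEQ_I)
  fix d' :: real assume "d' > 0"
  \<comment> \<open>Four exceptional sets of probability at most \<open>d\<close> leave a strict
    margin.\<close>
  define d where "d = d' / 5"
  have d: "d > 0" using \<open>d' > 0\<close> by (simp add: d_def)
  obtain K where K: "K > 0" "\<And>n. n \<ge> 1 \<Longrightarrow> prob (space M - regular_event n K) \<le> d"
    using regular_event_likely[OF d] by blast
  obtain b1 N1 where N1: "N1 \<ge> 1" "\<And>n. n \<ge> N1 \<Longrightarrow> \<exists>E\<in>events. prob E \<le> d \<and>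
    (\<forall>\<omega>\<in>regular_event n K - E. sqrt n * norm (At n \<omega> - Ahat) \<le> b1)"
    using At_rate[OF d K(1)] by blast
  obtain s where s: "s > 0" "\<And>n. n \<ge> 1 \<Longrightarrow> prob {\<omega> \<in> space M. norm (scaled_score n \<omega>) \<ge> s} \<le> d"
    using score_bounded[OF d] by blast
  obtain B where B: "B > 0" "\<And>x. norm (\<Gamma>inv x) \<le> B * norm x"
    using linear_bounded_pos[OF \<Gamma>inv_linear] by blast
  obtain c where c: "c > 0" "\<And>v. v \<in> Tperp \<Longrightarrow> c * (norm v)\<^sup>2 \<le> v \<bullet> \<Gamma> v"
    using hessian_lower_bound by blast
  \<comment> \<open>Large enough for the rescaled estimator, through \<open>b1\<close>, and for the
    minimizer of the form, through \<open>B * s\<close>.\<close>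
  define b where "b = \<bar>b1\<bar> + B * s + 1"
  have "B * s > 0" using B(1) s(1) by simp
  then have b: "b > 0" "b1 \<le> b" "B * s \<le> b" unfolding b_def by linarith+
  \<comment> \<open>A gap of at most \<open>4 * \<kappa>\<close> in the form means
    \<open>c * (norm (h - k))\<^sup>2 \<le> 8 * \<kappa>\<close>, and the right side is
    \<open>c * e\<^sup>2\<close>.\<close>
  define \<kappa> where "\<kappa> = c * e\<^sup>2 / 8"
  have \<kappa>: "\<kappa> > 0" using c(1) e by (simp add: \<kappa>_def)
  obtain N2 where N2: "N2 \<ge> 1" "\<And>n. n \<ge> N2 \<Longrightarrow> \<exists>E\<in>events. prob E \<le> d \<and>
    (\<forall>\<omega>\<in>regular_event n K - E. \<forall>h. norm h \<le> b \<longrightarrow> \<bar>local_process n h \<omega> - h \<bullet> scaled_score n \<omega>\<bar> \<le> \<kappa>)"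
    using local_process_uniform[OF b(1) \<kappa> d K(1)] by blast
  \<comment> \<open>With this tolerance the Taylor remainder at a displacement of norm
    \<open>b / sqrt n\<close>, multiplied by \<open>n\<close>, is at most \<kappa>.\<close>
  have \<kappa>b: "\<kappa> / b\<^sup>2 > 0" using \<kappa> b by simp
  obtain r where r: "r > 0"
    "\<And>v. norm v < r \<Longrightarrow> \<bar>\<Phi> (Ahat + v) - \<Phi> Ahat - (v \<bullet> \<Gamma> v) / 2\<bar> \<le> \<kappa> / b\<^sup>2 * (norm v)\<^sup>2"
    using \<Phi>_expansion[OF \<kappa>b] by blast
  define N where "N = max (max N1 N2) (nat \<lceil>(b / r)\<^sup>2\<rceil> + 1)"
  have "prob {\<omega> \<in> space M. norm (sqrt n *\<^sub>R (At n \<omega> - Ahat) - - \<Gamma>inv (scaled_score n \<omega>)) > e} < d'"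
    if n: "n \<ge> N" for n
  proof -
    have n1: "n \<ge> N1" "n \<ge> N2" "n \<ge> 1" "sqrt n > 0" using n N1(1) by (auto simp: N_def)
    have "(b / r)\<^sup>2 < n" using n by (simp add: N_def) linarith
    then have "sqrt ((b / r)\<^sup>2) < sqrt n" by (rule real_sqrt_less_mono)
    then have br: "b / sqrt n < r" using b(1) r(1) n1(4) by (simp add: pos_divide_less_eq mult.commute)
    obtain E1 where E1: "E1 \<in> events" "prob E1 \<le> d"
      "\<And>\<omega>. \<omega> \<in> regular_event n K - E1 \<Longrightarrow> sqrt n * norm (At n \<omega> - Ahat) \<le> b1"
      using N1(2)[OF n1(1)] by blast
    obtain E2 where E2: "E2 \<in> events" "prob E2 \<le> d"
      "\<And>\<omega> h. \<omega> \<in> regular_event n K - E2 \<Longrightarrow> norm h \<le> b \<Longrightarrow> \<bar>local_process n h \<omega> - h \<bullet> scaled_score n \<omega>\<bar> \<le> \<kappa>"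
      using N2(2)[OF n1(2)] by blast
    define E3 where "E3 = {\<omega> \<in> space M. norm (scaled_score n \<omega>) \<ge> s}"
    have E3: "E3 \<in> events" "prob E3 \<le> d" unfolding E3_def using s(2)[OF n1(3)] by auto
    define E4 where "E4 = space M - regular_event n K"
    have E4: "E4 \<in> events" "prob E4 \<le> d" unfolding E4_def using K(2)[OF n1(3)] by auto
    let ?G = "E1 \<union> E2 \<union> E3 \<union> E4"
    have good: "norm (sqrt n *\<^sub>R (At n \<omega> - Ahat) - - \<Gamma>inv (scaled_score n \<omega>)) \<le> e"
      if \<omega>: "\<omega> \<in> space M - ?G" for \<omega>
    proof -
      have \<omega>M: "\<omega> \<in> space M" and \<omega>R: "\<omega> \<in> regular_event n K" using \<omega> by (auto simp: E4_def)
      define S where "S = scaled_score n \<omega>"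
      define h where "h = sqrt n *\<^sub>R (At n \<omega> - Ahat)"
      define k where "k = - \<Gamma>inv S"
      have hT: "h \<in> Tperp" unfolding h_def by (intro subspace_scale Tperp_subspace At_perp n1 \<omega>M)
      have kT: "k \<in> Tperp" unfolding k_def by (intro subspace_neg Tperp_subspace \<Gamma>inv_in)
      have hb: "norm h \<le> b" using E1(3)[of \<omega>] \<omega> \<omega>R b(2) by (simp add: h_def)
      have "norm S < s" using \<omega> \<omega>M by (auto simp: E3_def S_def not_le)
      then have "B * norm S \<le> B * s" using B(1) by (intro mult_left_mono) auto
      then have kb: "norm k \<le> b" using B(2)[of S] b(3) by (simp add: k_def)
      define L where "L v = (\<Sum>i<n. loss (Ahat + (1 / sqrt n) *\<^sub>R v) (\<zeta> i \<omega>)) - (\<Sum>i<n. loss Ahat (\<zeta> i \<omega>))" for v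
      have approx: "\<bar>L v - (v \<bullet> S + (v \<bullet> \<Gamma> v) / 2)\<bar> \<le> 2 * \<kappa>" if v: "norm v \<le> b" for v
      proof -
        have "norm ((1 / sqrt n) *\<^sub>R v) \<le> b / sqrt n" using v n1(4) by (simp add: divide_right_mono)
        then have "norm ((1 / sqrt n) *\<^sub>R v) < r" using br by simp
        from r(2)[OF this]
        have "\<bar>\<Phi> (Ahat + (1 / sqrt n) *\<^sub>R v) - \<Phi> Ahat - (v \<bullet> \<Gamma> v) / n / 2\<bar> \<le> \<kappa> / b\<^sup>2 * ((norm v)\<^sup>2 / n)"
          by (simp add: linear_cmul[OF \<Gamma>_linear] power_divide)
        also have "\<dots> \<le> \<kappa> / b\<^sup>2 * (b\<^sup>2 / n)"
          using v \<kappa> by (intro mult_left_mono divide_right_mono power_mono) auto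
        also have "\<dots> = \<kappa> / n" using b(1) by simp
        finally have "n * \<bar>\<Phi> (Ahat + (1 / sqrt n) *\<^sub>R v) - \<Phi> Ahat - (v \<bullet> \<Gamma> v) / n / 2\<bar> \<le> \<kappa>"
          using n1 by (simp add: pos_le_divide_eq mult.commute)
        moreover have "n * \<bar>\<Phi> (Ahat + (1 / sqrt n) *\<^sub>R v) - \<Phi> Ahat - (v \<bullet> \<Gamma> v) / n / 2\<bar>
            = \<bar>n * (\<Phi> (Ahat + (1 / sqrt n) *\<^sub>R v) - \<Phi> Ahat) - (v \<bullet> \<Gamma> v) / 2\<bar>"
        proof -
          have "n * \<bar>x - y / n / 2\<bar> = \<bar>n * x - y / 2\<bar>" for x y :: real
          proof -
            have "n * x - y / 2 = n * (x - y / n / 2)" using n1 by (simp add: right_diff_distrib)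
            then show ?thesis by (simp add: abs_mult)
          qed
          then show ?thesis .
        qed
        ultimately have 1: "\<bar>n * (\<Phi> (Ahat + (1 / sqrt n) *\<^sub>R v) - \<Phi> Ahat) - (v \<bullet> \<Gamma> v) / 2\<bar> \<le> \<kappa>" by simp
        have 2: "\<bar>local_process n v \<omega> - v \<bullet> S\<bar> \<le> \<kappa>" using E2(3)[of \<omega> v] \<omega> \<omega>R v by (simp add: S_def)
        have L: "L v = local_process n v \<omega> + n * (\<Phi> (Ahat + (1 / sqrt n) *\<^sub>R v) - \<Phi> Ahat)"
          unfolding L_def loss_sum_diff[OF n1(3)] local_process_def ..
        have "\<bar>(x + y) - (p + q)\<bar> \<le> 2 * \<kappa>" if "\<bar>y - q\<bar> \<le> \<kappa>" "\<bar>x - p\<bar> \<le> \<kappa>" for x y p q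
          using that by (auto simp: abs_le_iff)
        from this[OF 1 2] show ?thesis unfolding L .
      qed
      have "Ahat + (1 / sqrt n) *\<^sub>R h = At n \<omega>" using n1(4) by (simp add: h_def)
      then have "L h \<le> L k" using At_min[OF n1(3) \<omega>M] by (simp add: L_def)
      then have "(h \<bullet> S + (h \<bullet> \<Gamma> h) / 2) - (k \<bullet> S + (k \<bullet> \<Gamma> k) / 2) \<le> 4 * \<kappa>"
        using approx[OF hb] approx[OF kb] by (auto simp: abs_le_iff)
      then have "((h - k) \<bullet> \<Gamma> (h - k)) / 2 \<le> 4 * \<kappa>"
        unfolding quadratic_identity[OF hT k_def] .
      moreover have "c * (norm (h - k))\<^sup>2 \<le> (h - k) \<bullet> \<Gamma> (h - k)"
        by (intro c(2) subspace_diff Tperp_subspace hT kT)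
      ultimately have "c * (norm (h - k))\<^sup>2 \<le> c * e\<^sup>2" by (simp add: \<kappa>_def)
      then have "(norm (h - k))\<^sup>2 \<le> e\<^sup>2" using c(1) by simp
      then show ?thesis using e unfolding h_def k_def S_def by (simp add: power_mono_iff)
    qed
    have "prob {\<omega> \<in> space M. norm (sqrt n *\<^sub>R (At n \<omega> - Ahat) - - \<Gamma>inv (scaled_score n \<omega>)) > e} \<le> prob ?G"
    proof (rule finite_measure_mono)
      show "{\<omega> \<in> space M. norm (sqrt n *\<^sub>R (At n \<omega> - Ahat) - - \<Gamma>inv (scaled_score n \<omega>)) > e} \<subseteq> ?G"
      proof
        fix \<omega> assume \<omega>: "\<omega> \<in> {\<omega> \<in> space M. norm (sqrt n *\<^sub>R (At n \<omega> - Ahat) - - \<Gamma>inv (scaled_score n \<omega>)) > e}"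
        show "\<omega> \<in> ?G"
        proof (rule ccontr)
          assume "\<omega> \<notin> ?G"
          then have "\<omega> \<in> space M - ?G" using \<omega> by blast
          from good[OF this] \<omega> show False by simp
        qed
      qed
      show "?G \<in> events" using E1(1) E2(1) E3(1) E4(1) by (intro sets.Un)
    qed
    also have "\<dots> \<le> prob E1 + prob E2 + prob E3 + prob E4"
      using measure_Un_le[OF sets.Un[OF sets.Un[OF E1(1) E2(1)] E3(1)] E4(1)]
        measure_Un_le[OF sets.Un[OF E1(1) E2(1)] E3(1)] measure_Un_le[OF E1(1) E2(1)] by linarith
    also have "\<dots> \<le> 4 * d" using E1(2) E2(2) E3(2) E4(2) by linarith
    also have "\<dots> < d'" using \<open>d' > 0\<close> by (simp add: d_def)
    finally show ?thesis .
  qed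
  then show "\<exists>no. \<forall>n\<ge>no. norm (prob {\<omega> \<in> space M. norm (sqrt n *\<^sub>R (At n \<omega> - Ahat) - - \<Gamma>inv (scaled_score n \<omega>)) > e} - 0) < d'"
    by (intro exI[of _ N]) simp
qed

end

section \<open>Covariance of the score and the limit law\<close>

context shape_normality begin

definition score_cov :: "real ^ 'q ^ 'd \<Rightarrow> real ^ 'q ^ 'd" where
  "score_cov h = (\<integral>z. (grad z \<bullet> h) *\<^sub>R grad z \<partial>(sphere_uniform \<Otimes>\<^sub>M \<nu>))"

lemma score_cov_integrable: "integrable (sphere_uniform \<Otimes>\<^sub>M \<nu>) (\<lambda>z. (grad z \<bullet> h) *\<^sub>R grad z)"
proof -
  have "(grad z \<bullet> h) *\<^sub>R grad z = (\<Sum>b\<in>Basis. ((h \<bullet> grad z) * (b \<bullet> grad z)) *\<^sub>R b)" for z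
  proof -
    have "(grad z \<bullet> h) *\<^sub>R grad z = (\<Sum>b\<in>Basis. (((grad z \<bullet> h) *\<^sub>R grad z) \<bullet> b) *\<^sub>R b)"
      by (rule euclidean_representation[symmetric])
    then show ?thesis by (simp add: inner_commute)
  qed
  then show ?thesis
    using grad_product_integrable by (simp only:) (intro Bochner_Integration.integrable_sum integrable_scaleR_left)
qed

lemma score_cov_inner:
  "score_cov h \<bullet> k = (\<integral>z. (h \<bullet> grad z) * (k \<bullet> grad z) \<partial>(sphere_uniform \<Otimes>\<^sub>M \<nu>))"
proof -
  have "score_cov h \<bullet> k = (\<integral>z. ((grad z \<bullet> h) *\<^sub>R grad z) \<bullet> k \<partial>(sphere_uniform \<Otimes>\<^sub>M \<nu>))"
    unfolding score_cov_def by (rule integral_inner_left[symmetric]) (rule score_cov_integrable)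
  then show ?thesis by (simp add: inner_commute)
qed

lemma score_cov_linear: "linear score_cov"
proof (rule linearI)
  show "score_cov (h + k) = score_cov h + score_cov k" for h k
    unfolding score_cov_def using score_cov_integrable
    by (simp add: inner_add_right scaleR_add_left)
  show "score_cov (r *\<^sub>R h) = r *\<^sub>R score_cov h" for r h
    unfolding score_cov_def by (simp flip: scaleR_scaleR)
qed

lemma score_cov_eq:
  "score_cov = second_moment_op (regression_law Kstar \<nu>) (\<lambda>z. gradient (\<lambda>A. sq_loss C A z) Ahat)"
proof
  fix h
  have G: "gradient (\<lambda>A. sq_loss C A z) Ahat = grad (residuals z)" for z
    by (simp add: grad_def loss_eq observations_residuals)
  have gb: "grad \<in> borel_measurable borel"
    using grad_measurable by (simp only: measurable_cong_sets[OF sets_S refl])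
  have [measurable]: "(\<lambda>z. grad (residuals z)) \<in> borel_measurable borel"
    by (rule measurable_compose[OF residuals_measurable gb])
  have "second_moment_op (regression_law Kstar \<nu>) (\<lambda>z. gradient (\<lambda>A. sq_loss C A z) Ahat) h
      = (\<integral>z. (grad (residuals z) \<bullet> h) *\<^sub>R grad (residuals z) \<partial>distr (sphere_uniform \<Otimes>\<^sub>M \<nu>) borel observations)"
    unfolding second_moment_op_def regression_law_eq G ..
  also have "\<dots> = score_cov h"
    by (subst integral_distr)
      (simp_all add: measurable_cong_sets[OF sets_S refl] residuals_observations score_cov_def)
  finally show "score_cov h = second_moment_op (regression_law Kstar \<nu>) (\<lambda>z. gradient (\<lambda>A. sq_loss C A z) Ahat) h" ..
qed

lemma sandwich_eq: "sandwich Tperp \<Gamma> score_cov h = \<Gamma>inv (score_cov (\<Gamma>inv h))"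
  by (rule sandwich_eq_compression_inverse)

lemma sandwich_inner:
  "sandwich Tperp \<Gamma> score_cov h \<bullet> k = (\<integral>z. (\<Gamma>inv h \<bullet> grad z) * (\<Gamma>inv k \<bullet> grad z) \<partial>(sphere_uniform \<Otimes>\<^sub>M \<nu>))"
  by (simp only: sandwich_eq \<Gamma>inv_symmetric score_cov_inner)

text \<open>By symmetry of the compressed inverse it can be moved onto the test vectors, so the
  variance of its product with the score in direction \<open>h\<close> is the score covariance
  evaluated at \<open>\<Gamma>inv h\<close>, which is the \<open>sandwich\<close> form. The minus
  sign of the linearization does not affect it.\<close>

theorem asymptotic_normality:
  "\<exists>N. is_gaussian N 0 (sandwich Tperp \<Gamma> score_cov) \<and>
    converges_weakly (\<lambda>n. distr M borel (\<lambda>\<omega>. sqrt (real n) *\<^sub>R (At n \<omega> - Ahat))) N"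
proof -
  let ?Q = "sandwich Tperp \<Gamma> score_cov"
  have lin: "linear ?Q"
    using linear_compose[OF linear_compose[OF \<Gamma>inv_linear score_cov_linear] \<Gamma>inv_linear]
    by (simp add: comp_def sandwich_eq[abs_def])
  have sym: "?Q h \<bullet> k = h \<bullet> ?Q k" for h k
    unfolding sandwich_inner inner_commute[of h] by (simp add: mult.commute)
  have pos: "?Q h \<bullet> h \<ge> 0" for h
    unfolding sandwich_inner by (rule integral_nonneg_AE) simp
  obtain m v where "\<And>h. ?Q h = (\<Sum>i<(m::nat). (v i \<bullet> h) *\<^sub>R v i)"
    using psd_sum_of_rank_one[OF lin sym pos] by blast
  from is_gaussian_exists[OF lin sym pos this] obtain N where N: "is_gaussian N 0 ?Q" by blast
  define Y where "Y i \<omega> = - \<Gamma>inv (grad (\<zeta> i \<omega>))" for i \<omega>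
  have cont: "(\<lambda>x. - \<Gamma>inv x) \<in> borel_measurable borel"
    using \<Gamma>inv_linear by (intro borel_measurable_continuous_onI continuous_intros linear_continuous_on)
      (simp add: linear_conv_bounded_linear)
  have Y_grad: "(\<lambda>z. - \<Gamma>inv (grad z)) \<in> borel_measurable (sphere_uniform \<Otimes>\<^sub>M \<nu>)"
    by (rule measurable_compose[OF grad_measurable cont])
  have Yh: "Y i \<omega> \<bullet> h = - (grad (\<zeta> i \<omega>) \<bullet> \<Gamma>inv h)" for i \<omega> h
    by (simp add: Y_def \<Gamma>inv_symmetric)
  have sumY: "(1 / sqrt n) *\<^sub>R (\<Sum>i<n. Y i \<omega>) = - \<Gamma>inv (scaled_score n \<omega>)" for n \<omega>
    by (simp add: Y_def scaled_score_def sum_negf linear_cmul[OF \<Gamma>inv_linear] linear_sum[OF \<Gamma>inv_linear])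
  have "converges_weakly (\<lambda>n. distr M borel (\<lambda>\<omega>. sqrt (real n) *\<^sub>R (At n \<omega> - Ahat))) N"
  proof (rule central_limit_Slutsky[where Y = Y and Q = ?Q])
    show "indep_vars (\<lambda>_. borel) Y UNIV"
      unfolding Y_def by (rule indep_vars_compose2[OF indep Y_grad])
    show "distr M borel (Y n) = distr (sphere_uniform \<Otimes>\<^sub>M \<nu>) borel (\<lambda>z. - \<Gamma>inv (grad z))" for n
      using distr_distr[OF Y_grad \<zeta>_measurable, of n] unfolding law Y_def comp_def by simp
    show "integrable M (\<lambda>\<omega>. (Y i \<omega> \<bullet> h)\<^sup>2)" for i h
      unfolding Yh using score_second_moment(1)[of i "\<Gamma>inv h"] by simp
    show "expectation (\<lambda>\<omega>. Y i \<omega> \<bullet> h) = 0" for i h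
      unfolding Yh using score_mean[of i "\<Gamma>inv h"] by simp
    show "expectation (\<lambda>\<omega>. (Y i \<omega> \<bullet> h)\<^sup>2) = ?Q h \<bullet> h" for i h
      unfolding Yh sandwich_inner using score_second_moment(2)[of i "\<Gamma>inv h"] by (simp add: power2_eq_square)
    show "(\<lambda>\<omega>. sqrt (real n) *\<^sub>R (At n \<omega> - Ahat)) \<in> borel_measurable M" if "n \<ge> 1" for n
      using At_measurable[OF that] by measurable
    show "(\<lambda>n. prob {\<omega> \<in> space M. norm (sqrt (real n) *\<^sub>R (At n \<omega> - Ahat) - (1 / sqrt n) *\<^sub>R (\<Sum>i<n. Y i \<omega>)) > e}) \<longlonglongrightarrow> 0"
      if "e > 0" for e
      unfolding sumY by (rule At_linearization[OF that])
  qed (fact N)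
  then show ?thesis using N by blast
qed

end

theorem theorem3p4:
  fixes Kstar :: "(real ^ 'd) set" and C :: "(real ^ 'q) set"
    and \<nu> :: "real measure" and \<sigma> :: real
    and M :: "'w measure" and Z :: "nat \<Rightarrow> 'w \<Rightarrow> (real ^ 'd) \<times> real"
    and Ahat :: "real ^ 'q ^ 'd" and \<Gamma> :: "real ^ 'q ^ 'd \<Rightarrow> real ^ 'q ^ 'd"
    and Ahat_seq Atilde :: "nat \<Rightarrow> 'w \<Rightarrow> real ^ 'q ^ 'd"
  defines "P \<equiv> regression_law Kstar \<nu>"
  defines "T \<equiv> tangent_space (risk_minimizers C P) Ahat"
  assumes Kstar: "compact Kstar" "convex Kstar" "Kstar \<noteq> {}"
    and C: "compact C" "convex C" "C \<noteq> {}"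
    and Aut_C: "Aut C \<subseteq> {g. orthogonal_matrix g}"
    and noise_law: "prob_space \<nu>" "sets \<nu> = sets borel"
    and noise_mean: "integrable \<nu> (\<lambda>e. e)" "(\<integral>e. e \<partial>\<nu>) = 0"
    and noise_variance: "integrable \<nu> (\<lambda>e. e\<^sup>2)" "(\<integral>e. e\<^sup>2 \<partial>\<nu>) = \<sigma>\<^sup>2"
    and M: "prob_space M"
    and Z_indep: "prob_space.indep_vars M (\<lambda>_. borel) Z UNIV"
    and Z_law: "\<And>i. distr M borel (Z i) = P"
    and minimizers: "risk_minimizers C P = orbit Ahat C"
    and support_diff: "AE (u, y) in P. support_fun C differentiable (at (transpose Ahat *v u))"
    and hessian: "has_hessian (\<lambda>A. risk C A P) \<Gamma> Ahat"
    and hessian_pos: "\<And>H. H \<in> orthogonal_comp T \<Longrightarrow> H \<noteq> 0 \<Longrightarrow> H \<bullet> \<Gamma> H > 0"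
    and VC: "VC_class (loss_quotient_graphs C Ahat)"
    and Ahat_seq: "\<And>n \<omega>. n \<ge> 1 \<Longrightarrow> \<omega> \<in> space M \<Longrightarrow>
      Ahat_seq n \<omega> \<in> risk_minimizers C (empirical_measure n (\<lambda>i. Z i \<omega>))"
    and Atilde: "\<And>n \<omega>. n \<ge> 1 \<Longrightarrow> \<omega> \<in> space M \<Longrightarrow>
      Atilde n \<omega> \<in> argmin_set (\<lambda>A. norm (Ahat - A)) (orbit (Ahat_seq n \<omega>) C)"
    and Atilde_measurable: "\<And>n. n \<ge> 1 \<Longrightarrow> Atilde n \<in> borel_measurable M"
  shows "\<exists>N. is_gaussian N 0
               (sandwich (orthogonal_comp T) \<Gamma>
                 (second_moment_op P (\<lambda>z. gradient (\<lambda>A. sq_loss C A z) Ahat))) \<and>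
             converges_weakly
               (\<lambda>n. distr M borel (\<lambda>\<omega>. sqrt (real n) *\<^sub>R (Atilde n \<omega> - Ahat))) N"
proof -
  interpret R: shape_regression M Kstar C \<nu> Z
    using Kstar C noise_law noise_mean noise_variance M Z_indep Z_law
    by (intro shape_regression.intro shape_regression_axioms.intro) (simp_all add: P_def)
  have T: "T = tangent_space (orbit Ahat C) Ahat"
    by (simp only: T_def minimizers)
  have \<Phi>: "(\<lambda>A. risk C A P) = R.\<Phi>"
    by (simp add: fun_eq_iff P_def R.risk_\<Phi>)
  have empirical: "Ahat_seq n \<omega> \<in> {A. \<forall>B. (\<Sum>i<n. R.loss A (R.\<zeta> i \<omega>)) \<le> (\<Sum>i<n. R.loss B (R.\<zeta> i \<omega>))}"
    if n: "n \<ge> 1" and \<omega>: "\<omega> \<in> space M" for n \<omega>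
  proof -
    have "\<not> (\<Sum>i<n. sq_loss C B (Z i \<omega>)) / n < (\<Sum>i<n. sq_loss C (Ahat_seq n \<omega>) (Z i \<omega>)) / n" for B :: "real ^ 'q ^ 'd"
      using Ahat_seq[OF n \<omega>] unfolding risk_minimizers_def argmin_set_def is_arg_min_def
      by (simp add: risk_empirical_measure[OF C(1,3)])
    then show ?thesis using n by (simp add: R.loss_\<zeta> divide_less_cancel not_less)
  qed
  have orbit: "\<exists>g\<in>Aut C. Atilde n \<omega> = Ahat_seq n \<omega> ** g" and closest: "\<And>g. g \<in> Aut C \<Longrightarrow> norm (Ahat - Atilde n \<omega>) \<le> norm (Ahat - Ahat_seq n \<omega> ** g)"
    if n: "n \<ge> 1" and \<omega>: "\<omega> \<in> space M" for n \<omega>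
    using Atilde[OF n \<omega>] unfolding argmin_set_def is_arg_min_def orbit_def by (auto simp: not_less)
  interpret shape_normality M Kstar C \<nu> Z Ahat Atilde \<Gamma>
  proof (intro shape_normality.intro shape_asymptotics.intro shape_estimator.intro
      shape_normality_axioms.intro shape_asymptotics_axioms.intro shape_estimator_axioms.intro)
    show "shape_regression M Kstar C \<nu> Z" by (rule R.shape_regression_axioms)
    show "Aut C \<subseteq> {g. orthogonal_matrix g}" by (rule Aut_C)
    show "risk_minimizers C (regression_law Kstar \<nu>) = orbit Ahat C" using minimizers by (simp only: P_def)
    show "Atilde n \<in> borel_measurable M" if "n \<ge> 1" for n by (rule Atilde_measurable[OF that])
    show "(\<Sum>i<n. R.loss (Atilde n \<omega>) (R.\<zeta> i \<omega>)) \<le> (\<Sum>i<n. R.loss B (R.\<zeta> i \<omega>))"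
      if n: "n \<ge> 1" and \<omega>: "\<omega> \<in> space M" for n \<omega> B
    proof -
      obtain g where g: "g \<in> Aut C" "Atilde n \<omega> = Ahat_seq n \<omega> ** g" using orbit[OF n \<omega>] by blast
      have "R.loss (Atilde n \<omega>) = R.loss (Ahat_seq n \<omega>)"
        by (simp add: R.loss_def g(2) R.hC_Aut[OF g(1)])
      then show ?thesis using empirical[OF n \<omega>] by simp
    qed
    show "norm (Ahat - Atilde n \<omega>) \<le> norm (Ahat ** g - Atilde n \<omega>)"
      if n: "n \<ge> 1" and \<omega>: "\<omega> \<in> space M" and g: "g \<in> Aut C" for n \<omega> g
    proof -
      obtain g0 where g0: "g0 \<in> Aut C" "Atilde n \<omega> = Ahat_seq n \<omega> ** g0" using orbit[OF n \<omega>] by blast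
      have t: "transpose g \<in> Aut C" "g ** transpose g = mat 1"
        using Aut_subgroup(3)[OF Aut_C g] by auto
      have o: "orthogonal_matrix (transpose g)" using t(1) Aut_C by blast
      \<comment> \<open>Closeness is applied to the competitor
        \<open>Atilde n \<omega> ** transpose g\<close> in the orbit of the estimator; the isometry
        \<open>transpose g\<close> then transfers the motion to \<open>Ahat\<close>.\<close>
      have "norm (Ahat - Atilde n \<omega>) \<le> norm (Ahat - Ahat_seq n \<omega> ** (g0 ** transpose g))"
        by (rule closest[OF n \<omega> Aut_subgroup(2)[OF Aut_C g0(1) t(1)]])
      also have "Ahat_seq n \<omega> ** (g0 ** transpose g) = Atilde n \<omega> ** transpose g"
        by (simp add: g0(2) matrix_mul_assoc)
      also have "Ahat - Atilde n \<omega> ** transpose g = (Ahat ** g - Atilde n \<omega>) ** transpose g"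
      proof -
        have "(Ahat ** g - Atilde n \<omega>) ** transpose g = Ahat ** g ** transpose g - Atilde n \<omega> ** transpose g"
          by (simp add: vec_eq_iff matrix_matrix_mult_def left_diff_distrib sum_subtractf)
        also have "Ahat ** g ** transpose g = Ahat" by (simp add: matrix_mul_assoc[symmetric] t(2))
        finally show ?thesis ..
      qed
      finally show ?thesis by (simp only: norm_matrix_mult_orthogonal[OF o])
    qed
    show "AE (u, y) in regression_law Kstar \<nu>. support_fun C differentiable (at (transpose Ahat *v u))"
      using support_diff by (simp only: P_def)
    show "has_hessian R.\<Phi> \<Gamma> Ahat" using hessian by (simp only: \<Phi>)
    show "H \<bullet> \<Gamma> H > 0" if "H \<in> orthogonal_comp (tangent_space (orbit Ahat C) Ahat)" "H \<noteq> 0" for H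
      using hessian_pos[of H] that unfolding T by blast
  qed
  have "orthogonal_comp T = Tperp" by (simp only: T Tperp_def)
  then show ?thesis
    unfolding P_def score_cov_eq[symmetric] using asymptotic_normality by (simp only:)
qed

end
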